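(* Let $X$ be a projective $n$-dimensional toric variety not isomorphic to $\mathbb{P}^{n}$. Let $D$ and $D'$ be $T$-$\mathbb{Q}$-Cartier divisors on $X$ such that $0 \geq D' \geq K_{X}$ and $D \cdot C \geq n+1$ for all $T$-curves $C$ on $X$. Then $P_{D+D'}^{\sigma} \cap M$ generates the semigroup $\sigma^{\vee} \cap M$ for all maximal cones $\sigma$ in the fan defining $X$.
   Context: Toric varieties are normal, over a fixed algebraically closed field (of any characteristic), with dense torus $T$, and arbitrary singularities are allowed. $M$ is the character lattice of $T$, $N$ is its dual lattice, $\langle\ ,\ \rangle$ is the pairing, and $M_{\mathbb{Q}} = M \otimes \mathbb{Q}$. The variety $X$ is defined by a fan in $N$; $v_i$ denotes the primitive generator of the $i$-th ray of the fan, and $D_i$ the corresponding $T$-invariant prime divisor. The canonical divisor is fixed to be $K_X = -\sum_i D_i$. A $T$-$\mathbb{Q}$-Cartier divisor is a $\mathbb{Q}$-linear combination $\sum_i d_i D_i$ some positive integer multiple of which is Cartier. Inequalities between divisors are coefficientwise: $0 \geq D' \geq K_X$ means $D' = \sum_i d'_i D_i$ with $-1 \leq d'_i \leq 0$ for all $i$. A $T$-curve is a $T$-invariant complete irreducible curve in $X$, i.e. the orbit closure $V(\omega)$ of an $(n-1)$-dimensional cone $\omega$ of the fan. For a maximal cone $\sigma$ of the fan, $\sigma^\vee \subset M_{\mathbb{Q}}$ is the dual cone. For a $T$-$\mathbb{Q}$-Cartier divisor $E = \sum_i e_i D_i$ on $X$ and a maximal cone $\sigma$, let $u_\sigma(E)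 \in M_{\mathbb{Q}}$ be the unique point with $\langle u_\sigma(E), v_i\rangle = -e_i$ for every primitive generator $v_i$ of a ray of $\sigma$. Let $P_E = \{u \in M_{\mathbb{Q}} \mid \langle u, v_i \rangle \geq -e_i \text{ for all } i\}$, where $v_i$ ranges over the primitive generators of all rays of the fan, and let $P_E^\sigma := P_E - u_\sigma(E)$, which is contained in $\sigma^\vee$. A subset $S \subset \sigma^\vee \cap M$ generates $\sigma^\vee \cap M$ if every element of $\sigma^\vee\cap M$ is a nonnegative integer linear combination of elements of $S$. *)

theory Defs
  imports "HOL-Analysis.Analysis" "HOL-Computational_Algebra.Polynomial"
begin

section \<open>Varieties over an algebraically closed field as spaces with regular functions\<close>

text \<open>
  A (possibly singular, reduced) variety is given by its set of closed points, covered by affine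
  charts. A chart \<open>(U, A)\<close> consists of a set \<open>U\<close> of points and its coordinate ring \<open>A\<close>, an algebra of
  functions; only the restrictions to \<open>U\<close> of the members of \<open>A\<close> matter.
\<close>

type_synonym ('p, 'k) atlas = "('p set \<times> ('p \<Rightarrow> 'k) set) set"

inductive_set algebra_gen :: "('p \<Rightarrow> 'k::field) set \<Rightarrow> ('p \<Rightarrow> 'k) set"
  for S :: "('p \<Rightarrow> 'k) set" where
  const: "(\<lambda>_. c) \<in> algebra_gen S"
| gen: "f \<in> S \<Longrightarrow> f \<in> algebra_gen S"
| add: "f \<in> algebra_gen S \<Longrightarrow> g \<in> algebra_gen S \<Longrightarrow> (\<lambda>z. f z + g z) \<in> algebra_gen S"
| mult: "f \<in> algebra_gen S \<Longrightarrow> g \<in> algebra_gen S \<Longrightarrow> (\<lambda>z. f z * g z) \<in> algebra_gen S"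

definition pts :: "('p, 'k) atlas \<Rightarrow> 'p set" where
  "pts At = (\<Union>(U, A)\<in>At. U)"

text \<open>Zariski topology: the open sets are the unions of principal open subsets of the charts.\<close>

definition zariski_open :: "('p, 'k::field) atlas \<Rightarrow> 'p set \<Rightarrow> bool" where
  "zariski_open At W \<longleftrightarrow>
     (\<forall>x\<in>W. \<exists>(U, A)\<in>At. x \<in> U \<and> (\<exists>q\<in>A. q x \<noteq> 0 \<and> {z\<in>U. q z \<noteq> 0} \<subseteq> W))"

definition zariski_closed :: "('p, 'k::field) atlas \<Rightarrow> 'p set \<Rightarrow> bool" where
  "zariski_closed At Z \<longleftrightarrow> Z \<subseteq> pts At \<and> zariski_open At (pts At - Z)"

definition regular_on :: "('p, 'k::field) atlas \<Rightarrow> 'p set \<Rightarrow> ('p \<Rightarrow> 'k) \<Rightarrow> bool" where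
  "regular_on At W f \<longleftrightarrow>
     (\<forall>x\<in>W. \<exists>(U, A)\<in>At. x \<in> U \<and>
        (\<exists>p\<in>A. \<exists>q\<in>A. q x \<noteq> 0 \<and> (\<forall>z\<in>U \<inter> W. q z \<noteq> 0 \<longrightarrow> f z = p z / q z)))"

definition morphism :: "('p, 'k::field) atlas \<Rightarrow> ('q, 'k) atlas \<Rightarrow> ('p \<Rightarrow> 'q) \<Rightarrow> bool" where
  "morphism At Bt \<phi> \<longleftrightarrow>
     \<phi> ` pts At \<subseteq> pts Bt \<and>
     (\<forall>W. zariski_open Bt W \<longrightarrow>
        zariski_open At (pts At \<inter> \<phi> -` W) \<and>
        (\<forall>f. regular_on Bt W f \<longrightarrow> regular_on At (pts At \<inter> \<phi> -` W) (f \<circ> \<phi>)))"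

definition isomorphic :: "('p, 'k::field) atlas \<Rightarrow> ('q, 'k) atlas \<Rightarrow> bool" where
  "isomorphic At Bt \<longleftrightarrow>
     (\<exists>\<phi> \<psi>. morphism At Bt \<phi> \<and> morphism Bt At \<psi> \<and>
        (\<forall>x\<in>pts At. \<psi> (\<phi> x) = x) \<and> (\<forall>y\<in>pts Bt. \<phi> (\<psi> y) = y))"

text \<open>The reduced structure on a closed subset \<open>Z\<close>.\<close>

definition subvariety :: "('p, 'k) atlas \<Rightarrow> 'p set \<Rightarrow> ('p, 'k) atlas" where
  "subvariety At Z = (\<lambda>(U, A). (U \<inter> Z, A)) ` At"


subsection \<open>Projective space and projectivity\<close>

text \<open>Points are the lines through the origin of $k^{m+1}$, without the origin.\<close>

definition proj_points :: "nat \<Rightarrow> (nat \<Rightarrow> 'k::field) set set" where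
  "proj_points m = {{\<lambda>i. c * x i | c. c \<noteq> 0} | x. (\<forall>i>m. x i = 0) \<and> (\<exists>i. x i \<noteq> 0)}"

text \<open>The function \<open>x\<^sub>i / x\<^sub>j\<close>; it does not depend on the chosen homogeneous coordinates.\<close>

definition proj_ratio :: "nat \<Rightarrow> nat \<Rightarrow> (nat \<Rightarrow> 'k::field) set \<Rightarrow> 'k" where
  "proj_ratio i j L = (SOME x. x \<in> L) i / (SOME x. x \<in> L) j"

definition proj_space :: "nat \<Rightarrow> ((nat \<Rightarrow> 'k::field) set, 'k) atlas" where
  "proj_space m =
     (\<lambda>j. ({L \<in> proj_points m. \<forall>x\<in>L. x j \<noteq> 0}, algebra_gen {proj_ratio i j | i. i \<le> m})) ` {..m}"

definition projective :: "('p, 'k::field) atlas \<Rightarrow> bool" where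
  "projective At \<longleftrightarrow>
     (\<exists>m Z. zariski_closed (proj_space m) Z \<and> isomorphic At (subvariety (proj_space m) Z))"


subsection \<open>Order of vanishing at a point of a smooth curve\<close>

text \<open>\<open>t\<close> generates the maximal ideal of the local ring at \<open>x\<close>.\<close>

definition uniformizer :: "('p, 'k::field) atlas \<Rightarrow> 'p \<Rightarrow> ('p \<Rightarrow> 'k) \<Rightarrow> bool" where
  "uniformizer At x t \<longleftrightarrow>
     (\<exists>W. zariski_open At W \<and> x \<in> W \<and> regular_on At W t) \<and> t x = 0 \<and>
     (\<forall>W g. zariski_open At W \<and> x \<in> W \<and> regular_on At W g \<and> g x = 0 \<longrightarrow>
        (\<exists>W' h. zariski_open At W' \<and> x \<in> W' \<and> W' \<subseteq> W \<and> regular_on At W' h \<and>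
           (\<forall>z\<in>W'. g z = t z * h z)))"

text \<open>\<open>f\<close> is a rational function, of interest on a punctured neighbourhood of \<open>x\<close> only.\<close>

definition has_order :: "('p, 'k::field) atlas \<Rightarrow> 'p \<Rightarrow> ('p \<Rightarrow> 'k) \<Rightarrow> int \<Rightarrow> bool" where
  "has_order At x f k \<longleftrightarrow>
     (\<exists>t h W. uniformizer At x t \<and> zariski_open At W \<and> x \<in> W \<and>
        regular_on At W h \<and> (\<forall>z\<in>W. h z \<noteq> 0) \<and>
        (\<forall>z\<in>W - {x}. t z \<noteq> 0 \<and> f z = (t z) powi k * h z))"


section \<open>Lattices, cones and fans\<close>

text \<open>
  Choosing a basis of \<open>N\<close> and the dual basis of \<open>M\<close>, both lattices become the set of integral vectors,
  $M_{\mathbb{Q}}$ becomes the set of rational vectors, and the pairing becomes the inner product.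
  Cones of the fan are taken in $N_{\mathbb{R}}$.
\<close>

definition int_lattice :: "(real^'n::finite) set" where
  "int_lattice = {u. \<forall>i. u $ i \<in> \<int>}"

definition rat_vectors :: "(real^'n::finite) set" where
  "rat_vectors = {u. \<forall>i. u $ i \<in> \<rat>}"

definition rational_cone :: "(real^'n::finite) set \<Rightarrow> bool" where
  "rational_cone \<sigma> \<longleftrightarrow>
     (\<exists>S. finite S \<and> S \<subseteq> int_lattice \<and> \<sigma> = convex_cone hull S) \<and>
     (\<forall>v. v \<in> \<sigma> \<and> - v \<in> \<sigma> \<longrightarrow> v = 0)"

text \<open>The empty set is a face in the sense of \<open>face_of\<close>, but not a face of a cone.\<close>

definition cone_face :: "(real^'n::finite) set \<Rightarrow> (real^'n) set \<Rightarrow> bool" where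
  "cone_face \<tau> \<sigma> \<longleftrightarrow> \<tau> face_of \<sigma> \<and> \<tau> \<noteq> {}"

definition fan :: "(real^'n::finite) set set \<Rightarrow> bool" where
  "fan \<Sigma> \<longleftrightarrow>
     finite \<Sigma> \<and> \<Sigma> \<noteq> {} \<and>
     (\<forall>\<sigma>\<in>\<Sigma>. rational_cone \<sigma>) \<and>
     (\<forall>\<sigma>\<in>\<Sigma>. \<forall>\<tau>. cone_face \<tau> \<sigma> \<longrightarrow> \<tau> \<in> \<Sigma>) \<and>
     (\<forall>\<sigma>\<in>\<Sigma>. \<forall>\<sigma>'\<in>\<Sigma>. cone_face (\<sigma> \<inter> \<sigma>') \<sigma> \<and> cone_face (\<sigma> \<inter> \<sigma>') \<sigma>')"

definition maximal_cones :: "(real^'n::finite) set set \<Rightarrow> (real^'n) set set" where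
  "maximal_cones \<Sigma> = {\<sigma>\<in>\<Sigma>. \<forall>\<tau>\<in>\<Sigma>. \<sigma> \<subseteq> \<tau> \<longrightarrow> \<tau> = \<sigma>}"

definition rays :: "(real^'n::finite) set set \<Rightarrow> (real^'n) set set" where
  "rays \<Sigma> = {\<rho>\<in>\<Sigma>. dim \<rho> = 1}"

definition rays_of :: "(real^'n::finite) set \<Rightarrow> (real^'n) set set" where
  "rays_of \<sigma> = {\<rho>. cone_face \<rho> \<sigma> \<and> dim \<rho> = 1}"

definition prim_gen :: "(real^'n::finite) set \<Rightarrow> real^'n" where
  "prim_gen \<rho> = (THE v. \<rho> \<inter> int_lattice = range (\<lambda>k::nat. real k *\<^sub>R v))"

definition dual_cone :: "(real^'n::finite) set \<Rightarrow> (real^'n) set" where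
  "dual_cone \<sigma> = {u\<in>rat_vectors. \<forall>v\<in>\<sigma>. 0 \<le> u \<bullet> v}"

definition perp_lattice :: "(real^'n::finite) set \<Rightarrow> (real^'n) set" where
  "perp_lattice \<tau> = {u\<in>int_lattice. \<forall>v\<in>\<tau>. u \<bullet> v = 0}"


section \<open>The toric variety of a fan\<close>

text \<open>
  A closed point of $U_\sigma = \mathrm{Spec}\, k[\sigma^\vee \cap M]$ is a homomorphism from the
  semigroup $\sigma^\vee \cap M$ to the multiplicative monoid of \<open>k\<close>. The places where it does not
  vanish form $\tau^\perp \cap \sigma^\vee \cap M$ for exactly one face $\tau$ of $\sigma$, and on
  these it extends uniquely to a group homomorphism \<open>g\<close> from $\tau^\perp \cap M$ to $k^*$. The point
  is encoded as \<open>(\<tau>, g)\<close>, with \<open>g\<close> extended by \<open>0\<close>: it lies in the torus orbit of $\tau$, and the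
  homomorphism is the restriction of \<open>g\<close> to $\sigma^\vee \cap M$. The encoding does not depend
  on $\sigma$, so that gluing along common faces is the identification of equal pairs.
\<close>

type_synonym ('n, 'k) toric_point = "(real^'n) set \<times> (real^'n \<Rightarrow> 'k)"

definition orbit :: "(real^'n::finite) set \<Rightarrow> ('n, 'k::field) toric_point set" where
  "orbit \<tau> = {(\<tau>, g) | g.
     (\<forall>u\<in>perp_lattice \<tau>. g u \<noteq> 0) \<and>
     (\<forall>u\<in>perp_lattice \<tau>. \<forall>u'\<in>perp_lattice \<tau>. g (u + u') = g u * g u') \<and>
     (\<forall>u. u \<notin> perp_lattice \<tau> \<longrightarrow> g u = 0)}"

definition character :: "real^'n::finite \<Rightarrow> ('n, 'k) toric_point \<Rightarrow> 'k" where
  "character u x = snd x u"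

definition toric_chart ::
  "(real^'n::finite) set \<Rightarrow> ('n, 'k::field) toric_point set \<times> (('n, 'k) toric_point \<Rightarrow> 'k) set" where
  "toric_chart \<sigma> =
     (\<Union>\<tau>\<in>{\<tau>. cone_face \<tau> \<sigma>}. orbit \<tau>, algebra_gen {character u | u. u \<in> dual_cone \<sigma> \<inter> int_lattice})"

definition toric_variety ::
  "(real^'n::finite) set set \<Rightarrow> (('n, 'k::field) toric_point, 'k) atlas" where
  "toric_variety \<Sigma> = toric_chart ` \<Sigma>"

text \<open>The orbit closure $V(\tau)$ is the union of the orbits of the cones having $\tau$ as a face.\<close>

definition orbit_closure ::
  "(real^'n::finite) set set \<Rightarrow> (real^'n) set \<Rightarrow> ('n, 'k::field) toric_point set" where
  "orbit_closure \<Sigma> \<tau> = (\<Union>\<gamma>\<in>{\<gamma>\<in>\<Sigma>. cone_face \<tau> \<gamma>}. orbit \<gamma>)"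

definition T_curve ::
  "(real^'n::finite) set set \<Rightarrow> ('n, 'k::field) toric_point set \<Rightarrow> bool" where
  "T_curve \<Sigma> C \<longleftrightarrow> (\<exists>\<omega>\<in>\<Sigma>. Suc (dim \<omega>) = CARD('n) \<and> C = orbit_closure \<Sigma> \<omega>)"


section \<open>Torus-invariant divisors\<close>

text \<open>
  A divisor $\sum_i d_i D_i$ is given by its coefficients, indexed by the rays \<open>\<rho>\<close> of the fan, where
  the prime divisor of \<open>\<rho>\<close> is \<open>orbit_closure \<Sigma> \<rho>\<close>. Coefficients at other sets are irrelevant.
\<close>

type_synonym 'n T_divisor = "(real^'n) set \<Rightarrow> real"

definition canonical_divisor :: "'n::finite T_divisor" where
  "canonical_divisor = (\<lambda>_. - 1)"

definition divisor_le ::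
  "(real^'n::finite) set set \<Rightarrow> 'n T_divisor \<Rightarrow> 'n T_divisor \<Rightarrow> bool" where
  "divisor_le \<Sigma> E F \<longleftrightarrow> (\<forall>\<rho>\<in>rays \<Sigma>. E \<rho> \<le> F \<rho>)"

text \<open>
  The divisor of the rational function $\chi^u$ is $\sum_i \langle u, v_i \rangle D_i$. On the affine
  chart of a cone $\sigma$ an invariant Cartier divisor is the divisor of a character; with the
  character called $\chi^{-u}$, the coefficients are $-\langle u, v_i \rangle$.
\<close>

definition div_char :: "real^'n::finite \<Rightarrow> 'n T_divisor" where
  "div_char u = (\<lambda>\<rho>. u \<bullet> prim_gen \<rho>)"

definition local_datum :: "'n::finite T_divisor \<Rightarrow> (real^'n) set \<Rightarrow> real^'n \<Rightarrow> bool" where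
  "local_datum E \<sigma> u \<longleftrightarrow> (\<forall>\<rho>\<in>rays_of \<sigma>. u \<bullet> prim_gen \<rho> = - E \<rho>)"

definition T_Cartier :: "(real^'n::finite) set set \<Rightarrow> 'n T_divisor \<Rightarrow> bool" where
  "T_Cartier \<Sigma> E \<longleftrightarrow>
     (\<forall>\<rho>\<in>rays \<Sigma>. E \<rho> \<in> \<int>) \<and> (\<forall>\<sigma>\<in>maximal_cones \<Sigma>. \<exists>u\<in>int_lattice. local_datum E \<sigma> u)"

definition T_QCartier :: "(real^'n::finite) set set \<Rightarrow> 'n T_divisor \<Rightarrow> bool" where
  "T_QCartier \<Sigma> D \<longleftrightarrow>
     (\<forall>\<rho>\<in>rays \<Sigma>. D \<rho> \<in> \<rat>) \<and> (\<exists>m::nat. m > 0 \<and> T_Cartier \<Sigma> (\<lambda>\<rho>. real m * D \<rho>))"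

definition support ::
  "(real^'n::finite) set set \<Rightarrow> 'n T_divisor \<Rightarrow> ('n, 'k::field) toric_point set" where
  "support \<Sigma> E = (\<Union>\<rho>\<in>{\<rho>\<in>rays \<Sigma>. E \<rho> \<noteq> 0}. orbit_closure \<Sigma> \<rho>)"

text \<open>
  Intersection numbers. Let \<open>E\<close> be Cartier and let \<open>C\<close> be an invariant curve not contained in the
  support of \<open>E\<close>. Then $E \cdot C$ is the degree of the restriction of \<open>E\<close> to \<open>C\<close>, i.e. the sum over
  the points \<open>x\<close> of $C \cap \mathrm{Supp}\,E$ of the order at \<open>x\<close>, along \<open>C\<close>, of a local equation
  $\chi^{-u}$ of \<open>E\<close>. (Invariant curves are smooth, and \<open>fst x\<close> is the cone whose orbit contains \<open>x\<close>.)
  For an arbitrary $\mathbb{Q}$-Cartier \<open>D\<close>, the number is computed from any Cartier divisor that is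
  linearly equivalent to a multiple of \<open>D\<close> and whose support does not contain \<open>C\<close>.
\<close>

definition local_mult ::
  "(real^'n::finite) set set \<Rightarrow> 'n T_divisor \<Rightarrow> ('n, 'k::field) toric_point set \<Rightarrow>
     ('n, 'k) toric_point \<Rightarrow> int" where
  "local_mult \<Sigma> E C x =
     (THE k. \<exists>u\<in>int_lattice. local_datum E (fst x) u \<and>
        has_order (subvariety (toric_variety \<Sigma>) C) x (character (- u)) k)"

definition intersection_number ::
  "(real^'n::finite) set set \<Rightarrow> 'n T_divisor \<Rightarrow> ('n, 'k::field) toric_point set \<Rightarrow> real" where
  "intersection_number \<Sigma> D C =
     (THE r. \<exists>(m::nat) u E. m > 0 \<and> u \<in> int_lattice \<and>
        E = (\<lambda>\<rho>. real m * D \<rho> + div_char u \<rho>) \<and> T_Cartier \<Sigma> E \<and> \<not> C \<subseteq> support \<Sigma> E \<and>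
        r = real_of_int (\<Sum>x\<in>C \<inter> support \<Sigma> E. local_mult \<Sigma> E C x) / real m)"


section \<open>Polytopes of divisors\<close>

definition vertex :: "'n::finite T_divisor \<Rightarrow> (real^'n) set \<Rightarrow> real^'n" where
  "vertex E \<sigma> = (THE u. u \<in> rat_vectors \<and> local_datum E \<sigma> u)"

definition divisor_polytope ::
  "(real^'n::finite) set set \<Rightarrow> 'n T_divisor \<Rightarrow> (real^'n) set" where
  "divisor_polytope \<Sigma> E = {u\<in>rat_vectors. \<forall>\<rho>\<in>rays \<Sigma>. - E \<rho> \<le> u \<bullet> prim_gen \<rho>}"

definition shifted_polytope ::
  "(real^'n::finite) set set \<Rightarrow> 'n T_divisor \<Rightarrow> (real^'n) set \<Rightarrow> (real^'n) set" where
  "shifted_polytope \<Sigma> E \<sigma> = (\<lambda>u. u - vertex E \<sigma>) ` divisor_polytope \<Sigma> E"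

definition generates_semigroup :: "(real^'n::finite) set \<Rightarrow> (real^'n) set \<Rightarrow> bool" where
  "generates_semigroup G S \<longleftrightarrow>
     G \<subseteq> S \<and> (\<forall>u\<in>S. \<exists>F c. finite F \<and> F \<subseteq> G \<and> u = (\<Sum>s\<in>F. real (c s :: nat) *\<^sub>R s))"

end

theory Submission
  imports Defs
begin

text \<open>
  Write $n$ for the dimension, $u_\sigma$ for the local datum of $D$ on a maximal cone $\sigma$, and
  $u'_\sigma$ for the one of $D'$. If $g$ is the primitive inward normal of a facet of $\sigma$ and
  $\tau$ is the maximal cone behind this facet, then $u_\tau = u_\sigma + (D \cdot C) g$, where $C$ is
  the invariant curve of the facet (\<open>intersection_number_wall\<close>). This formula is all that is
  used of $D$; the rest of the argument is convex geometry.

  Let $v$ be the generator of a ray with coefficient $d$ in $D$. When a wall with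
  $\langle g, v\rangle < 0$ is crossed, $\langle u_\sigma, v\rangle$ drops by at least
  $-(n+1)\langle g, v\rangle$. A maximal cone at which this pairing is least must therefore contain
  $v$, and there the pairing is $-d$. So for $v \notin \sigma$ the excess
  $\ell = d + \langle u_\sigma, v\rangle$ is at least $(n+1)\mu$, where $\mu \geq 1$ is the maximum of
  $-\langle g, v\rangle$ over the facet normals $g$ of $\sigma$ (\<open>slope\<close>). Since
  $D' \geq K_X$, an element $x$ of $\sigma^\vee \cap M$ lies in the shifted polytope as soon as
  $\langle x + u'_\sigma, v\rangle + \ell \geq 1$ for all such $v$. Every element of
  $\sigma^\vee \cap M$ is a sum of indecomposable ones, so it is enough to prove this
  inequality for indecomposable $x$.

  The facet normals span the rays of $\sigma^\vee$, and $u'_\sigma \in \sigma^\vee$ because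
  $D' \leq 0$. Hence $x + u'_\sigma = \sum_k a_k g_k$ with $a_k \geq 0$ and at most $n$ linearly
  independent normals $g_k$. If some $a_k > 1$, then $x - g_k$ is still in $\sigma^\vee$: its
  pairings with the ray generators of $\sigma$ are integers, and they are greater than $-1$ because
  $u'_\sigma$ contributes at most $1$. So $x = g_k$. In all other cases
  $\sum_k a_k \leq n$ and the pairing with $v$ is at least $-n\mu$, which leaves room for
  $\mu \geq 1$ (\<open>indecomposable_in_polytope\<close>).

  If $x$ is itself a facet normal, the same estimate for $u'_\sigma$ gives only $-(n+1)\mu$. Losing
  the required $1$ is possible only if all normals involved pair to $-\mu$ with $v$ and all
  coefficients are close to $1$; integrality then forces $\sigma$ to be generated by a lattice basis
  $r_1, \dots, r_n$ and $v = -\sum_i r_i$ (\<open>near_equality_smooth\<close>). If a cone adjacent to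
  $\sigma$ does not contain $v$, a second wall has to be crossed and $\ell$ is larger by $n+1$, which
  is more than enough. If all of them contain $v$, the fan is the one of projective space
  (\<open>projective_space_fanI\<close>), and its toric variety is isomorphic to $\mathbb{P}^n$
  (\<open>projective_space_fan_isomorphic\<close>), contrary to the hypothesis.

  Projectivity is used to know that the fan is complete, so that there is a cone behind every
  facet: one-parameter subgroups have limits in projective space, hence in the toric variety
  (\<open>projective_imp_complete\<close>).
\<close>

section \<open>Integral and rational vectors\<close>

lemma int_lattice_0 [simp]: "0 \<in> int_lattice"
  by (simp add: int_lattice_def)
lemma int_lattice_add: "u \<in> int_lattice \<Longrightarrow> v \<in> int_lattice \<Longrightarrow> u + v \<in> int_lattice"
  by (simp add: int_lattice_def)
lemma int_lattice_diff: "u \<in> int_lattice \<Longrightarrow> v \<in> int_lattice \<Longrightarrow> u - v \<in> int_lattice"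
  by (simp add: int_lattice_def)
lemma int_lattice_uminus: "u \<in> int_lattice \<Longrightarrow> - u \<in> int_lattice"
  by (simp add: int_lattice_def)
lemma int_lattice_scale: "u \<in> int_lattice \<Longrightarrow> r \<in> \<int> \<Longrightarrow> r *\<^sub>R u \<in> int_lattice"
  by (simp add: int_lattice_def)
lemma int_lattice_sum: "(\<And>i. i \<in> A \<Longrightarrow> f i \<in> int_lattice) \<Longrightarrow> sum f A \<in> int_lattice"
  by (induction A rule: infinite_finite_induct) (auto intro: int_lattice_add)
lemma int_lattice_inner: "u \<in> int_lattice \<Longrightarrow> v \<in> int_lattice \<Longrightarrow> u \<bullet> v \<in> \<int>"
  by (auto simp: int_lattice_def inner_vec_def intro!: Ints_sum)
lemma axis_in_int_lattice: "axis i 1 \<in> int_lattice"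
  by (simp add: int_lattice_def axis_def)

lemma rat_vectors_0 [simp]: "0 \<in> rat_vectors"
  by (simp add: rat_vectors_def)
lemma int_lattice_rat: "u \<in> int_lattice \<Longrightarrow> u \<in> rat_vectors"
  using Ints_subset_Rats by (auto simp: int_lattice_def rat_vectors_def)
lemma rat_vectors_add: "u \<in> rat_vectors \<Longrightarrow> v \<in> rat_vectors \<Longrightarrow> u + v \<in> rat_vectors"
  by (simp add: rat_vectors_def)
lemma rat_vectors_diff: "u \<in> rat_vectors \<Longrightarrow> v \<in> rat_vectors \<Longrightarrow> u - v \<in> rat_vectors"
  by (simp add: rat_vectors_def)
lemma rat_vectors_scale: "u \<in> rat_vectors \<Longrightarrow> r \<in> \<rat> \<Longrightarrow> r *\<^sub>R u \<in> rat_vectors"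
  by (simp add: rat_vectors_def)
lemma Rats_sum_closed: "(\<And>i. i \<in> A \<Longrightarrow> f i \<in> \<rat>) \<Longrightarrow> sum f A \<in> \<rat>"
  by (induction A rule: infinite_finite_induct) auto
lemma rat_vectors_inner: "u \<in> rat_vectors \<Longrightarrow> v \<in> rat_vectors \<Longrightarrow> u \<bullet> v \<in> \<rat>"
  by (auto simp: rat_vectors_def inner_vec_def intro!: Rats_sum_closed)

lemma Int_less_imp_le_minus_1: "(a::real) \<in> \<int> \<Longrightarrow> b \<in> \<int> \<Longrightarrow> a < b \<Longrightarrow> a \<le> b - 1"
  by (elim Ints_cases) auto

lemma clear_denominators:
  assumes "u \<in> (rat_vectors :: (real^'n::finite) set)"
  obtains m :: nat where "m > 0" "real m *\<^sub>R u \<in> int_lattice"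
proof -
  have "\<exists>m::nat. m > 0 \<and> real m * u $ i \<in> \<int>" for i
  proof -
    obtain p q where "q > 0" "u $ i = of_int p / of_int q"
      using assms unfolding rat_vectors_def by (blast elim: Rats_cases')
    then show ?thesis
      by (intro exI[of _ "nat q"]) auto
  qed
  then obtain m where m: "\<And>i. m i > (0::nat)" "\<And>i. real (m i) * u $ i \<in> \<int>"
    by metis
  have "real (prod m UNIV) * u $ i \<in> \<int>" for i
  proof -
    have "real (prod m UNIV) * u $ i = real (prod m (UNIV - {i})) * (real (m i) * u $ i)"
      by (simp add: prod.remove[of UNIV i])
    then show ?thesis using m(2)[of i] by (metis Ints_mult Ints_of_nat)
  qed
  then show thesis
    by (intro that[of "prod m UNIV"]) (auto simp: int_lattice_def m prod_pos)
qed

text \<open>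
  Choose a coordinate that does not vanish on the line, and a lattice vector on the line for which
  this coordinate is nonzero and least in absolute value; rounding down the factor of any other lattice vector leaves a remainder with a smaller
  coordinate, that is, zero.
\<close>

lemma line_generator:
  fixes s :: "real^'n::finite"
  assumes "s \<in> int_lattice" "s \<noteq> 0"
  obtains v t where "v \<in> int_lattice" "t > 0" "v = t *\<^sub>R s"
    "\<forall>r. r *\<^sub>R v \<in> int_lattice \<longrightarrow> r \<in> \<int>"
proof -
  obtain i where i: "s $ i \<noteq> 0" using assms(2) by (auto simp: vec_eq_iff)
  define Q where "Q n \<longleftrightarrow> n > 0 \<and> (\<exists>r. r *\<^sub>R s \<in> int_lattice \<and> \<bar>r * s $ i\<bar> = real n)" for n
  have int_abs: "\<exists>n. \<bar>r * s $ i\<bar> = real n" if "r *\<^sub>R s \<in> int_lattice" for r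
  proof -
    have "\<bar>r * s $ i\<bar> \<in> \<int>" using that by (simp add: int_lattice_def)
    then obtain z where z: "\<bar>r * s $ i\<bar> = of_int z" by (auto elim: Ints_cases)
    then have "z \<ge> 0" by (metis abs_ge_zero of_int_0_le_iff)
    then show ?thesis using z by (metis of_nat_nat)
  qed
  have "\<exists>n. Q n" using int_abs[of 1] assms i unfolding Q_def
    by (metis abs_0 abs_0_eq mult_1 of_nat_0 scaleR_one neq0_conv)
  then have QL: "Q (LEAST n. Q n)" by (rule LeastI_ex)
  define n where "n = (LEAST n. Q n)"
  obtain r0 where r0: "r0 *\<^sub>R s \<in> int_lattice" "\<bar>r0 * s $ i\<bar> = real n" and n0: "n > 0"
    using QL unfolding n_def Q_def by blast
  define t where "t = \<bar>r0\<bar>"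
  have t: "t > 0" using r0 n0 unfolding t_def by auto
  have tl: "t *\<^sub>R s \<in> int_lattice"
    using r0 int_lattice_uminus[OF r0(1)] unfolding t_def by (auto simp: abs_if)
  have "r \<in> \<int>" if r: "r *\<^sub>R (t *\<^sub>R s) \<in> int_lattice" for r
  proof -
    define q where "q = frac r"
    have "(r * t - of_int \<lfloor>r\<rfloor> * t) *\<^sub>R s \<in> int_lattice"
      using int_lattice_diff[OF r int_lattice_scale[OF tl, of "of_int \<lfloor>r\<rfloor>"]] by (simp add: scaleR_left_diff_distrib)
    then have l: "(q * t) *\<^sub>R s \<in> int_lattice" by (simp add: q_def frac_def algebra_simps)
    then obtain k where k: "\<bar>q * t * s $ i\<bar> = real k" using int_abs by blast
    have q: "0 \<le> q" "q < 1" by (auto simp: q_def frac_lt_1)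
    have "\<bar>q * t * s $ i\<bar> = q * real n" using q t r0 by (simp add: abs_mult t_def)
    also have "\<dots> < real n" using q n0 by simp
    finally have "k < n" using k by simp
    then have "\<not> Q k" unfolding n_def by (rule not_less_Least)
    then have "k = 0" using l k unfolding Q_def by (metis neq0_conv)
    then have "q = 0" using k t i by auto
    then show ?thesis by (simp add: q_def frac_eq_0_iff)
  qed
  then show thesis using that[OF tl t] by blast
qed

text \<open>
  Gram-Schmidt orthogonalization never leaves the rational vectors. This provides rational normals
  of rational hyperplanes.
\<close>

lemma rational_orthogonalization:
  fixes x :: "real^'n::finite"
  assumes "finite S" "S \<subseteq> rat_vectors" "x \<in> rat_vectors"
  shows "\<exists>y\<in>rat_vectors. y - x \<in> span S \<and> (\<forall>s\<in>S. y \<bullet> s = 0)"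
  using assms
proof (induction S arbitrary: x rule: finite_induct)
  case empty
  then show ?case by (intro bexI[of _ x]) auto
next
  case (insert s S)
  obtain s' where s': "s' \<in> rat_vectors" "s' - s \<in> span S" "\<forall>z\<in>S. s' \<bullet> z = 0"
    using insert by (metis insert_subset)
  obtain x' where x': "x' \<in> rat_vectors" "x' - x \<in> span S" "\<forall>z\<in>S. x' \<bullet> z = 0"
    using insert by (metis insert_subset)
  have sp: "span S \<subseteq> span (insert s S)" by (simp add: span_mono subset_insertI)
  have orth: "y \<bullet> z = 0" if "\<forall>z\<in>S. y \<bullet> z = 0" "z \<in> span S" for y z :: "real^'n"
    using orthogonal_to_span[of z S y] that by (auto simp: orthogonal_def)
  show ?case
  proof (cases "s' = 0")
    case True
    then have "s \<in> span S" using s'(2) by (metis diff_0 span_neg minus_minus)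
    then show ?thesis using x' sp orth by (intro bexI[of _ x']) auto
  next
    case False
    define y where "y = x' - ((x' \<bullet> s') / (s' \<bullet> s')) *\<^sub>R s'"
    have "y \<in> rat_vectors" unfolding y_def
      by (intro rat_vectors_diff rat_vectors_scale Rats_divide rat_vectors_inner x' s')
    moreover have "s' \<in> span (insert s S)"
      using span_add[OF subsetD[OF sp s'(2)] span_base[of s "insert s S"]] by simp
    then have "y - x \<in> span (insert s S)"
      using span_diff[OF subsetD[OF sp x'(2)] span_scale[of s' "insert s S" "(x' \<bullet> s') / (s' \<bullet> s')"]]
      by (simp add: y_def algebra_simps)
    moreover have yS: "\<forall>z\<in>S. y \<bullet> z = 0" using s' x' by (simp add: y_def inner_diff_left)
    moreover have "y \<bullet> s' = 0" using False by (simp add: y_def inner_diff_left)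
    then have "y \<bullet> s = 0" using orth[OF yS s'(2)] by (simp add: inner_diff_right)
    ultimately show ?thesis by auto
  qed
qed

lemma primitive_integral_normal:
  fixes S :: "(real^'n::finite) set"
  assumes "finite S" "S \<subseteq> int_lattice" "dim S < CARD('n)"
  obtains u where "u \<in> int_lattice" "u \<noteq> 0" "\<And>x. x \<in> S \<Longrightarrow> u \<bullet> x = 0"
    "\<forall>r. r *\<^sub>R u \<in> int_lattice \<longrightarrow> r \<in> \<int>"
proof -
  have "\<not> (Basis :: (real^'n) set) \<subseteq> span S"
  proof
    assume "(Basis :: (real^'n) set) \<subseteq> span S"
    then have "span S = UNIV" by (metis span_Basis span_mono span_span top.extremum_uniqueI)
    then have "dim S = CARD('n)" by (metis dim_UNIV dim_span DIM_cart DIM_real mult.right_neutral)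
    then show False using assms by simp
  qed
  then obtain e :: "real^'n" where e: "e \<in> Basis" "e \<notin> span S" by auto
  then have "e \<in> rat_vectors" by (auto simp: Basis_vec_def intro: int_lattice_rat axis_in_int_lattice)
  then obtain y where y: "y \<in> rat_vectors" "y - e \<in> span S" "\<forall>s\<in>S. y \<bullet> s = 0"
    using rational_orthogonalization[OF assms(1)] assms(2) int_lattice_rat by (metis subset_eq)
  have "y \<noteq> 0" using y(2) e(2) by (metis diff_0 span_neg minus_minus)
  obtain m :: nat where m: "m > 0" "real m *\<^sub>R y \<in> int_lattice" using clear_denominators[OF y(1)] .
  have "real m *\<^sub>R y \<noteq> 0" using \<open>y \<noteq> 0\<close> m(1) by simp
  then obtain v t where "v \<in> int_lattice" "t > 0" "v = t *\<^sub>R real m *\<^sub>R y"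
    "\<forall>r. r *\<^sub>R v \<in> int_lattice \<longrightarrow> r \<in> \<int>"
    by (rule line_generator[OF m(2)])
  then show thesis using that[of v] y(3) \<open>y \<noteq> 0\<close> m(1) by auto
qed

section \<open>Finitely generated cones\<close>

lemma convex_cone_hull_finite:
  assumes "finite S"
  shows "convex_cone hull S = {\<Sum>s\<in>S. c s *\<^sub>R s | c. \<forall>s\<in>S. 0 \<le> c s}" (is "_ = ?R")
proof
  show "convex_cone hull S \<subseteq> ?R"
  proof (rule hull_minimal)
    show "S \<subseteq> ?R"
    proof
      fix x assume "x \<in> S"
      then have "x = (\<Sum>s\<in>S. of_bool (s = x) *\<^sub>R s)"
        using assms by (subst sum.remove[of S x]) (auto intro!: sum.neutral)
      then show "x \<in> ?R" by (intro CollectI exI[of _ "\<lambda>s. of_bool (s = x)"]) simp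
    qed
    show "convex_cone ?R" unfolding convex_cone_iff
    proof (intro conjI strip)
      show "0 \<in> ?R" by (auto intro!: exI[of _ "\<lambda>_. 0"])
    next
      fix x y assume "x \<in> ?R" "y \<in> ?R"
      then obtain c d where "x = (\<Sum>s\<in>S. c s *\<^sub>R s)" "y = (\<Sum>s\<in>S. d s *\<^sub>R s)" "\<forall>s\<in>S. 0 \<le> c s" "\<forall>s\<in>S. 0 \<le> d s"
        by auto
      then show "x + y \<in> ?R"
        by (auto intro!: exI[of _ "\<lambda>s. c s + d s"] simp: scaleR_left_distrib sum.distrib)
    next
      fix x and r :: real assume "x \<in> ?R" "0 \<le> r"
      then obtain c where "x = (\<Sum>s\<in>S. c s *\<^sub>R s)" "\<forall>s\<in>S. 0 \<le> c s" by auto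
      then show "r *\<^sub>R x \<in> ?R" using \<open>0 \<le> r\<close>
        by (auto intro!: exI[of _ "\<lambda>s. r * c s"] simp: scaleR_sum_right)
    qed
  qed
  have "(\<Sum>s\<in>T. c s *\<^sub>R s) \<in> convex_cone hull S" if "\<forall>s\<in>S. 0 \<le> c s" "T \<subseteq> S" for c T
    using finite_subset[OF that(2) assms] that
  proof (induction T rule: finite_induct)
    case (insert s T)
    then show ?case by (simp add: convex_cone_hull_add convex_cone_hull_mul hull_inc)
  qed (simp add: convex_cone_hull_contains_0)
  then show "?R \<subseteq> convex_cone hull S" by auto
qed

text \<open>
  In a representation with the fewest generators these are independent: along a linear dependency
  one can move until some coefficient vanishes.
\<close>

lemma conical_caratheodory:
  fixes S :: "'a::euclidean_space set"
  assumes "finite S" "x \<in> convex_cone hull S"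
  obtains B c where "B \<subseteq> S" "independent B" "\<forall>b\<in>B. 0 \<le> c b" "x = (\<Sum>b\<in>B. c b *\<^sub>R b)"
proof -
  define Q where "Q n \<longleftrightarrow> (\<exists>B c. B \<subseteq> S \<and> card B = n \<and> (\<forall>b\<in>B. 0 \<le> c b) \<and> x = (\<Sum>b\<in>B. c b *\<^sub>R b))" for n
  obtain c where "\<forall>s\<in>S. 0 \<le> c s" "x = (\<Sum>s\<in>S. c s *\<^sub>R s)"
    using assms(2) unfolding convex_cone_hull_finite[OF assms(1)] by blast
  then have "Q (card S)" unfolding Q_def by blast
  then have "\<exists>n. Q n" by blast
  then have "Q (LEAST n. Q n)" by (rule LeastI_ex)
  then obtain B c where B: "B \<subseteq> S" "card B = (LEAST n. Q n)" "\<forall>b\<in>B. 0 \<le> c b" "x = (\<Sum>b\<in>B. c b *\<^sub>R b)"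
    unfolding Q_def by auto
  have fin: "finite B" using B(1) assms(1) finite_subset by blast
  have "independent B"
  proof (rule ccontr)
    assume "\<not> independent B"
    then obtain d0 where d0: "(\<exists>v\<in>B. d0 v \<noteq> 0)" "(\<Sum>v\<in>B. d0 v *\<^sub>R v) = 0"
      using dependent_finite[OF fin] by auto
    obtain d where d: "\<exists>v\<in>B. d v > 0" "(\<Sum>v\<in>B. d v *\<^sub>R v) = 0"
    proof (cases "\<exists>v\<in>B. d0 v > 0")
      case True
      then show ?thesis using that d0 by blast
    next
      case False
      then have "\<exists>v\<in>B. - d0 v > 0" using d0 by (metis neg_0_less_iff_less linorder_neqE_linordered_idom)
      then show ?thesis using that[of "\<lambda>v. - d0 v"] d0(2) by (simp add: sum_negf)
    qed
    define P where "P = {v\<in>B. d v > 0}"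
    have P: "finite P" "P \<noteq> {}" using fin d by (auto simp: P_def)
    obtain p where p: "p \<in> P" "\<And>v. v \<in> P \<Longrightarrow> c p / d p \<le> c v / d v"
      using ex_min_if_finite[of "(\<lambda>v. c v / d v) ` P"] P
      by (metis (no_types, lifting) arg_min_if_finite(1) arg_min_least)
    define t where "t = c p / d p"
    have t: "t \<ge> 0" "p \<in> B" "d p > 0" using p B(3) by (auto simp: t_def P_def)
    define c' where "c' v = c v - t * d v" for v
    have c'0: "0 \<le> c' v" if "v \<in> B" for v
    proof (cases "d v > 0")
      case True
      then have "t \<le> c v / d v" using p that by (auto simp: t_def P_def)
      then show ?thesis using True by (simp add: c'_def field_simps)
    next
      case False
      then have "t * d v \<le> 0" using t by (simp add: mult_nonneg_nonpos)
      then show ?thesis using B(3) that by (force simp: c'_def)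
    qed
    have "(\<Sum>v\<in>B. c' v *\<^sub>R v) = x - t *\<^sub>R (\<Sum>v\<in>B. d v *\<^sub>R v)"
      by (simp add: c'_def B(4) scaleR_left_diff_distrib sum_subtractf scaleR_sum_right)
    then have "x = (\<Sum>v\<in>B. c' v *\<^sub>R v)" using d by simp
    also have "\<dots> = (\<Sum>v\<in>B - {p}. c' v *\<^sub>R v)"
      using t fin by (subst sum.remove[of B p]) (auto simp: c'_def t_def)
    finally have "Q (card (B - {p}))" unfolding Q_def using B(1) c'0 by blast
    moreover have "card (B - {p}) < (LEAST n. Q n)" using t fin B(2) by (metis card_Diff1_less)
    ultimately show False using not_less_Least by blast
  qed
  then show thesis using that B by blast
qed

text \<open>
  Farkas' lemma: a finitely generated cone is closed, so a vector outside it is separated from it by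
  a hyperplane, which can be moved to the origin.
\<close>

lemma dual_in_convex_cone_hull:
  fixes G :: "'a::euclidean_space set"
  assumes "finite G" "\<And>x. (\<And>g. g \<in> G \<Longrightarrow> 0 \<le> g \<bullet> x) \<Longrightarrow> 0 \<le> w \<bullet> x"
  shows "w \<in> convex_cone hull G"
proof (rule ccontr)
  assume w: "w \<notin> convex_cone hull G"
  have "closed (convex_cone hull G)" using assms(1)
    by (simp add: polyhedron_convex_cone_hull polyhedron_imp_closed)
  then obtain a b where ab: "a \<bullet> w < b" "\<And>x. x \<in> convex_cone hull G \<Longrightarrow> b < a \<bullet> x"
    using separating_hyperplane_closed_point[OF convex_convex_cone_hull _ w] by blast
  have b0: "b < 0" using ab(2)[OF convex_cone_hull_contains_0] by simp
  have "0 \<le> g \<bullet> a" if "g \<in> G" for g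
  proof (rule ccontr)
    assume "\<not> 0 \<le> g \<bullet> a"
    then have neg: "a \<bullet> g < 0" by (simp add: inner_commute)
    define r where "r = b / (a \<bullet> g)"
    have "r \<ge> 0" using neg b0 by (simp add: r_def divide_nonpos_neg)
    then have "r *\<^sub>R g \<in> convex_cone hull G" using that by (simp add: convex_cone_hull_mul hull_inc)
    then have "b < a \<bullet> (r *\<^sub>R g)" by (rule ab(2))
    then show False using neg by (simp add: r_def)
  qed
  then have "0 \<le> w \<bullet> a" using assms(2) by blast
  then show False using ab(1) b0 by (simp add: inner_commute)
qed

section \<open>Faces and rays of rational cones\<close>

definition primitive :: "real^'n::finite \<Rightarrow> bool" where
  "primitive v \<longleftrightarrow> v \<in> int_lattice \<and> v \<noteq> 0 \<and> (\<forall>r. r *\<^sub>R v \<in> int_lattice \<longrightarrow> r \<in> \<int>)"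

lemma primitive_parallel:
  assumes "primitive g" "primitive h" "h = c *\<^sub>R g"
  shows "c = 1 \<or> c = -1"
proof -
  have "c \<noteq> 0" using assms by (auto simp: primitive_def)
  then have "g = (1/c) *\<^sub>R h" using assms(3) by simp
  then have "c \<in> \<int>" "1/c \<in> \<int>" using assms by (auto simp: primitive_def)
  then obtain a b where ab: "c = of_int a" "1/c = of_int b" by (auto elim!: Ints_cases)
  then have "real_of_int (a * b) = 1" using \<open>c \<noteq> 0\<close> by (metis nonzero_eq_divide_eq of_int_mult mult.commute)
  then have "a * b = 1" by linarith
  then show ?thesis using ab zmult_eq_1_iff by auto
qed

text \<open>
  For cones the segments in the definition of a face can be replaced by sums, since a face is closed
  under scaling. This makes faces accessible to algebra.
\<close>

lemma cone_face_iff: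
  assumes "convex_cone C"
  shows "cone_face F C \<longleftrightarrow> F \<subseteq> C \<and> convex_cone F \<and> (\<forall>a\<in>C. \<forall>b\<in>C. a + b \<in> F \<longrightarrow> a \<in> F \<and> b \<in> F)"
    (is "?l \<longleftrightarrow> ?r")
proof
  assume ?l
  then have F: "F face_of C" "F \<noteq> {}" by (auto simp: cone_face_def)
  have sub: "F \<subseteq> C" and cv: "convex F" using F by (auto simp: face_of_def)
  have seg: "a \<in> F \<and> b \<in> F" if "a \<in> C" "b \<in> C" "x \<in> F" "x \<in> open_segment a b" for a b x
    using F that by (auto simp: face_of_def)
  have dbl: "0 \<in> F" "t *\<^sub>R x \<in> F" if x: "x \<in> F" "t > 1" for x and t :: real
  proof -
    have C: "0 \<in> C" "t *\<^sub>R x \<in> C" using assms x sub by (auto simp: convex_cone_iff)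
    show "0 \<in> F" "t *\<^sub>R x \<in> F"
    proof (atomize (full), cases "x = 0")
      case False
      have "x \<in> open_segment 0 (t *\<^sub>R x)"
        using False x(2) by (auto simp: in_segment intro!: exI[of _ "1/t"])
      then show "0 \<in> F \<and> t *\<^sub>R x \<in> F" using seg[OF C x(1)] by blast
    qed (use x in auto)
  qed
  have z: "0 \<in> F" using dbl(1)[of _ 2] F(2) by auto
  have sc: "t *\<^sub>R x \<in> F" if "x \<in> F" "t \<ge> 0" for x and t :: real
  proof (cases "t > 1")
    case False
    then show ?thesis using convexD_alt[OF cv z that(1), of t] that by simp
  qed (use dbl that in auto)
  have ad: "a + b \<in> F" if "a \<in> F" "b \<in> F" for a b
    using sc[of "(1/2) *\<^sub>R a + (1/2) *\<^sub>R b" 2] convexD[OF cv that, of "1/2" "1/2"]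
    by (simp add: scaleR_right_distrib)
  have "a \<in> F \<and> b \<in> F" if "a \<in> C" "b \<in> C" "a + b \<in> F" for a b
  proof (cases "a = b")
    case True
    then show ?thesis using sc[OF that(3), of "1/2"] by (simp flip: scaleR_2)
  next
    case False
    have "a + b \<in> open_segment (2 *\<^sub>R a) (2 *\<^sub>R b)"
      using False by (auto simp: in_segment intro!: exI[of _ "1/2"])
    then have "2 *\<^sub>R a \<in> F \<and> 2 *\<^sub>R b \<in> F"
      using seg[of "2 *\<^sub>R a" "2 *\<^sub>R b", OF _ _ that(3)] assms that by (simp add: convex_cone_iff)
    then show ?thesis using sc[of "2 *\<^sub>R a" "1/2"] sc[of "2 *\<^sub>R b" "1/2"] by simp
  qed
  moreover have "convex_cone F" unfolding convex_cone_iff using z sc ad by blast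
  ultimately show ?r using sub by blast
next
  assume r: ?r
  then have sc: "\<And>x t. x \<in> F \<Longrightarrow> 0 \<le> t \<Longrightarrow> t *\<^sub>R x \<in> F" and sub: "F \<subseteq> C"
    by (auto simp: convex_cone_iff)
  have "F face_of C" unfolding face_of_def
  proof (intro conjI ballI impI)
    show "F \<subseteq> C" "convex F" using r by (auto simp: convex_cone_def)
  next
    fix a b x assume h: "a \<in> C" "b \<in> C" "x \<in> F" "x \<in> open_segment a b"
    then obtain u where u: "0 < u" "u < 1" "x = (1 - u) *\<^sub>R a + u *\<^sub>R b" by (auto simp: in_segment)
    have "(1-u) *\<^sub>R a \<in> C" "u *\<^sub>R b \<in> C"
      using u h by (auto intro!: convex_cone_scaleR[OF assms])
    then have "(1-u) *\<^sub>R a \<in> F \<and> u *\<^sub>R b \<in> F"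
      using r h(3) u(3) by blast
    then show "a \<in> F" "b \<in> F"
      using sc[of "(1-u) *\<^sub>R a" "1/(1-u)"] sc[of "u *\<^sub>R b" "1/u"] u by auto
  qed
  then show ?l using r by (auto simp: cone_face_def convex_cone_iff)
qed

lemma rational_cone_convex_cone: "rational_cone \<sigma> \<Longrightarrow> convex_cone \<sigma>"
  by (auto simp: rational_cone_def convex_cone_convex_cone_hull)

lemma rational_cone_polyhedron: "rational_cone \<sigma> \<Longrightarrow> polyhedron \<sigma>"
  by (auto simp: rational_cone_def polyhedron_convex_cone_hull)

lemma cone_face_trans: "cone_face F G \<Longrightarrow> cone_face G C \<Longrightarrow> cone_face F C"
  by (auto simp: cone_face_def intro: face_of_trans)

lemma cone_face_halfspace:
  assumes "convex_cone C" "\<And>x. x \<in> C \<Longrightarrow> 0 \<le> u \<bullet> x"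
  shows "cone_face (C \<inter> {x. u \<bullet> x = 0}) C"
  unfolding cone_face_iff[OF assms(1)]
  using assms by (auto simp: convex_cone_iff inner_add_right add_nonneg_eq_0_iff)

lemma cone_face_Int_span:
  fixes C :: "(real^'n::finite) set"
  assumes "convex_cone C" "cone_face F C"
  shows "C \<inter> span F = F"
proof
  have F: "F \<subseteq> C" "convex_cone F" "\<forall>a\<in>C. \<forall>b\<in>C. a + b \<in> F \<longrightarrow> a \<in> F \<and> b \<in> F"
    using assms(2) unfolding cone_face_iff[OF assms(1)] by auto
  let ?D = "{a - b | a b. a \<in> F \<and> b \<in> F}"
  have "span F \<subseteq> ?D"
  proof (rule span_minimal)
    show "F \<subseteq> ?D" using convex_cone_contains_0[OF F(2)] by force
    have add: "\<exists>a b. x + y = a - b \<and> a \<in> F \<and> b \<in> F" if "x = a - b" "y = c - d" "a \<in> F" "b \<in> F" "c \<in> F" "d \<in> F" for x y a b c d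
      using that by (intro exI[of _ "a + c"] exI[of _ "b + d"]) (simp add: convex_cone_add[OF F(2)])
    have sc: "\<exists>a' b'. r *\<^sub>R (a - b) = a' - b' \<and> a' \<in> F \<and> b' \<in> F" if "a \<in> F" "b \<in> F" for r a b
    proof (cases "r \<ge> 0")
      case True
      then show ?thesis using that
        by (intro exI[of _ "r *\<^sub>R a"] exI[of _ "r *\<^sub>R b"]) (simp add: convex_cone_scaleR[OF F(2)] scaleR_diff_right)
    next
      case False
      then show ?thesis using that
        by (intro exI[of _ "(-r) *\<^sub>R b"] exI[of _ "(-r) *\<^sub>R a"])
           (simp add: convex_cone_scaleR[OF F(2)] scaleR_diff_right convex_cone_scaleR[OF F(2), of "-r", simplified])
    qed
    show "subspace ?D" unfolding subspace_def
      using add sc convex_cone_contains_0[OF F(2)] by (auto 0 3 intro: exI[of _ 0])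
  qed
  then show "C \<inter> span F \<subseteq> F" using F by (smt (verit) Int_iff diff_add_cancel mem_Collect_eq subset_iff)
qed (use assms(2) in \<open>auto simp: cone_face_iff[OF assms(1)] span_base\<close>)

lemma cone_face_eq_if_dim:
  fixes C :: "(real^'n::finite) set"
  assumes "convex_cone C" "cone_face F C" "dim C \<le> dim F"
  shows "F = C"
proof -
  have "F \<subseteq> C" using assms cone_face_iff by blast
  then have "span F = span C" using assms(3) by (simp add: dim_eq_span)
  then show ?thesis using cone_face_Int_span[OF assms(1,2)] span_superset[of C] by auto
qed

lemma cone_face_generators:
  fixes S :: "(real^'n::finite) set"
  assumes "finite S" "cone_face F (convex_cone hull S)"
  shows "F = convex_cone hull (S \<inter> F)"
proof
  note F = assms(2)[unfolded cone_face_iff[OF convex_cone_convex_cone_hull]]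
  then show "convex_cone hull (S \<inter> F) \<subseteq> F" by (intro hull_minimal) auto
  have key: "(\<Sum>s\<in>T. c s *\<^sub>R s) \<in> F \<longrightarrow> (\<Sum>s\<in>T. c s *\<^sub>R s) \<in> convex_cone hull (S \<inter> F)"
    if "T \<subseteq> S" and c: "\<And>s. s \<in> S \<Longrightarrow> 0 \<le> c s" for T c
    using finite_subset[OF that(1) assms(1)] that(1)
  proof (induction T rule: finite_induct)
    case (insert s T)
    have T: "(\<Sum>s\<in>T. c s *\<^sub>R s) \<in> convex_cone hull S"
      using convex_cone_hull_finite[OF assms(1)] insert(4) c
      by (auto intro!: exI[of _ "\<lambda>s. if s \<in> T then c s else 0"] sum.mono_neutral_cong_left simp: assms(1))
    have s: "s \<in> S" using insert by auto
    then have s': "c s *\<^sub>R s \<in> convex_cone hull S"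
      using c by (intro convex_cone_hull_mul hull_inc)
    show ?case
    proof
      assume "(\<Sum>s\<in>insert s T. c s *\<^sub>R s) \<in> F"
      then have "c s *\<^sub>R s \<in> F" "(\<Sum>s\<in>T. c s *\<^sub>R s) \<in> F" using F insert s' T by auto
      moreover have "c s *\<^sub>R s \<in> convex_cone hull (S \<inter> F)"
      proof (cases "c s = 0")
        case False
        then have "(1 / c s) *\<^sub>R (c s *\<^sub>R s) \<in> F"
          using F c s \<open>c s *\<^sub>R s \<in> F\<close> by (intro convex_cone_scaleR[of F "1 / c s" "c s *\<^sub>R s"]) auto
        then have "s \<in> S \<inter> F" using False s by simp
        then show ?thesis using s c by (intro convex_cone_hull_mul hull_inc)
      qed (simp add: convex_cone_hull_contains_0)
      ultimately show "(\<Sum>s\<in>insert s T. c s *\<^sub>R s) \<in> convex_cone hull (S \<inter> F)"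
        using insert by (simp add: convex_cone_hull_add)
    qed
  qed (simp add: convex_cone_hull_contains_0)
  show "F \<subseteq> convex_cone hull (S \<inter> F)"
  proof
    fix x assume x: "x \<in> F"
    then have "x \<in> convex_cone hull S" using F by auto
    then obtain c where "\<forall>s\<in>S. 0 \<le> c s" "x = (\<Sum>s\<in>S. c s *\<^sub>R s)"
      unfolding convex_cone_hull_finite[OF assms(1)] by blast
    then show "x \<in> convex_cone hull (S \<inter> F)" using key[of S c] x by auto
  qed
qed

lemma rational_cone_face:
  fixes \<sigma> :: "(real^'n::finite) set"
  assumes "rational_cone \<sigma>" "cone_face F \<sigma>"
  shows "rational_cone F"
proof -
  obtain S where S: "finite S" "S \<subseteq> int_lattice" "\<sigma> = convex_cone hull S"
    using assms by (auto simp: rational_cone_def)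
  have "F = convex_cone hull (S \<inter> F)" using cone_face_generators S assms by blast
  moreover have "F \<subseteq> \<sigma>" using assms(2) rational_cone_convex_cone[OF assms(1)] cone_face_iff by blast
  ultimately show ?thesis using assms(1) S unfolding rational_cone_def
    by (metis (no_types, lifting) finite_Int le_infI1 subset_eq)
qed

lemma ray_prim_gen:
  fixes \<rho> :: "(real^'n::finite) set"
  assumes "rational_cone \<rho>" "dim \<rho> = 1"
  shows "primitive (prim_gen \<rho>)" "\<rho> = {t *\<^sub>R prim_gen \<rho> | t. t \<ge> 0}"
proof -
  obtain S where S: "finite S" "S \<subseteq> int_lattice" "\<rho> = convex_cone hull S"
    using assms by (auto simp: rational_cone_def)
  have "\<exists>s\<in>S. s \<noteq> 0"
  proof (rule ccontr)
    assume "\<not> ?thesis"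
    then have "convex_cone hull S \<subseteq> {0}" by (intro hull_minimal) auto
    then show False using S(3) assms(2) by (metis dim_eq_0 zero_neq_one)
  qed
  then obtain s where s: "s \<in> S" "s \<noteq> 0" by auto
  obtain v t where v: "v \<in> int_lattice" "t > 0" "v = t *\<^sub>R s" "\<forall>r. r *\<^sub>R v \<in> int_lattice \<longrightarrow> r \<in> \<int>"
    using line_generator[of s] s S by blast
  have prim: "primitive v" using v s by (auto simp: primitive_def)
  have cc: "convex_cone \<rho>" by (simp add: assms(1) rational_cone_convex_cone)
  have v\<rho>: "v \<in> \<rho>" using s S v by (simp add: convex_cone_hull_mul hull_inc)
  have "dim {v} = 1" using v s by (simp add: dim_insert)
  then have sp: "span {v} = span \<rho>" using v\<rho> assms(2) by (intro dim_eq_span) auto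
  have ray: "\<rho> = {t *\<^sub>R v | t. t \<ge> 0}"
  proof
    show "\<rho> \<subseteq> {t *\<^sub>R v | t. t \<ge> 0}"
    proof
      fix x assume x: "x \<in> \<rho>"
      then have "x \<in> span {v}" using sp span_base by blast
      then obtain r where r: "x = r *\<^sub>R v" by (auto simp: span_singleton)
      have "r \<ge> 0"
      proof (rule ccontr)
        assume "\<not> r \<ge> 0"
        then have "(1/(-r)) *\<^sub>R x \<in> \<rho>" using cc x by (intro convex_cone_scaleR) auto
        then have "- v \<in> \<rho>" using r \<open>\<not> r \<ge> 0\<close> by simp
        then show False using v\<rho> assms(1) prim by (auto simp: rational_cone_def primitive_def)
      qed
      then show "x \<in> {t *\<^sub>R v | t. t \<ge> 0}" using r by auto
    qed
  qed (use cc v\<rho> in \<open>auto intro: convex_cone_scaleR\<close>)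
  have rng: "\<rho> \<inter> int_lattice = range (\<lambda>k::nat. real k *\<^sub>R v)"
  proof
    show "\<rho> \<inter> int_lattice \<subseteq> range (\<lambda>k::nat. real k *\<^sub>R v)"
    proof
      fix x assume "x \<in> \<rho> \<inter> int_lattice"
      then obtain t where t: "x = t *\<^sub>R v" "t \<ge> 0" "x \<in> int_lattice" using ray by auto
      then have "t \<in> \<int>" using prim by (auto simp: primitive_def)
      then have "t \<in> \<nat>" using t(2) by (simp add: Nats_altdef2)
      then show "x \<in> range (\<lambda>k::nat. real k *\<^sub>R v)" using t(1) by (auto elim!: Nats_cases)
    qed
    show "range (\<lambda>k::nat. real k *\<^sub>R v) \<subseteq> \<rho> \<inter> int_lattice"
      using int_lattice_scale[OF v(1)] unfolding ray by auto
  qed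
  have "prim_gen \<rho> = v" unfolding prim_gen_def
  proof (rule the_equality)
    fix w assume w: "\<rho> \<inter> int_lattice = range (\<lambda>k::nat. real k *\<^sub>R w)"
    obtain a :: nat where a: "v = real a *\<^sub>R w"
      using rng w rangeI[of "\<lambda>k::nat. real k *\<^sub>R v" 1] by auto
    obtain b :: nat where b: "w = real b *\<^sub>R v"
      using rng w rangeI[of "\<lambda>k::nat. real k *\<^sub>R w" 1] by auto
    have "(real a * real b) *\<^sub>R v = 1 *\<^sub>R v" using a b by (metis scaleR_one scaleR_scaleR)
    then have "real a * real b = 1" using prim unfolding primitive_def scaleR_cancel_right by blast
    then have "b = 1" by (metis nat_mult_eq_1_iff of_nat_eq_1_iff of_nat_mult)
    then show "w = v" using b by simp
  qed (rule rng)
  then show "primitive (prim_gen \<rho>)" "\<rho> = {t *\<^sub>R prim_gen \<rho> | t. t \<ge> 0}" using prim ray by auto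
qed

lemma convex_cone_hull_singleton: "convex_cone hull {s} = {t *\<^sub>R s | t. t \<ge> 0}"
  unfolding convex_cone_hull_finite[OF finite.emptyI[THEN finite.insertI], of s] by (auto intro: exI[of _ "\<lambda>_. _"])

lemma finite_rays_of: "rational_cone \<sigma> \<Longrightarrow> finite (rays_of \<sigma>)"
  by (rule finite_subset[OF _ finite_polyhedron_faces[OF rational_cone_polyhedron]])
     (auto simp: rays_of_def cone_face_def)

lemma pointed_cone_sum_zero:
  assumes "convex_cone C" "\<And>v. v \<in> C \<Longrightarrow> - v \<in> C \<Longrightarrow> v = 0" "finite A" "\<And>a. a \<in> A \<Longrightarrow> f a \<in> C" "sum f A = 0" "a \<in> A"
  shows "f a = (0 :: real^'n::finite)"
proof -
  have mem: "(\<Sum>b\<in>B. f b) \<in> C" if "B \<subseteq> A" for B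
    using finite_subset[OF that assms(3)] that
    by (induction B rule: finite_induct) (auto simp: assms(4) convex_cone_add[OF assms(1)] convex_cone_contains_0[OF assms(1)])
  have "- f a = (\<Sum>b\<in>A - {a}. f b)"
    using assms by (metis add.inverse_unique sum.remove)
  then show ?thesis using assms(2)[of "f a"] assms(4,6) mem[of "A - {a}"] by simp
qed

text \<open>
  A generating set of least cardinality consists of ray generators: if a multiple of a generator \<open>s\<close>
  is a sum of two elements of the cone, comparing coefficients either expresses \<open>s\<close> by the other
  generators, or yields a vanishing sum of elements of a pointed cone.
\<close>

lemma rational_cone_rays:
  fixes \<sigma> :: "(real^'n::finite) set"
  assumes "rational_cone \<sigma>"
  shows "\<sigma> = convex_cone hull (prim_gen ` rays_of \<sigma>)"
proof
  have cc: "convex_cone \<sigma>" by (simp add: assms rational_cone_convex_cone)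
  have pt: "\<And>v. v \<in> \<sigma> \<Longrightarrow> - v \<in> \<sigma> \<Longrightarrow> v = 0" using assms by (auto simp: rational_cone_def)
  have ray: "primitive (prim_gen \<rho>)" "\<rho> = {t *\<^sub>R prim_gen \<rho> | t. t \<ge> 0}" if "\<rho> \<in> rays_of \<sigma>" for \<rho>
    using that ray_prim_gen rational_cone_face[OF assms] by (auto simp: rays_of_def)
  have in\<rho>: "prim_gen \<rho> \<in> \<rho>" if "\<rho> \<in> rays_of \<sigma>" for \<rho>
  proof -
    have "prim_gen \<rho> \<in> {t *\<^sub>R prim_gen \<rho> | t. t \<ge> 0}" by (auto intro!: exI[of _ 1])
    then show ?thesis using ray(2)[OF that] by simp
  qed
  have "prim_gen ` rays_of \<sigma> \<subseteq> \<sigma>"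
    using in\<rho> unfolding rays_of_def cone_face_iff[OF cc] by blast
  then show "convex_cone hull (prim_gen ` rays_of \<sigma>) \<subseteq> \<sigma>" using cc by (rule hull_minimal)
  define Q where "Q n \<longleftrightarrow> (\<exists>S. finite S \<and> S \<subseteq> int_lattice \<and> card S = n \<and> \<sigma> = convex_cone hull S)" for n
  have "\<exists>n. Q n" unfolding Q_def using assms by (auto simp: rational_cone_def)
  then have "Q (LEAST n. Q n)" by (rule LeastI_ex)
  then obtain S where S: "finite S" "S \<subseteq> int_lattice" "card S = (LEAST n. Q n)" "\<sigma> = convex_cone hull S"
    unfolding Q_def by auto
  have min: "s \<notin> convex_cone hull (S - {s})" if "s \<in> S" for s
  proof
    assume "s \<in> convex_cone hull (S - {s})"
    then have "S \<subseteq> convex_cone hull (S - {s})" by (metis Diff_iff empty_iff hull_inc insertE subsetI)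
    then have "convex_cone hull S \<subseteq> convex_cone hull (S - {s})"
      by (simp add: convex_cone_convex_cone_hull subset_hull)
    then have "\<sigma> = convex_cone hull (S - {s})" using S(4) by (metis Diff_subset hull_mono subset_antisym)
    then have "Q (card (S - {s}))" unfolding Q_def using S by (metis Diff_subset finite_Diff order_trans)
    moreover have "card (S - {s}) < (LEAST n. Q n)" using S that by (metis card_Diff1_less)
    ultimately show False using not_less_Least by blast
  qed
  have "s \<in> convex_cone hull (prim_gen ` rays_of \<sigma>)" if s: "s \<in> S" for s
  proof -
    have s0: "s \<noteq> 0" using min[OF s] convex_cone_hull_contains_0 by auto
    let ?R = "convex_cone hull {s}"
    have "cone_face ?R \<sigma>" unfolding cone_face_iff[OF cc]
    proof (intro conjI ballI impI)
      show "?R \<subseteq> \<sigma>" using s S by (simp add: hull_mono)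
      show "convex_cone ?R" by (rule convex_cone_convex_cone_hull)
      fix a b assume ab: "a \<in> \<sigma>" "b \<in> \<sigma>" "a + b \<in> ?R"
      obtain \<alpha> where \<alpha>: "\<forall>t\<in>S. 0 \<le> \<alpha> t" "a = (\<Sum>t\<in>S. \<alpha> t *\<^sub>R t)"
        using ab S convex_cone_hull_finite[OF S(1)] by auto
      obtain \<beta> where \<beta>: "\<forall>t\<in>S. 0 \<le> \<beta> t" "b = (\<Sum>t\<in>S. \<beta> t *\<^sub>R t)"
        using ab S convex_cone_hull_finite[OF S(1)] by auto
      obtain l where l: "l \<ge> 0" "a + b = l *\<^sub>R s" using ab(3) by (auto simp: convex_cone_hull_singleton)
      define r where "r = \<alpha> s + \<beta> s - l"
      have eq: "r *\<^sub>R s + (\<Sum>t\<in>S - {s}. (\<alpha> t + \<beta> t) *\<^sub>R t) = 0"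
        using l(2) unfolding \<alpha>(2) \<beta>(2) sum.remove[OF S(1) s]
        by (simp add: r_def scaleR_left_distrib scaleR_left_diff_distrib sum.distrib algebra_simps)
      have rest: "(\<Sum>t\<in>S - {s}. (\<alpha> t + \<beta> t) *\<^sub>R t) \<in> convex_cone hull (S - {s})"
        unfolding convex_cone_hull_finite[OF finite_Diff[OF S(1)]] using \<alpha> \<beta>
        by (intro CollectI exI[of _ "\<lambda>t. \<alpha> t + \<beta> t"]) auto
      have "r \<ge> 0"
      proof (rule ccontr)
        assume "\<not> r \<ge> 0"
        have "(- r) *\<^sub>R s = (\<Sum>t\<in>S - {s}. (\<alpha> t + \<beta> t) *\<^sub>R t)" using eq
          by (simp add: add_eq_0_iff)
        then have "(1/(-r)) *\<^sub>R ((- r) *\<^sub>R s) \<in> convex_cone hull (S - {s})"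
          using rest \<open>\<not> r \<ge> 0\<close> by (simp only:) (intro convex_cone_hull_mul, auto)
        then show False using min[OF s] \<open>\<not> r \<ge> 0\<close> by simp
      qed
      define \<gamma> where "\<gamma> t = (if t = s then r else \<alpha> t + \<beta> t)" for t
      have "(\<Sum>t\<in>S. \<gamma> t *\<^sub>R t) = 0" using eq sum.remove[OF S(1) s, of "\<lambda>t. \<gamma> t *\<^sub>R t"]
        by (simp add: \<gamma>_def)
      moreover have "\<gamma> t *\<^sub>R t \<in> \<sigma>" if "t \<in> S" for t
        using that \<alpha> \<beta> \<open>r \<ge> 0\<close> unfolding S(4)
        by (intro convex_cone_hull_mul hull_inc) (auto simp: \<gamma>_def)
      ultimately have z: "\<gamma> t *\<^sub>R t = 0" if "t \<in> S" for t
        using pointed_cone_sum_zero[OF cc pt S(1), of "\<lambda>t. \<gamma> t *\<^sub>R t"] that by blast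
      have "\<alpha> t *\<^sub>R t = 0 \<and> \<beta> t *\<^sub>R t = 0" if "t \<in> S - {s}" for t
      proof (cases "t = 0")
        case False
        then have "\<alpha> t + \<beta> t = 0" using z[of t] that by (simp add: \<gamma>_def)
        then show ?thesis using \<alpha>(1) \<beta>(1) that by (metis Diff_iff add_nonneg_eq_0_iff scaleR_zero_left)
      qed simp
      then have "(\<Sum>t\<in>S - {s}. \<alpha> t *\<^sub>R t) = 0" "(\<Sum>t\<in>S - {s}. \<beta> t *\<^sub>R t) = 0"
        by (simp_all add: sum.neutral)
      then have "a = \<alpha> s *\<^sub>R s" "b = \<beta> s *\<^sub>R s"
        unfolding \<alpha>(2) \<beta>(2) sum.remove[OF S(1) s] by simp_all
      then show "a \<in> ?R" "b \<in> ?R" using \<alpha> \<beta> s by (auto simp: convex_cone_hull_singleton)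
    qed
    moreover have "?R \<subseteq> span {s}" by (auto simp: convex_cone_hull_singleton span_scale span_base)
    then have "span ?R = span {s}" unfolding span_eq by (simp add: span_base hull_inc)
    then have "dim ?R = dim {s}" by (metis dim_span)
    then have "dim ?R = 1" using s0 by (simp add: dim_insert)
    ultimately have R: "?R \<in> rays_of \<sigma>" by (simp add: rays_of_def)
    then obtain t where "t \<ge> 0" "s = t *\<^sub>R prim_gen ?R" using ray(2)[OF R] hull_inc[of s "{s}"] by auto
    then show ?thesis using R by (metis convex_cone_hull_mul hull_inc image_eqI)
  qed
  then show "\<sigma> \<subseteq> convex_cone hull (prim_gen ` rays_of \<sigma>)"
    using S(4) by (metis convex_cone_convex_cone_hull subset_hull subsetI)
qed

lemma rays_of_generator:
  assumes "rational_cone \<sigma>" "\<rho> \<in> rays_of \<sigma>"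
  shows "primitive (prim_gen \<rho>)" "prim_gen \<rho> \<in> \<sigma>" "prim_gen \<rho> \<in> \<rho>"
proof -
  have \<rho>: "cone_face \<rho> \<sigma>" "dim \<rho> = 1" using assms(2) by (auto simp: rays_of_def)
  note r = ray_prim_gen[OF rational_cone_face[OF assms(1) \<rho>(1)] \<rho>(2)]
  show "primitive (prim_gen \<rho>)" by (rule r(1))
  have "prim_gen \<rho> \<in> {t *\<^sub>R prim_gen \<rho> |t. 0 \<le> t}" by (auto intro!: exI[of _ 1])
  then show "prim_gen \<rho> \<in> \<rho>" using r(2) by simp
  then show "prim_gen \<rho> \<in> \<sigma>"
    using \<rho>(1) cone_face_iff[OF rational_cone_convex_cone[OF assms(1)]] by blast
qed

lemma nonneg_on_cone_iff:
  assumes "rational_cone \<sigma>"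
  shows "(\<forall>x\<in>\<sigma>. 0 \<le> u \<bullet> x) \<longleftrightarrow> (\<forall>\<rho>\<in>rays_of \<sigma>. 0 \<le> u \<bullet> prim_gen \<rho>)"
proof
  assume r: "\<forall>\<rho>\<in>rays_of \<sigma>. 0 \<le> u \<bullet> prim_gen \<rho>"
  have "convex_cone hull (prim_gen ` rays_of \<sigma>) \<subseteq> {x. 0 \<le> u \<bullet> x}"
    using r by (intro hull_minimal) (auto simp: convex_cone_halfspace_ge)
  then show "\<forall>x\<in>\<sigma>. 0 \<le> u \<bullet> x" using rational_cone_rays[OF assms] by blast
qed (use rays_of_generator[OF assms] in auto)

lemma full_cone_eq_zero:
  fixes \<sigma> :: "(real^'n::finite) set"
  assumes "rational_cone \<sigma>" "dim \<sigma> = CARD('n)" "\<And>\<rho>. \<rho> \<in> rays_of \<sigma> \<Longrightarrow> u \<bullet> prim_gen \<rho> = 0"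
  shows "u = 0"
proof -
  have "\<forall>x\<in>\<sigma>. 0 \<le> u \<bullet> x" "\<forall>x\<in>\<sigma>. 0 \<le> (- u) \<bullet> x"
    unfolding nonneg_on_cone_iff[OF assms(1)] using assms(3) by auto
  then have z: "\<forall>x\<in>\<sigma>. u \<bullet> x = 0" by force
  have "DIM(real^'n) \<le> dim \<sigma>" using assms(2) by simp
  then have "span \<sigma> = span (UNIV :: (real^'n) set)" by (intro dim_eq_span) (auto simp: dim_UNIV)
  then have "u \<in> span \<sigma>" by simp
  then have "orthogonal u u" using z by (intro orthogonal_to_span[of u \<sigma> u]) (auto simp: orthogonal_def)
  then show ?thesis by (simp add: orthogonal_def)
qed

section \<open>Facets and their primitive normals\<close>

lemma normal_parallel:
  fixes g h :: "real^'n::finite"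
  assumes "Suc (dim F) = CARD('n)" "g \<noteq> 0" "\<And>x. x \<in> F \<Longrightarrow> g \<bullet> x = 0" "\<And>x. x \<in> F \<Longrightarrow> h \<bullet> x = 0"
  shows "\<exists>c. h = c *\<^sub>R g"
proof -
  have "dim {x. g \<bullet> x = 0} = DIM(real^'n) - 1" using dim_hyperplane[OF assms(2)] .
  then have "dim {x. g \<bullet> x = 0} \<le> dim F" using assms(1) by simp
  then have "span F = span {x. g \<bullet> x = 0}" using assms(3) by (intro dim_eq_span) blast
  then have sp: "x \<in> span F" if "g \<bullet> x = 0" for x using that span_base[of x "{x. g \<bullet> x = 0}"] by simp
  have hz: "h \<bullet> x = 0" if "x \<in> span F" for x
    using orthogonal_to_span[OF that, of h] assms(4) by (auto simp: orthogonal_def)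
  define y where "y = h - ((h \<bullet> g) / (g \<bullet> g)) *\<^sub>R g"
  have "g \<bullet> y = 0" using assms(2) by (simp add: y_def inner_diff_right inner_commute)
  then have "h \<bullet> y = 0" using sp hz by blast
  then have "y \<bullet> y = 0" using \<open>g \<bullet> y = 0\<close> by (simp add: y_def inner_diff_left inner_commute)
  then show ?thesis by (auto simp: y_def)
qed

text \<open>
  For a full-dimensional cone these are also the primitive generators of the rays of the dual cone.
\<close>

definition facet_normals :: "(real^'n::finite) set \<Rightarrow> (real^'n) set" where
  "facet_normals \<sigma> = {g. primitive g \<and> (\<forall>x\<in>\<sigma>. 0 \<le> g \<bullet> x) \<and> Suc (dim (\<sigma> \<inter> {x. g \<bullet> x = 0})) = CARD('n)}"

lemma facet_normals_eq_if_parallel: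
  fixes \<sigma> :: "(real^'n::finite) set"
  assumes "dim \<sigma> = CARD('n)" "g \<in> facet_normals \<sigma>" "h \<in> facet_normals \<sigma>" "h = c *\<^sub>R g"
  shows "h = g"
proof (rule ccontr)
  assume "h \<noteq> g"
  then have c: "c = -1" using primitive_parallel[of g h c] assms by (auto simp: facet_normals_def)
  have "\<sigma> \<subseteq> {x. g \<bullet> x = 0}" using assms(2-4) c by (force simp: facet_normals_def)
  then have "dim \<sigma> \<le> dim {x. g \<bullet> x = 0}" by (rule dim_subset)
  moreover have "g \<noteq> 0" using assms(2) by (auto simp: facet_normals_def primitive_def)
  ultimately have "dim \<sigma> \<le> CARD('n) - 1" using dim_hyperplane[of g] by simp
  then show False using assms(1) zero_less_card_finite[where 'a='n] by linarith
qed

lemma facet_normals_properties: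
  fixes \<sigma> :: "(real^'n::finite) set"
  assumes rc: "rational_cone \<sigma>" and full: "dim \<sigma> = CARD('n)"
  shows facet_normals_halfspaces: "\<sigma> = {x. \<forall>g\<in>facet_normals \<sigma>. 0 \<le> g \<bullet> x}"
    and finite_facet_normals: "finite (facet_normals \<sigma>)"
proof -
  have cc: "convex_cone \<sigma>" using rc by (rule rational_cone_convex_cone)
  have aff: "affine hull \<sigma> = UNIV"
  proof -
    have "aff_dim \<sigma> = int (dim \<sigma>)"
      using convex_cone_contains_0[OF cc] by (intro aff_dim_zero) (simp add: hull_inc)
    then have "aff_dim \<sigma> = int DIM(real^'n)" using full by simp
    then show ?thesis by (simp only: aff_dim_eq_full)
  qed
  obtain H where H: "finite H" "\<sigma> = affine hull \<sigma> \<inter> \<Inter>H"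
    "\<forall>h\<in>H. \<exists>a b. a \<noteq> 0 \<and> h = {x. a \<bullet> x \<le> b}" "\<forall>F'. F' \<subset> H \<longrightarrow> \<sigma> \<subset> affine hull \<sigma> \<inter> \<Inter>F'"
    using rational_cone_polyhedron[OF rc] unfolding polyhedron_Int_affine_minimal by metis
  obtain a b where ab: "\<And>h. h \<in> H \<Longrightarrow> a h \<noteq> 0 \<and> h = {x. a h \<bullet> x \<le> b h}" using H(3) by metis
  have "\<exists>g\<in>facet_normals \<sigma>. {x. 0 \<le> g \<bullet> x} = h" if h: "h \<in> H" for h
  proof -
    let ?F = "\<sigma> \<inter> {x. a h \<bullet> x = b h}"
    have facet: "?F facet_of \<sigma>"
      using facet_of_polyhedron_explicit[OF H(1,2) ab, of ?F] H(4) h by blast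
    then have cf: "cone_face ?F \<sigma>" by (auto simp: facet_of_def cone_face_def)
    then have "0 \<in> ?F" using cone_face_iff[OF cc] convex_cone_contains_0 by blast
    then have b0: "b h = 0" by simp
    have "aff_dim ?F = int (dim ?F)" using \<open>0 \<in> ?F\<close> by (intro aff_dim_zero) (simp add: hull_inc)
    moreover have "aff_dim \<sigma> = int (dim \<sigma>)"
      using convex_cone_contains_0[OF cc] by (intro aff_dim_zero) (simp add: hull_inc)
    ultimately have dF: "Suc (dim ?F) = CARD('n)" using facet full by (auto simp: facet_of_def)
    obtain S where S: "finite S" "S \<subseteq> int_lattice" "\<sigma> = convex_cone hull S"
      using rc by (auto simp: rational_cone_def)
    have F: "?F = convex_cone hull (S \<inter> ?F)" using cone_face_generators[OF S(1)] cf S(3) by metis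
    have "dim (S \<inter> ?F) \<le> dim ?F" by (intro dim_subset) auto
    then have "dim (S \<inter> ?F) < CARD('n)" using dF by linarith
    then obtain u where u: "u \<in> int_lattice" "u \<noteq> 0" "\<And>x. x \<in> S \<inter> ?F \<Longrightarrow> u \<bullet> x = 0"
      "\<forall>r. r *\<^sub>R u \<in> int_lattice \<longrightarrow> r \<in> \<int>"
      using primitive_integral_normal[of "S \<inter> ?F"] S by (metis finite_Int le_infI1)
    have "convex_cone {x. u \<bullet> x = 0}" by (simp add: convex_cone_iff inner_add_right)
    then have "convex_cone hull (S \<inter> ?F) \<subseteq> {x. u \<bullet> x = 0}" using u(3) by (intro hull_minimal) auto
    then have uF: "u \<bullet> x = 0" if "x \<in> ?F" for x using F that by blast
    have "a h \<bullet> x = 0" if "x \<in> ?F" for x using that b0 by simp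
    then obtain c where c: "u = c *\<^sub>R a h"
      using normal_parallel[OF dF, of "a h" u] uF ab h by metis
    have c0: "c \<noteq> 0" using c u by auto
    define g where "g = (if c < 0 then u else - u)"
    have g: "g = (- \<bar>c\<bar>) *\<^sub>R a h" using c by (auto simp: g_def)
    have hg: "h = {x. 0 \<le> g \<bullet> x}" using ab[OF h] b0 c0
      by (auto simp: g zero_le_mult_iff mult_le_0_iff)
    have "primitive g" using u unfolding g_def primitive_def
      by (auto intro: int_lattice_uminus) (metis Ints_minus minus_minus scaleR_minus_left)
    moreover have "\<forall>x\<in>\<sigma>. 0 \<le> g \<bullet> x" using H(2) h hg by blast
    moreover have "{x. g \<bullet> x = 0} = {x. a h \<bullet> x = b h}" using c0 b0 by (auto simp: g)
    ultimately have "g \<in> facet_normals \<sigma>" using dF by (simp add: facet_normals_def)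
    then show ?thesis using hg by blast
  qed
  then have "{x. \<forall>g\<in>facet_normals \<sigma>. 0 \<le> g \<bullet> x} \<subseteq> \<Inter>H" by blast
  then show "\<sigma> = {x. \<forall>g\<in>facet_normals \<sigma>. 0 \<le> g \<bullet> x}"
    using H(2) aff by (auto simp: facet_normals_def)
  have "finite ((\<lambda>g. \<sigma> \<inter> {x. g \<bullet> x = 0}) ` facet_normals \<sigma>)"
  proof (rule finite_subset[OF _ finite_polyhedron_faces[OF rational_cone_polyhedron[OF rc]]])
    show "(\<lambda>g. \<sigma> \<inter> {x. g \<bullet> x = 0}) ` facet_normals \<sigma> \<subseteq> {F. F face_of \<sigma>}"
      using cone_face_halfspace[OF cc] by (auto simp: facet_normals_def cone_face_def)
  qed
  moreover have "inj_on (\<lambda>g. \<sigma> \<inter> {x. g \<bullet> x = 0}) (facet_normals \<sigma>)"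
  proof (rule inj_onI)
    fix g h assume gh: "g \<in> facet_normals \<sigma>" "h \<in> facet_normals \<sigma>" "\<sigma> \<inter> {x. g \<bullet> x = 0} = \<sigma> \<inter> {x. h \<bullet> x = 0}"
    then have dF: "Suc (dim (\<sigma> \<inter> {x. g \<bullet> x = 0})) = CARD('n)" "g \<noteq> 0" by (auto simp: facet_normals_def primitive_def)
    obtain c where "h = c *\<^sub>R g" using normal_parallel[OF dF, of h] gh(3) by blast
    then show "g = h" using facet_normals_eq_if_parallel[OF full gh(1,2)] by metis
  qed
  ultimately show "finite (facet_normals \<sigma>)" by (rule finite_imageD)
qed

lemma facet_normal_cone_face:
  assumes "rational_cone \<sigma>" "g \<in> facet_normals \<sigma>"
  shows "cone_face (\<sigma> \<inter> {x. g \<bullet> x = 0}) \<sigma>"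
  using assms cone_face_halfspace rational_cone_convex_cone unfolding facet_normals_def by blast

text \<open>
  Only the inequality of the facet itself is tight at a point of its relative interior, because two
  facets with a common relative interior point have parallel normals.
\<close>

lemma facet_local_halfspace:
  fixes \<sigma> :: "(real^'n::finite) set"
  assumes rc: "rational_cone \<sigma>" and full: "dim \<sigma> = CARD('n)" and g: "g \<in> facet_normals \<sigma>"
    and x: "x \<in> rel_interior (\<sigma> \<inter> {x. g \<bullet> x = 0})" and z: "0 < g \<bullet> z"
  shows "\<exists>\<epsilon>>0. x + \<epsilon> *\<^sub>R z \<in> \<sigma>"
proof -
  let ?\<omega> = "\<sigma> \<inter> {x. g \<bullet> x = 0}"
  have x\<omega>: "x \<in> ?\<omega>" using x rel_interior_subset by blast
  have \<omega>: "cone_face ?\<omega> \<sigma>" by (rule facet_normal_cone_face[OF rc g])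
  have cc: "convex_cone \<sigma>" by (rule rational_cone_convex_cone[OF rc])
  have pos: "0 < h \<bullet> x" if h: "h \<in> facet_normals \<sigma>" "h \<noteq> g" for h
  proof (rule ccontr)
    assume "\<not> 0 < h \<bullet> x"
    then have hx: "h \<bullet> x = 0" using x\<omega> h by (force simp: facet_normals_def)
    let ?F = "\<sigma> \<inter> {x. h \<bullet> x = 0}"
    have "cone_face ?F \<sigma>" by (rule facet_normal_cone_face[OF rc h(1)])
    then have "?\<omega> \<subseteq> ?F"
      using subset_of_face_of[of ?F \<sigma> ?\<omega>] x hx x\<omega> unfolding cone_face_def by blast
    then have "h \<bullet> y = 0" if "y \<in> ?\<omega>" for y using that by blast
    moreover have "Suc (dim ?\<omega>) = CARD('n)" "g \<noteq> 0" using g by (auto simp: facet_normals_def primitive_def)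
    ultimately obtain c where "h = c *\<^sub>R g"
      using normal_parallel[of ?\<omega> g h] by blast
    then show False using facet_normals_eq_if_parallel[OF full g h(1)] h(2) by blast
  qed
  have ev: "\<forall>\<^sub>F \<epsilon> in at_right 0. 0 \<le> h \<bullet> (x + \<epsilon> *\<^sub>R z)" if h: "h \<in> facet_normals \<sigma>" for h
  proof (cases "h = g")
    case True
    have "\<forall>\<^sub>F \<epsilon> in at_right 0. \<epsilon> > (0::real)" by (simp add: eventually_at_right_less)
    then show ?thesis using x\<omega> z True by (auto elim!: eventually_mono simp: inner_add_right)
  next
    case False
    have "((\<lambda>\<epsilon>. h \<bullet> (x + \<epsilon> *\<^sub>R z)) \<longlongrightarrow> h \<bullet> (x + 0 *\<^sub>R z)) (at_right 0)"
      by (intro tendsto_intros)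
    then have "\<forall>\<^sub>F \<epsilon> in at_right 0. 0 < h \<bullet> (x + \<epsilon> *\<^sub>R z)"
      using pos[OF h False] by (intro order_tendstoD(1)) auto
    then show ?thesis by (auto elim: eventually_mono)
  qed
  then have "\<forall>\<^sub>F \<epsilon> in at_right 0. \<forall>h\<in>facet_normals \<sigma>. 0 \<le> h \<bullet> (x + \<epsilon> *\<^sub>R z)"
    by (intro eventually_ball_finite finite_facet_normals[OF rc full]) auto
  moreover have "\<forall>\<^sub>F \<epsilon> in at_right 0. \<epsilon> > (0::real)" by (simp add: eventually_at_right_less)
  ultimately have "\<forall>\<^sub>F \<epsilon> in at_right 0. \<epsilon> > (0::real) \<and> x + \<epsilon> *\<^sub>R z \<in> \<sigma>"
    by (rule eventually_elim2) (use facet_normals_halfspaces[OF rc full] in blast)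
  then show ?thesis using eventually_happens'[OF trivial_limit_at_right_real] by blast
qed

section \<open>Complete fans\<close>

locale complete_fan =
  fixes \<Sigma> :: "(real^'n::finite) set set"
  assumes fan: "fan \<Sigma>" and complete: "\<Union>\<Sigma> = UNIV"
begin

lemma rational: "\<sigma> \<in> \<Sigma> \<Longrightarrow> rational_cone \<sigma>"
  using fan by (auto simp: fan_def)
lemma convex_cone: "\<sigma> \<in> \<Sigma> \<Longrightarrow> convex_cone \<sigma>"
  using rational rational_cone_convex_cone by blast
lemma closed_cone: "\<sigma> \<in> \<Sigma> \<Longrightarrow> closed \<sigma>"
  using rational rational_cone_polyhedron polyhedron_imp_closed by blast
lemma face_in_fan: "\<sigma> \<in> \<Sigma> \<Longrightarrow> cone_face \<tau> \<sigma> \<Longrightarrow> \<tau> \<in> \<Sigma>"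
  using fan by (auto simp: fan_def)
lemma Int_face: "\<sigma> \<in> \<Sigma> \<Longrightarrow> \<tau> \<in> \<Sigma> \<Longrightarrow> cone_face (\<sigma> \<inter> \<tau>) \<sigma> \<and> cone_face (\<sigma> \<inter> \<tau>) \<tau>"
  using fan by (auto simp: fan_def)
lemma finite_fan: "finite \<Sigma>"
  using fan by (auto simp: fan_def)

lemma subset_imp_face: "\<sigma> \<in> \<Sigma> \<Longrightarrow> \<tau> \<in> \<Sigma> \<Longrightarrow> \<sigma> \<subseteq> \<tau> \<Longrightarrow> cone_face \<sigma> \<tau>"
  using Int_face[of \<sigma> \<tau>] by (simp add: Int_absorb2)

text \<open>
  The cones of smaller dimension form a null set, and the union of the others is closed.
\<close>

lemma full_cones_cover: "\<Union>{\<sigma>\<in>\<Sigma>. dim \<sigma> = CARD('n)} = UNIV"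
proof -
  let ?L = "{\<sigma>\<in>\<Sigma>. dim \<sigma> \<noteq> CARD('n)}"
  have cl: "closed (\<Union>{\<sigma>\<in>\<Sigma>. dim \<sigma> = CARD('n)})"
    using finite_fan closed_cone by (intro closed_Union) auto
  have "negligible (\<Union>?L)"
  proof (intro negligible_Union)
    fix \<sigma> assume "\<sigma> \<in> ?L"
    then have "dim \<sigma> \<noteq> DIM(real^'n)" by simp
    moreover have "dim \<sigma> \<le> DIM(real^'n)" by (rule dim_subset_UNIV)
    ultimately show "negligible \<sigma>" by (intro negligible_lowdim) linarith
  qed (use finite_fan in auto)
  moreover have "- \<Union>{\<sigma>\<in>\<Sigma>. dim \<sigma> = CARD('n)} \<subseteq> \<Union>?L" using complete by auto
  ultimately have "negligible (- \<Union>{\<sigma>\<in>\<Sigma>. dim \<sigma> = CARD('n)})" using negligible_subset by blast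
  then have "- \<Union>{\<sigma>\<in>\<Sigma>. dim \<sigma> = CARD('n)} = {}"
    using cl open_not_negligible[of "- \<Union>{\<sigma>\<in>\<Sigma>. dim \<sigma> = CARD('n)}"] open_Compl by blast
  then show ?thesis by auto
qed

lemma maximal_cones_eq: "maximal_cones \<Sigma> = {\<sigma>\<in>\<Sigma>. dim \<sigma> = CARD('n)}"
proof (intro subset_antisym subsetI CollectI conjI; (elim CollectE conjE)?)
  fix \<sigma> assume s: "\<sigma> \<in> maximal_cones \<Sigma>"
  then show \<Sigma>: "\<sigma> \<in> \<Sigma>" by (auto simp: maximal_cones_def)
  have "convex \<sigma>" "\<sigma> \<noteq> {}" using convex_cone[OF \<Sigma>] by (auto simp: convex_cone_def)
  then obtain x where x: "x \<in> rel_interior \<sigma>" using rel_interior_eq_empty by blast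
  then obtain \<tau> where \<tau>: "\<tau> \<in> \<Sigma>" "dim \<tau> = CARD('n)" "x \<in> \<tau>" using full_cones_cover by blast
  have "x \<in> \<sigma>" using x rel_interior_subset by blast
  then have "\<sigma> \<subseteq> \<sigma> \<inter> \<tau>"
    using subset_of_face_of[of "\<sigma> \<inter> \<tau>" \<sigma> \<sigma>] Int_face[OF \<Sigma> \<tau>(1)] x \<tau>(3) unfolding cone_face_def by blast
  then show "dim \<sigma> = CARD('n)" using s \<tau> unfolding maximal_cones_def by blast
next
  fix \<sigma> assume s: "\<sigma> \<in> \<Sigma>" "dim \<sigma> = CARD('n)"
  have "\<tau> = \<sigma>" if "\<tau> \<in> \<Sigma>" "\<sigma> \<subseteq> \<tau>" for \<tau>
  proof -
    have "dim \<tau> \<le> DIM(real^'n)" by (rule dim_subset_UNIV)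
    then show ?thesis
      using cone_face_eq_if_dim[OF convex_cone[OF that(1)] subset_imp_face[OF s(1) that]] s(2) by simp
  qed
  then show "\<sigma> \<in> maximal_cones \<Sigma>" using s by (auto simp: maximal_cones_def)
qed

lemma maximalD: "\<sigma> \<in> maximal_cones \<Sigma> \<Longrightarrow> \<sigma> \<in> \<Sigma>" "\<sigma> \<in> maximal_cones \<Sigma> \<Longrightarrow> dim \<sigma> = CARD('n)"
  by (auto simp: maximal_cones_eq)

lemma ray_gen:
  assumes "\<rho> \<in> rays \<Sigma>"
  shows "primitive (prim_gen \<rho>)" "prim_gen \<rho> \<in> \<rho>" "\<rho> = {t *\<^sub>R prim_gen \<rho> | t. t \<ge> 0}"
proof -
  note r = ray_prim_gen[OF rational]
  show "primitive (prim_gen \<rho>)" "\<rho> = {t *\<^sub>R prim_gen \<rho> | t. t \<ge> 0}"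
    using assms r by (auto simp: rays_def)
  then show "prim_gen \<rho> \<in> \<rho>" by (smt (verit, best) mem_Collect_eq scaleR_one)
qed

lemma ray_mem_cone:
  assumes "\<rho> \<in> rays \<Sigma>" "\<tau> \<in> \<Sigma>" "prim_gen \<rho> \<in> \<tau>"
  shows "\<rho> \<in> rays_of \<tau>"
proof -
  have "\<rho> \<subseteq> \<tau>"
    by (subst ray_gen(3)[OF assms(1)]) (auto intro: convex_cone_scaleR[OF convex_cone[OF assms(2)] _ assms(3)])
  then show ?thesis using subset_imp_face[of \<rho> \<tau>] assms by (auto simp: rays_of_def rays_def)
qed

lemma rays_of_rays: "\<tau> \<in> \<Sigma> \<Longrightarrow> \<rho> \<in> rays_of \<tau> \<Longrightarrow> \<rho> \<in> rays \<Sigma>"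
  using face_in_fan by (auto simp: rays_def rays_of_def)

lemma maximal_nonempty: "maximal_cones \<Sigma> \<noteq> {}"
  using full_cones_cover maximal_cones_eq by auto

lemma not_mem_maximal:
  assumes "\<sigma> \<in> maximal_cones \<Sigma>" "v \<notin> \<sigma>" "v \<in> int_lattice"
  obtains g where "g \<in> facet_normals \<sigma>" "g \<bullet> v \<le> -1"
proof -
  obtain g where g: "g \<in> facet_normals \<sigma>" "g \<bullet> v < 0"
    using facet_normals_halfspaces[OF rational[OF maximalD(1)[OF assms(1)]] maximalD(2)[OF assms(1)]] assms(2)
    by (smt (verit) mem_Collect_eq)
  then have "g \<bullet> v \<in> \<int>" using assms(3) int_lattice_inner by (auto simp: facet_normals_def primitive_def)
  then show thesis using that[OF g(1)] Int_less_imp_le_minus_1[of "g \<bullet> v" 0] g(2) by simp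
qed

text \<open>
  If the second cone contained a point on the positive side of the facet, moving from a relative
  interior point of the facet towards it would give a common point of both cones that is not on the
  facet. Hence the cones lie on different sides.
\<close>

lemma facet_opposite:
  assumes \<sigma>: "\<sigma> \<in> maximal_cones \<Sigma>" and \<tau>: "\<tau> \<in> maximal_cones \<Sigma>" "\<tau> \<noteq> \<sigma>"
    and g: "g \<in> facet_normals \<sigma>" and sub: "\<sigma> \<inter> {x. g \<bullet> x = 0} \<subseteq> \<tau>"
  shows "\<sigma> \<inter> \<tau> = \<sigma> \<inter> {x. g \<bullet> x = 0}" "- g \<in> facet_normals \<tau>"
    "\<tau> \<inter> {x. g \<bullet> x = 0} = \<sigma> \<inter> {x. g \<bullet> x = 0}"
proof -
  let ?\<omega> = "\<sigma> \<inter> {x. g \<bullet> x = 0}"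
  note \<sigma>' = maximalD[OF \<sigma>] and \<tau>' = maximalD[OF \<tau>(1)]
  note rc = rational[OF \<sigma>'(1)] rational[OF \<tau>'(1)]
  note cc = convex_cone[OF \<sigma>'(1)] convex_cone[OF \<tau>'(1)]
  have d\<omega>: "Suc (dim ?\<omega>) = CARD('n)" and pg: "primitive g" and g0: "g \<noteq> 0" using g by (auto simp: facet_normals_def primitive_def)
  have \<omega>: "cone_face ?\<omega> \<sigma>" by (rule facet_normal_cone_face[OF rc(1) g])
  have fs: "cone_face (\<sigma> \<inter> \<tau>) \<sigma>" and ft: "cone_face (\<sigma> \<inter> \<tau>) \<tau>" using Int_face \<sigma>' \<tau>' by auto
  have "\<sigma> \<inter> \<tau> \<noteq> \<sigma>" using \<sigma> \<tau> \<tau>' unfolding maximal_cones_def by blast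
  then have "dim (\<sigma> \<inter> \<tau>) < dim \<sigma>" using cone_face_eq_if_dim[OF cc(1) fs] by linarith
  then have "dim (\<sigma> \<inter> \<tau>) \<le> dim ?\<omega>" using d\<omega> \<sigma>'(2) by linarith
  then have "span ?\<omega> = span (\<sigma> \<inter> \<tau>)" using sub by (intro dim_eq_span) auto
  then show eq: "\<sigma> \<inter> \<tau> = ?\<omega>"
    using cone_face_Int_span[OF cc(1) fs] cone_face_Int_span[OF cc(1) \<omega>] by simp
  have "convex ?\<omega>" "?\<omega> \<noteq> {}" using \<omega> unfolding cone_face_def by (auto dest: face_of_imp_convex)
  then obtain x where x: "x \<in> rel_interior ?\<omega>" using rel_interior_eq_empty by blast
  then have x\<tau>: "x \<in> \<tau>" "g \<bullet> x = 0" using sub rel_interior_subset by blast+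
  have neg: "g \<bullet> z \<le> 0" if z: "z \<in> \<tau>" for z
  proof (rule ccontr)
    assume "\<not> g \<bullet> z \<le> 0"
    then obtain \<epsilon> where e: "\<epsilon> > 0" "x + \<epsilon> *\<^sub>R z \<in> \<sigma>"
      using facet_local_halfspace[OF rc(1) \<sigma>'(2) g x, of z] by auto
    then have "x + \<epsilon> *\<^sub>R z \<in> \<tau>" using x\<tau>(1) z cc(2) by (simp add: convex_cone_iff)
    then have "g \<bullet> (x + \<epsilon> *\<^sub>R z) = 0" using e eq by blast
    then show False using x\<tau>(2) e \<open>\<not> g \<bullet> z \<le> 0\<close> by (simp add: inner_add_right)
  qed
  let ?F = "\<tau> \<inter> {x. g \<bullet> x = 0}"
  have "{x. g \<bullet> x = 0} = {x. - g \<bullet> x = 0}" by auto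
  then have F: "cone_face ?F \<tau>"
    using cone_face_halfspace[OF cc(2), of "- g"] neg by simp
  have "dim ?F \<le> dim {x. g \<bullet> x = 0}" by (intro dim_subset) auto
  then have "dim ?F \<le> CARD('n) - 1" using dim_hyperplane[OF g0] by simp
  then have "dim ?F \<le> dim ?\<omega>" using d\<omega> by linarith
  moreover have s: "?\<omega> \<subseteq> ?F" using sub by auto
  ultimately have sp: "span ?\<omega> = span ?F" by (intro dim_eq_span) auto
  then have dF: "dim ?F = dim ?\<omega>" by (metis dim_span)
  have "primitive (- g)" using pg unfolding primitive_def
    by (auto intro: int_lattice_uminus) (metis Ints_minus minus_minus scaleR_minus_left)
  then show "- g \<in> facet_normals \<tau>" using neg d\<omega> dF by (simp add: facet_normals_def)
  show "?F = ?\<omega>"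
    using cone_face_Int_span[OF cc(2) F] cone_face_Int_span[OF cc(2) ft] sp eq by simp
qed

text \<open>
  Points just behind the facet lie in some other full-dimensional cone, and it contains the facet
  because cones are closed and meet in faces. There cannot be two such cones: each of them would lie
  on the negative side of the facet, and on the opposite side of the other one.
\<close>

lemma facet_neighbour:
  assumes \<sigma>: "\<sigma> \<in> maximal_cones \<Sigma>" and g: "g \<in> facet_normals \<sigma>"
  obtains \<tau> where "\<tau> \<in> maximal_cones \<Sigma>" "\<tau> \<noteq> \<sigma>" "\<sigma> \<inter> \<tau> = \<sigma> \<inter> {x. g \<bullet> x = 0}" "- g \<in> facet_normals \<tau>"
    "\<tau> \<inter> {x. g \<bullet> x = 0} = \<sigma> \<inter> {x. g \<bullet> x = 0}"
    "\<And>\<gamma>. \<gamma> \<in> \<Sigma> \<Longrightarrow> \<sigma> \<inter> {x. g \<bullet> x = 0} \<subseteq> \<gamma> \<Longrightarrow> \<gamma> = \<sigma> \<inter> {x. g \<bullet> x = 0} \<or> \<gamma> = \<sigma> \<or> \<gamma> = \<tau>"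
proof -
  let ?\<omega> = "\<sigma> \<inter> {x. g \<bullet> x = 0}"
  note \<sigma>' = maximalD[OF \<sigma>]
  note rc = rational[OF \<sigma>'(1)]
  have d\<omega>: "Suc (dim ?\<omega>) = CARD('n)" and g0: "g \<noteq> 0" using g by (auto simp: facet_normals_def primitive_def)
  have \<omega>: "cone_face ?\<omega> \<sigma>" by (rule facet_normal_cone_face[OF rc g])
  have "convex ?\<omega>" "?\<omega> \<noteq> {}" using \<omega> unfolding cone_face_def by (auto dest: face_of_imp_convex)
  then obtain x where x: "x \<in> rel_interior ?\<omega>" using rel_interior_eq_empty by blast
  then have x\<omega>: "x \<in> ?\<omega>" using rel_interior_subset by blast
  let ?U = "\<Union>(maximal_cones \<Sigma> - {\<sigma>})"
  have clU: "closed ?U"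
    using finite_fan closed_cone unfolding maximal_cones_eq by (intro closed_Union) auto
  have "x \<in> ?U"
  proof (rule ccontr)
    assume "x \<notin> ?U"
    then obtain e where e: "e > 0" "ball x e \<subseteq> - ?U" using clU by (metis ComplI open_Compl open_contains_ball)
    \<comment> \<open>a point behind the facet, close to \<open>x\<close>\<close>
    define y where "y = x - (e / (2 * norm g)) *\<^sub>R g"
    have "y \<in> ball x e" using e g0 by (simp add: y_def dist_norm)
    then have "y \<in> \<sigma>" using e full_cones_cover maximal_cones_eq by blast
    then have "0 \<le> g \<bullet> y" using g by (auto simp: facet_normals_def)
    moreover have "g \<bullet> y < 0" using x\<omega> e g0 by (simp add: y_def inner_diff_right)
    ultimately show False by simp
  qed
  then obtain \<tau> where \<tau>: "\<tau> \<in> maximal_cones \<Sigma>" "\<tau> \<noteq> \<sigma>" "x \<in> \<tau>" by blast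
  have fs: "cone_face (\<sigma> \<inter> \<tau>) \<sigma>" using Int_face \<sigma>' maximalD \<tau> by auto
  then have "?\<omega> \<subseteq> \<sigma> \<inter> \<tau>"
    using subset_of_face_of[of "\<sigma> \<inter> \<tau>" \<sigma> ?\<omega>] x x\<omega> \<tau>(3) unfolding cone_face_def by blast
  then have sub: "?\<omega> \<subseteq> \<tau>" by blast
  note opp = facet_opposite[OF \<sigma> \<tau>(1,2) g sub]
  have "\<gamma> = ?\<omega> \<or> \<gamma> = \<sigma> \<or> \<gamma> = \<tau>" if \<gamma>: "\<gamma> \<in> \<Sigma>" "?\<omega> \<subseteq> \<gamma>" for \<gamma>
  proof (rule ccontr)
    assume n: "\<not> ?thesis"
    have "cone_face ?\<omega> \<gamma>" using subset_imp_face face_in_fan \<omega> \<sigma>'(1) \<gamma> by blast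
    then have "dim ?\<omega> < dim \<gamma>"
      using cone_face_eq_if_dim[OF convex_cone[OF \<gamma>(1)], of ?\<omega>] n by (metis not_le)
    moreover have "dim \<gamma> \<le> DIM(real^'n)" by (rule dim_subset_UNIV)
    ultimately have dg: "dim \<gamma> = CARD('n)" using d\<omega> by simp
    then have m: "\<gamma> \<in> maximal_cones \<Sigma>" using \<gamma> maximal_cones_eq by blast
    have "- g \<in> facet_normals \<gamma>" using facet_opposite(2)[OF \<sigma> m _ g \<gamma>(2)] n by blast
    moreover have "{x. - g \<bullet> x = 0} = {x. g \<bullet> x = 0}" by auto
    then have "- (- g) \<in> facet_normals \<gamma>"
      using facet_opposite(2)[OF \<tau>(1) m _ opp(2)] n opp(3) \<gamma>(2) by auto
    ultimately have "- (-g) = - g" using facet_normals_eq_if_parallel[OF dg, of "-g" "-(-g)" "-1"] by simp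
    then show False using g0 by (simp add: eq_neg_iff_add_eq_0 flip: scaleR_2)
  qed
  then show thesis using that[OF \<tau>(1,2) opp] by blast
qed

end

section \<open>The fan of projective space\<close>

lemma independent_cone_face:
  fixes K :: "(real^'n::finite) set"
  assumes "independent K" "S \<subseteq> K"
  shows "cone_face (convex_cone hull S) (convex_cone hull K)"
  unfolding cone_face_iff[OF convex_cone_convex_cone_hull]
proof (intro conjI ballI impI)
  have finK: "finite K" and finS: "finite S"
    using assms independent_imp_finite finite_subset by blast+
  show "convex_cone hull S \<subseteq> convex_cone hull K" using assms(2) by (rule hull_mono)
  show "convex_cone (convex_cone hull S)" by (rule convex_cone_convex_cone_hull)
  fix a b assume ab: "a \<in> convex_cone hull K" "b \<in> convex_cone hull K" "a + b \<in> convex_cone hull S"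
  obtain \<alpha> where \<alpha>: "\<forall>t\<in>K. 0 \<le> \<alpha> t" "a = (\<Sum>t\<in>K. \<alpha> t *\<^sub>R t)"
    using ab convex_cone_hull_finite[OF finK] by auto
  obtain \<beta> where \<beta>: "\<forall>t\<in>K. 0 \<le> \<beta> t" "b = (\<Sum>t\<in>K. \<beta> t *\<^sub>R t)"
    using ab convex_cone_hull_finite[OF finK] by auto
  obtain \<gamma> where \<gamma>: "a + b = (\<Sum>t\<in>S. \<gamma> t *\<^sub>R t)"
    using ab convex_cone_hull_finite[OF finS] by auto
  have "(\<Sum>t\<in>S. \<gamma> t *\<^sub>R t) = (\<Sum>t\<in>K. (if t \<in> S then \<gamma> t else 0) *\<^sub>R t)"
    using assms(2) finK by (intro sum.mono_neutral_cong_left) auto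
  then have "(\<Sum>t\<in>K. (\<alpha> t + \<beta> t - (if t \<in> S then \<gamma> t else 0)) *\<^sub>R t) = 0"
    using \<gamma> by (simp add: \<alpha>(2) \<beta>(2) scaleR_left_diff_distrib scaleR_left_distrib sum.distrib sum_subtractf)
  then have z: "\<alpha> t + \<beta> t - (if t \<in> S then \<gamma> t else 0) = 0" if "t \<in> K" for t
    by (rule independentD[OF assms(1) finK subset_refl _ that])
  have "\<alpha> t = 0 \<and> \<beta> t = 0" if "t \<in> K - S" for t
  proof -
    have "\<alpha> t + \<beta> t = 0" "0 \<le> \<alpha> t" "0 \<le> \<beta> t" using z[of t] \<alpha> \<beta> that by auto
    then show ?thesis by linarith
  qed
  then have "a = (\<Sum>t\<in>S. \<alpha> t *\<^sub>R t)" "b = (\<Sum>t\<in>S. \<beta> t *\<^sub>R t)"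
    unfolding \<alpha>(2) \<beta>(2) using assms(2) finK by (auto intro!: sum.mono_neutral_right)
  then show "a \<in> convex_cone hull S" "b \<in> convex_cone hull S"
    using \<alpha>(1) \<beta>(1) assms(2) unfolding convex_cone_hull_finite[OF finS] by blast+
qed

text \<open>
  The vectors \<open>r i\<close> form a basis of $N$, because the dual vectors \<open>w i\<close> are integral as well.
\<close>

definition projective_space_fan :: "(real^'n::finite) set set \<Rightarrow> bool" where
  "projective_space_fan \<Sigma> \<longleftrightarrow>
     (\<exists>r w :: 'n \<Rightarrow> real^'n. (\<forall>i. r i \<in> int_lattice) \<and> (\<forall>i. w i \<in> int_lattice) \<and>
        (\<forall>i j. w i \<bullet> r j = (if i = j then 1 else 0)) \<and>
        \<Sigma> = {convex_cone hull S | S. S \<subset> insert (- (\<Sum>i\<in>UNIV. r i)) (range r)})"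

lemma dual_basis_expansion:
  fixes r w :: "'n::finite \<Rightarrow> real^'n"
  assumes dual: "\<And>i j. w i \<bullet> r j = (if i = j then 1 else 0)"
  shows "x = (\<Sum>i\<in>UNIV. (w i \<bullet> x) *\<^sub>R r i)" "independent (range r)" "inj r"
proof -
  show inj: "inj r"
    by (rule injI) (metis dual zero_neq_one)
  have coeff: "w j \<bullet> (\<Sum>i\<in>UNIV. c i *\<^sub>R r i) = c j" for c j
    by (simp add: inner_sum_right dual if_distrib[of "\<lambda>x. _ * x"] cong: if_cong)
  show ind: "independent (range r)"
  proof (rule independent_if_scalars_zero)
    fix f x assume "(\<Sum>x\<in>range r. f x *\<^sub>R x) = 0" "x \<in> range r"
    then have "(\<Sum>i\<in>UNIV. f (r i) *\<^sub>R r i) = 0" by (simp add: sum.reindex[OF inj])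
    then have "f (r j) = 0" for j using coeff[of j "\<lambda>i. f (r i)"] by simp
    then show "f x = 0" using \<open>x \<in> range r\<close> by auto
  qed simp
  have "card (range r) = DIM(real^'n)" using inj by (simp add: card_image)
  then have "span (range r) = UNIV"
    using ind card_ge_dim_independent[of "range r" UNIV] by auto
  then have "x \<in> span (range r)" by simp
  then obtain c where "x = (\<Sum>i\<in>UNIV. c i *\<^sub>R r i)"
    unfolding span_finite[OF finite_imageI[OF finite]] by (auto simp: sum.reindex[OF inj])
  then show "x = (\<Sum>i\<in>UNIV. (w i \<bullet> x) *\<^sub>R r i)" using coeff by simp
qed

context complete_fan begin

lemma subset_maximal:
  assumes "\<gamma> \<in> \<Sigma>" obtains \<tau> where "\<tau> \<in> maximal_cones \<Sigma>" "\<gamma> \<subseteq> \<tau>"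
proof -
  have "convex \<gamma>" "\<gamma> \<noteq> {}" using convex_cone[OF assms] by (auto simp: convex_cone_def)
  then obtain x where x: "x \<in> rel_interior \<gamma>" using rel_interior_eq_empty by blast
  then obtain \<tau> where \<tau>: "\<tau> \<in> \<Sigma>" "dim \<tau> = CARD('n)" "x \<in> \<tau>" using full_cones_cover by blast
  have "x \<in> \<gamma>" using x rel_interior_subset by blast
  then have "\<gamma> \<subseteq> \<gamma> \<inter> \<tau>"
    using subset_of_face_of[of "\<gamma> \<inter> \<tau>" \<gamma> \<gamma>] Int_face[OF assms \<tau>(1)] x \<tau>(3) unfolding cone_face_def by blast
  then show thesis using that[of \<tau>] \<tau> maximal_cones_eq by blast
qed

text \<open>
  The cone generated by all \<open>r j\<close> except \<open>r i\<close>, together with $v = -\sum_j r_j$, consists of the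
  points whose \<open>i\<close>-th coordinate is least and not positive. So these cones and $\sigma$ cover the
  space. The cone \<open>\<tau> i\<close> cannot be larger than the one just described: a point of it with
  smaller \<open>k\<close>-th coordinate lies in \<open>\<tau> k\<close> and involves \<open>r i\<close> there, so \<open>r i\<close> would belong to
  the common face of \<open>\<tau> i\<close> and \<open>\<tau> k\<close>, although \<open>w i\<close> is not positive on \<open>\<tau> i\<close>.
\<close>

lemma projective_space_fanI:
  fixes r w :: "'n \<Rightarrow> real^'n"
  assumes int: "\<And>i. r i \<in> int_lattice" "\<And>i. w i \<in> int_lattice"
    and dual: "\<And>i j. w i \<bullet> r j = (if i = j then 1 else 0)"
    and \<sigma>: "\<sigma> \<in> maximal_cones \<Sigma>" "\<sigma> = convex_cone hull (range r)"
    and \<tau>: "\<And>i. \<tau> i \<in> maximal_cones \<Sigma>" "\<And>i x. x \<in> \<tau> i \<Longrightarrow> w i \<bullet> x \<le> 0"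
      "\<And>i j. i \<noteq> j \<Longrightarrow> r j \<in> \<tau> i" "\<And>i. - (\<Sum>i\<in>UNIV. r i) \<in> \<tau> i"
  shows "projective_space_fan \<Sigma>"
proof -
  let ?v = "- (\<Sum>i\<in>UNIV. r i)"
  let ?R = "insert ?v (range r)"
  note expand = dual_basis_expansion(1)[OF dual] and ind = dual_basis_expansion(2)[OF dual] and inj = dual_basis_expansion(3)[OF dual]
  have wv: "w i \<bullet> ?v = -1" for i by (simp add: inner_sum_right dual)
  have vr: "?v \<noteq> r i" for i
  proof
    assume "?v = r i"
    then have "w i \<bullet> ?v = 1" by (simp add: dual)
    then show False using wv[of i] by simp
  qed
  have cc: "convex_cone (\<tau> i)" for i using \<tau>(1) convex_cone maximalD by blast
  let ?K = "\<lambda>i. ?R - {r i}"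
  have Ksub: "convex_cone hull (?K i) \<subseteq> \<tau> i" for i
    using \<tau>(3)[of i] \<tau>(4)[of i] cc[of i] by (intro hull_minimal) force+
  have rK: "r j \<in> convex_cone hull (?K i)" if "i \<noteq> j" for i j
    using that inj by (intro hull_inc) (auto simp: inj_eq)
  have vK: "?v \<in> convex_cone hull (?K i)" for i using vr by (intro hull_inc) (auto dest: sym)
  have inK: "x \<in> convex_cone hull (?K i)" if "w i \<bullet> x \<le> 0" "\<And>j. w i \<bullet> x \<le> w j \<bullet> x" for i x
  proof -
    have "x = (- (w i \<bullet> x)) *\<^sub>R ?v + (\<Sum>j\<in>UNIV. (w j \<bullet> x - w i \<bullet> x) *\<^sub>R r j)"
      using expand[of x] by (simp add: scaleR_left_diff_distrib sum_subtractf scaleR_sum_right sum_negf)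
    also have "(\<Sum>j\<in>UNIV. (w j \<bullet> x - w i \<bullet> x) *\<^sub>R r j) = (\<Sum>j\<in>UNIV - {i}. (w j \<bullet> x - w i \<bullet> x) *\<^sub>R r j)"
      by (intro sum.mono_neutral_right) auto
    finally have eq: "x = (- (w i \<bullet> x)) *\<^sub>R ?v + (\<Sum>j\<in>UNIV - {i}. (w j \<bullet> x - w i \<bullet> x) *\<^sub>R r j)" .
    have "(\<Sum>j\<in>J. (w j \<bullet> x - w i \<bullet> x) *\<^sub>R r j) \<in> convex_cone hull (?K i)" if "J \<subseteq> UNIV - {i}" for J
      using finite[of J] that
    proof (induction J rule: finite_induct)
      case (insert j J)
      then have "(w j \<bullet> x - w i \<bullet> x) *\<^sub>R r j \<in> convex_cone hull (?K i)"
        using rK[of i j] \<open>\<And>j. w i \<bullet> x \<le> w j \<bullet> x\<close>[of j] by (intro convex_cone_hull_mul) auto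
      then show ?case using insert by (simp add: convex_cone_hull_add)
    qed (simp add: convex_cone_hull_contains_0)
    then have "(\<Sum>j\<in>UNIV - {i}. (w j \<bullet> x - w i \<bullet> x) *\<^sub>R r j) \<in> convex_cone hull (?K i)" by blast
    moreover have "(- (w i \<bullet> x)) *\<^sub>R ?v \<in> convex_cone hull (?K i)"
      using vK that(1) by (intro convex_cone_hull_mul) auto
    ultimately show ?thesis by (subst eq) (rule convex_cone_hull_add)
  qed
  have min: "\<exists>i. \<forall>j. w i \<bullet> x \<le> w j \<bullet> x" for x
  proof -
    have "finite (range (\<lambda>i. w i \<bullet> x))" by simp
    then have "Min (range (\<lambda>i. w i \<bullet> x)) \<in> range (\<lambda>i. w i \<bullet> x)" by (intro Min_in) auto
    then obtain i where i: "Min (range (\<lambda>i. w i \<bullet> x)) = w i \<bullet> x" by (rule rangeE)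
    show ?thesis by (rule exI[of _ i]) (auto simp flip: i intro!: Min_le)
  qed
  have \<tau>K: "\<tau> i = convex_cone hull (?K i)" for i
  proof (rule subset_antisym[OF _ Ksub], rule subsetI)
    fix x assume x: "x \<in> \<tau> i"
    obtain k where k: "\<forall>j. w k \<bullet> x \<le> w j \<bullet> x" using min by blast
    show "x \<in> convex_cone hull (?K i)"
    proof (cases "w i \<bullet> x = w k \<bullet> x")
      case True
      then show ?thesis using inK[of i x] \<tau>(2)[OF x] k by auto
    next
      case False
      then have lt: "w k \<bullet> x < w i \<bullet> x" and ki: "k \<noteq> i" using k by (auto simp: less_le)
      let ?y = "x - (w i \<bullet> x - w k \<bullet> x) *\<^sub>R r i"
      have "w i \<bullet> ?y = w k \<bullet> x" "\<And>j. j \<noteq> i \<Longrightarrow> w j \<bullet> ?y = w j \<bullet> x"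
        by (auto simp: inner_diff_right dual)
      then have ky: "w k \<bullet> ?y = w k \<bullet> x" "\<And>j. w k \<bullet> x \<le> w j \<bullet> ?y"
        using k ki by (metis order_refl)+
      have "w k \<bullet> x \<le> 0" using lt \<tau>(2)[OF x] by linarith
      then have y: "?y \<in> \<tau> k" using inK[of k ?y] ky Ksub by auto
      have ri: "(w i \<bullet> x - w k \<bullet> x) *\<^sub>R r i \<in> \<tau> k"
        using lt \<tau>(3)[OF ki] by (intro convex_cone_scaleR[OF cc]) auto
      have "x \<in> \<tau> k" using convex_cone_add[OF cc y ri] by simp
      have "cone_face (\<tau> k \<inter> \<tau> i) (\<tau> k)" using Int_face \<tau>(1) maximalD by blast
      then have "(w i \<bullet> x - w k \<bullet> x) *\<^sub>R r i \<in> \<tau> k \<inter> \<tau> i"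
        using y ri x \<open>x \<in> \<tau> k\<close> unfolding cone_face_iff[OF cc] by (metis IntI diff_add_cancel)
      then have "w i \<bullet> ((w i \<bullet> x - w k \<bullet> x) *\<^sub>R r i) \<le> 0" using \<tau>(2) by blast
      then show ?thesis using lt by (simp add: dual)
    qed
  qed
  have cover: "x \<in> \<sigma> \<or> (\<exists>i. x \<in> \<tau> i)" for x
  proof (cases "\<forall>i. 0 \<le> w i \<bullet> x")
    case True
    have "(\<Sum>i\<in>J. (w i \<bullet> x) *\<^sub>R r i) \<in> \<sigma>" for J
      using finite[of J] True \<sigma>(2)
      by (induction J rule: finite_induct)
         (auto intro!: convex_cone_hull_add convex_cone_hull_mul intro: hull_inc simp: convex_cone_hull_contains_0)
    then show ?thesis using expand[of x] by metis
  next
    case False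
    obtain k where k: "\<forall>j. w k \<bullet> x \<le> w j \<bullet> x" using min by blast
    then have "w k \<bullet> x \<le> 0" using False by (meson le_less_trans not_le less_imp_le)
    then show ?thesis using inK[of k x] k \<tau>K by auto
  qed
  have all: "\<kappa> = \<sigma> \<or> (\<exists>i. \<kappa> = \<tau> i)" if \<kappa>: "\<kappa> \<in> maximal_cones \<Sigma>" for \<kappa>
  proof -
    note \<kappa>' = maximalD[OF \<kappa>]
    have "convex \<kappa>" "\<kappa> \<noteq> {}" using convex_cone[OF \<kappa>'(1)] by (auto simp: convex_cone_def)
    then obtain x where x: "x \<in> rel_interior \<kappa>" using rel_interior_eq_empty by blast
    then have x\<kappa>: "x \<in> \<kappa>" using rel_interior_subset by blast
    obtain \<eta> where \<eta>: "x \<in> \<eta>" "\<eta> \<in> maximal_cones \<Sigma>" "\<eta> = \<sigma> \<or> (\<exists>i. \<eta> = \<tau> i)"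
      using cover[of x] \<sigma> \<tau>(1) by blast
    have "\<kappa> \<subseteq> \<kappa> \<inter> \<eta>"
      using subset_of_face_of[of "\<kappa> \<inter> \<eta>" \<kappa> \<kappa>] Int_face[OF \<kappa>'(1) maximalD(1)[OF \<eta>(2)]] x x\<kappa> \<eta>(1)
      unfolding cone_face_def by blast
    then have "\<kappa> = \<eta>" using \<kappa> maximalD(1)[OF \<eta>(2)] unfolding maximal_cones_def by blast
    then show ?thesis using \<eta> by blast
  qed
  have indK: "independent (?K i)" for i
  proof -
    have "span (?K i) = UNIV"
    proof -
      have rj: "r j \<in> span (?K i)" if "j \<noteq> i" for j
        using that inj by (intro span_base) (auto simp: inj_eq)
      have "?v \<in> span (?K i)" using vr by (intro span_base) (auto dest: sym)
      moreover have "(\<Sum>j\<in>UNIV - {i}. r j) \<in> span (?K i)" using rj by (intro span_sum) auto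
      moreover have "r i = - ?v - (\<Sum>j\<in>UNIV - {i}. r j)" by (simp add: sum.remove[of UNIV i])
      ultimately have "r i \<in> span (?K i)" by (metis span_diff span_neg)
      then have "range r \<subseteq> span (?K i)" using rj by (metis image_subsetI)
      then have "span (range r) \<subseteq> span (?K i)" by (simp add: span_minimal)
      moreover have "x \<in> span (range r)" for x
        by (subst expand[of x]) (intro span_sum span_scale span_base rangeI)
      ultimately show ?thesis by blast
    qed
    moreover have "card (?K i) = CARD('n)"
    proof -
      have "card ?R = Suc (CARD('n))" using vr inj by (subst card_insert_disjoint) (auto simp: card_image)
      then show ?thesis by (subst card_Diff_singleton) auto
    qed
    ultimately show ?thesis
      using card_le_dim_spanning[of "?K i" UNIV] by (auto simp: dim_UNIV)
  qed
  have "\<Sigma> = {convex_cone hull S | S. S \<subset> ?R}"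
  proof (intro subset_antisym subsetI)
    fix \<gamma> assume \<gamma>: "\<gamma> \<in> \<Sigma>"
    obtain \<kappa> where \<kappa>: "\<kappa> \<in> maximal_cones \<Sigma>" "\<gamma> \<subseteq> \<kappa>" using subset_maximal[OF \<gamma>] .
    have "\<exists>K. finite K \<and> K \<subset> ?R \<and> \<kappa> = convex_cone hull K"
    proof (cases "\<kappa> = \<sigma>")
      case True
      then show ?thesis using \<sigma>(2) vr by (intro exI[of _ "range r"]) auto
    next
      case False
      then obtain i where "\<kappa> = \<tau> i" using all[OF \<kappa>(1)] by blast
      then show ?thesis using \<tau>K[of i] by (intro exI[of _ "?K i"]) auto
    qed
    then obtain K where K: "finite K" "K \<subset> ?R" "\<kappa> = convex_cone hull K" by blast
    have "cone_face \<gamma> \<kappa>" using subset_imp_face \<gamma> \<kappa> maximalD by blast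
    then have "\<gamma> = convex_cone hull (K \<inter> \<gamma>)" using cone_face_generators[OF K(1)] K(3) by blast
    then show "\<gamma> \<in> {convex_cone hull S | S. S \<subset> ?R}" using K(2) by blast
  next
    fix \<gamma> assume "\<gamma> \<in> {convex_cone hull S | S. S \<subset> ?R}"
    then obtain S where S: "S \<subset> ?R" "\<gamma> = convex_cone hull S" by blast
    have "\<exists>K. independent K \<and> S \<subseteq> K \<and> convex_cone hull K \<in> \<Sigma>"
    proof (cases "?v \<in> S")
      case False
      then show ?thesis using S(1) ind \<sigma> maximalD by (intro exI[of _ "range r"]) auto
    next
      case True
      then obtain i where "r i \<notin> S" using S(1) by blast
      then show ?thesis using S(1) indK[of i] \<tau>K[of i] \<tau>(1)[of i] maximalD by (intro exI[of _ "?K i"]) auto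
    qed
    then show "\<gamma> \<in> \<Sigma>" using independent_cone_face face_in_fan S(2) by blast
  qed
  then show ?thesis unfolding projective_space_fan_def using int dual by blast
qed

end

section \<open>Near equality in the basic estimate\<close>

lemma primitive_pos_parallel:
  assumes "primitive g" "primitive h" "h = c *\<^sub>R g" "0 < x \<bullet> g" "0 < x \<bullet> h"
  shows "h = g"
  using primitive_parallel[OF assms(1-3)] assms(3-5) by auto

text \<open>
  Any two of the coefficients have a sum greater than \<open>1\<close>, so a ray generator pairs positively with
  only one of the normals \<open>w i\<close>: the cone is simplicial, with generators \<open>r i\<close>. If
  $m_i = \langle w_i, r_i\rangle$, then $a_i m_i \leq 1$ and $v = -\sum_i (\mu / m_i) r_i$. At most one
  $m_i$ can exceed \<open>1\<close>, and if one does then $\mu = 1$ and $r_i / m_i$ is a lattice vector,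
  against primitivity. So all $m_i$ are \<open>1\<close>, and $\mu = 1$ since $v$ is primitive.
\<close>

lemma near_equality_smooth:
  fixes w :: "'n::finite \<Rightarrow> real^'n" and R :: "(real^'n) set" and a :: "'n \<Rightarrow> real"
  assumes w: "inj w" "independent (range w)" "\<And>i. w i \<in> int_lattice"
    and R: "\<And>r. r \<in> R \<Longrightarrow> primitive r" "\<And>i r. r \<in> R \<Longrightarrow> 0 \<le> w i \<bullet> r" "\<And>i. \<exists>r\<in>R. 1 \<le> w i \<bullet> r"
    and a: "\<And>r. r \<in> R \<Longrightarrow> (\<Sum>i\<in>UNIV. a i * (w i \<bullet> r)) \<le> 1" "\<And>i. 0 \<le> a i" "\<And>i. a i \<le> 1"
    and v: "primitive v" "\<And>i. w i \<bullet> v = - \<mu>" and \<mu>: "1 \<le> \<mu>"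
    and near: "(\<Sum>i\<in>UNIV. \<mu> * (1 - a i)) < 1"
  obtains r where "range r = R" "\<And>i j. w i \<bullet> r j = (if i = j then 1 else 0)" "v = - (\<Sum>i\<in>UNIV. r i)"
proof -
  have card: "card (range w) = CARD('n)" using w(1) by (simp add: card_image)
  have spanw: "span (range w) = UNIV"
    using w(2) card card_ge_dim_independent[of "range w" UNIV] by (auto simp: dim_UNIV)
  have zero: "x = 0" if "\<And>i. w i \<bullet> x = 0" for x
  proof -
    have "x \<in> span (range w)" using spanw by simp
    then have "orthogonal x x" using that by (intro orthogonal_to_span[of x "range w" x]) (auto simp: orthogonal_def inner_commute)
    then show ?thesis by (simp add: orthogonal_def)
  qed
  have near1: "\<mu> * (1 - a i) < 1" for i
  proof -
    have "\<mu> * (1 - a i) \<le> (\<Sum>i\<in>UNIV. \<mu> * (1 - a i))"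
      using a(3) \<mu> by (intro member_le_sum) auto
    then show ?thesis using near by linarith
  qed
  have apos: "0 < a i" for i
    using near1[of i] \<mu> a(2)[of i] by (cases "a i = 0") auto
  have two: "1 < a i + a j" if "i \<noteq> j" for i j
  proof -
    have "(\<Sum>k\<in>{i,j}. \<mu> * (1 - a k)) \<le> (\<Sum>k\<in>UNIV. \<mu> * (1 - a k))"
      using a(3) \<mu> by (intro sum_mono2) auto
    then have "\<mu> * ((1 - a i) + (1 - a j)) < 1" using near that by (simp add: algebra_simps)
    moreover have "(1 - a i) + (1 - a j) \<le> \<mu> * ((1 - a i) + (1 - a j))"
      using mult_right_mono[OF \<mu>, of "(1 - a i) + (1 - a j)"] a(3)[of i] a(3)[of j] by simp
    ultimately show ?thesis by linarith
  qed
  have wint: "w i \<bullet> r \<in> \<int>" if "r \<in> R" for i r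
    using R(1)[OF that] w(3) by (auto simp: primitive_def intro: int_lattice_inner)
  have uniq: "w j \<bullet> r = 0" if r: "r \<in> R" "1 \<le> w i \<bullet> r" "i \<noteq> j" for i j r
  proof (rule ccontr)
    assume "w j \<bullet> r \<noteq> 0"
    then have "0 < w j \<bullet> r" using R(2)[OF r(1), of j] by linarith
    then have j: "1 \<le> w j \<bullet> r" using Int_less_imp_le_minus_1[of 0 "w j \<bullet> r"] wint[OF r(1)] by simp
    have "(\<Sum>k\<in>{i,j}. a k * (w k \<bullet> r)) \<le> (\<Sum>k\<in>UNIV. a k * (w k \<bullet> r))"
      using a(2) R(2)[OF r(1)] by (intro sum_mono2) auto
    then have "a i * (w i \<bullet> r) + a j * (w j \<bullet> r) \<le> 1" using a(1)[OF r(1)] r(3) by simp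
    moreover have "a i * 1 \<le> a i * (w i \<bullet> r)" "a j * 1 \<le> a j * (w j \<bullet> r)"
      using mult_left_mono[OF r(2) a(2)] mult_left_mono[OF j a(2)] by blast+
    ultimately show False using two[OF r(3)] by linarith
  qed
  obtain r where r: "\<And>i. r i \<in> R" "\<And>i. 1 \<le> w i \<bullet> r i" using R(3) by metis
  have off: "w j \<bullet> r i = 0" if "i \<noteq> j" for i j using uniq[OF r(1,2) that] .
  have eqr: "x = r i" if x: "x \<in> R" "1 \<le> w i \<bullet> x" for x i
  proof -
    have "x - ((w i \<bullet> x) / (w i \<bullet> r i)) *\<^sub>R r i = 0"
    proof (rule zero)
      fix j show "w j \<bullet> (x - ((w i \<bullet> x) / (w i \<bullet> r i)) *\<^sub>R r i) = 0"
        using r(2)[of i] off[of i j] uniq[OF x, of j] by (cases "i = j") (auto simp: inner_diff_right)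
    qed
    then have "x = ((w i \<bullet> x) / (w i \<bullet> r i)) *\<^sub>R r i" by simp
    then show ?thesis
      using primitive_pos_parallel[OF R(1)[OF r(1)] R(1)[OF x(1)], of _ i "w i"] r(2)[of i] x(2)
      by (metis less_le_trans zero_less_one)
  qed
  have rng: "range r = R"
  proof
    show "R \<subseteq> range r"
    proof
      fix x assume x: "x \<in> R"
      then have "x \<noteq> 0" using R(1) by (auto simp: primitive_def)
      then obtain i where "w i \<bullet> x \<noteq> 0" using zero by blast
      then have "0 < w i \<bullet> x" using R(2)[OF x, of i] by linarith
      then have "1 \<le> w i \<bullet> x" using Int_less_imp_le_minus_1[of 0 "w i \<bullet> x"] wint[OF x] by simp
      then show "x \<in> range r" using eqr[OF x] by blast
    qed
  qed (use r in auto)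
  define m where "m i = w i \<bullet> r i" for i
  have m: "1 \<le> m i" "m i \<in> \<int>" for i using r wint by (auto simp: m_def)
  have am: "a i * m i \<le> 1" for i
  proof -
    have "(\<Sum>k\<in>{i}. a k * (w k \<bullet> r i)) \<le> (\<Sum>k\<in>UNIV. a k * (w k \<bullet> r i))"
      using a(2) R(2)[OF r(1)] by (intro sum_mono2) auto
    then show ?thesis using a(1)[OF r(1), of i] by (simp add: m_def)
  qed
  have vexp: "v = - (\<Sum>i\<in>UNIV. (\<mu> / m i) *\<^sub>R r i)"
  proof -
    have "v + (\<Sum>i\<in>UNIV. (\<mu> / m i) *\<^sub>R r i) = 0"
    proof (rule zero)
      fix j
      have "w j \<bullet> (\<Sum>i\<in>UNIV. (\<mu> / m i) *\<^sub>R r i) = (\<Sum>i\<in>UNIV. if i = j then \<mu> else 0)"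
        unfolding inner_sum_right
      proof (intro sum.cong refl)
        fix i show "w j \<bullet> (\<mu> / m i) *\<^sub>R r i = (if i = j then \<mu> else 0)"
          using off[of i j] m(1)[of i] by (cases "i = j") (auto simp: m_def)
      qed
      then show "w j \<bullet> (v + (\<Sum>i\<in>UNIV. (\<mu> / m i) *\<^sub>R r i)) = 0" using v(2) by (simp add: inner_add_right)
    qed
    then show ?thesis by (simp add: eq_neg_iff_add_eq_0)
  qed
  have rl: "r i \<in> int_lattice" for i using R(1) r(1) by (auto simp: primitive_def)
  have vl: "v \<in> int_lattice" using v(1) by (auto simp: primitive_def)
  have m1: "m i = 1" for i
  proof (rule ccontr)
    assume "m i \<noteq> 1"
    then have mi: "2 \<le> m i" using m[of i] Int_less_imp_le_minus_1[of 1 "m i"] by auto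
    have half: "a k \<le> 1/2" if "2 \<le> m k" for k
    proof -
      have "a k * 2 \<le> a k * m k" using a(2) that by (intro mult_left_mono) auto
      then show ?thesis using am[of k] by linarith
    qed
    have mk: "m k = 1" if "k \<noteq> i" for k
    proof (rule ccontr)
      assume "m k \<noteq> 1"
      then have "2 \<le> m k" using m[of k] Int_less_imp_le_minus_1[of 1 "m k"] by auto
      then show False using half[of k] half[OF mi] two[OF that] by linarith
    qed
    have "\<mu> * (1/2) \<le> \<mu> * (1 - a i)" using half[OF mi] \<mu> by (intro mult_left_mono) auto
    then have "\<mu> < 2" using near1[of i] by linarith
    have "\<mu> \<in> \<int>" using v(2)[of i] int_lattice_inner[OF w(3) vl, of i] by (metis Ints_minus minus_minus)
    then have "\<mu> = 1" using \<mu> \<open>\<mu> < 2\<close> Int_less_imp_le_minus_1[of \<mu> 2] by auto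
    then have "v = - ((1 / m i) *\<^sub>R r i + (\<Sum>k\<in>UNIV - {i}. r k))"
      using vexp mk by (simp add: sum.remove[of UNIV i])
    then have "(1 / m i) *\<^sub>R r i = - (v + (\<Sum>k\<in>UNIV - {i}. r k))" by simp
    moreover have "- (v + (\<Sum>k\<in>UNIV - {i}. r k)) \<in> int_lattice"
      by (intro int_lattice_uminus int_lattice_add int_lattice_sum vl rl)
    ultimately have "1 / m i \<in> \<int>" using R(1)[OF r(1)[of i]] by (simp add: primitive_def)
    moreover have "0 < 1 / m i" "1 / m i < 1" using mi by auto
    ultimately show False using Int_less_imp_le_minus_1[of "1 / m i" 1] by simp
  qed
  then have "v = (- \<mu>) *\<^sub>R (\<Sum>i\<in>UNIV. r i)" using vexp by (simp add: scaleR_sum_right sum_negf)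
  then have "(1 / \<mu>) *\<^sub>R v = - (\<Sum>i\<in>UNIV. r i)" using \<mu> by simp
  then have "(1 / \<mu>) *\<^sub>R v \<in> int_lattice" by (simp add: int_lattice_uminus int_lattice_sum rl)
  then have "1 / \<mu> \<in> \<int>" using v(1) by (simp add: primitive_def)
  then have "\<mu> = 1" using \<mu> Int_less_imp_le_minus_1[of "1 / \<mu>" 1]
    by (cases "\<mu> = 1") (auto simp: field_simps)
  then have "v = - (\<Sum>i\<in>UNIV. r i)" using \<open>v = (- \<mu>) *\<^sub>R _\<close> by simp
  moreover have "w i \<bullet> r j = (if i = j then 1 else 0)" for i j
    using m1[of i] off[of j i] by (auto simp: m_def)
  ultimately show thesis using that[OF rng] by blast
qed

text \<open>
  The total deficit, compared to \<open>n + 1\<close> terms equal to \<open>\<mu>\<close>, is less than \<open>1\<close>, and it is a sum of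
  nonnegative contributions: one of at least \<open>\<mu>\<close> for every missing term, and one of at least \<open>1\<close>
  for every \<open>p b\<close> that is less than \<open>\<mu>\<close>.
\<close>

lemma near_equality_all_extremal:
  fixes p :: "'b \<Rightarrow> real"
  assumes B: "finite B" "card B \<le> n" and a: "\<And>b. b \<in> B \<Longrightarrow> 0 \<le> a b" "\<And>b. b \<in> B \<Longrightarrow> a b \<le> 1"
    and p: "\<And>b. b \<in> B \<Longrightarrow> p b \<in> \<int>" "\<And>b. b \<in> B \<Longrightarrow> p b \<le> \<mu>" "p0 \<le> \<mu>"
    and \<mu>: "1 \<le> \<mu>" "\<mu> \<in> \<int>" and big: "(real n + 1) * \<mu> - 1 < p0 + (\<Sum>b\<in>B. a b * p b)"
  shows "card B = n" "\<And>b. b \<in> B \<Longrightarrow> p b = \<mu>" "(\<Sum>b\<in>B. \<mu> * (1 - a b)) < 1"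
proof -
  have ap: "a b * p b \<le> \<mu>" if "b \<in> B" for b
  proof (cases "0 \<le> p b")
    case True
    then have "a b * p b \<le> 1 * p b" using a that by (intro mult_right_mono) auto
    then show ?thesis using p(2)[OF that] by simp
  next
    case False
    then have "a b * p b \<le> 0" using a that by (simp add: mult_nonneg_nonpos)
    then show ?thesis using \<mu> by simp
  qed
  have "(\<Sum>b\<in>B. a b * p b) \<le> (\<Sum>b\<in>B. \<mu>)" using ap by (rule sum_mono)
  then have "(\<Sum>b\<in>B. a b * p b) \<le> real (card B) * \<mu>" by simp
  then have "(real n + 1) * \<mu> - 1 < \<mu> + real (card B) * \<mu>" using big p(3) by linarith
  then have "(real n - real (card B)) * \<mu> < 1" by (simp add: algebra_simps)
  show card: "card B = n"
  proof (rule ccontr)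
    assume "card B \<noteq> n"
    then have "1 * 1 \<le> (real n - real (card B)) * \<mu>" using B \<mu> by (intro mult_mono) auto
    then show False using \<open>(real n - real (card B)) * \<mu> < 1\<close> by linarith
  qed
  have def: "(\<Sum>b\<in>B. \<mu> - a b * p b) < 1"
    using big p(3) card by (simp add: sum_subtractf algebra_simps)
  have one: "\<mu> - a b * p b < 1" if "b \<in> B" for b
  proof -
    have "\<mu> - a b * p b \<le> (\<Sum>b\<in>B. \<mu> - a b * p b)" using ap that B by (intro member_le_sum) auto
    then show ?thesis using def by linarith
  qed
  show pb: "p b = \<mu>" if b: "b \<in> B" for b
  proof (rule ccontr)
    assume "p b \<noteq> \<mu>"
    then have le: "p b \<le> \<mu> - 1" using p b \<mu> Int_less_imp_le_minus_1[of "p b" \<mu>] by force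
    have "a b * p b \<le> \<mu> - 1"
    proof (cases "0 \<le> p b")
      case True
      then have "a b * p b \<le> 1 * p b" using a b by (intro mult_right_mono) auto
      then show ?thesis using le by simp
    next
      case False
      then have "a b * p b \<le> 0" using a b by (simp add: mult_nonneg_nonpos)
      then show ?thesis using \<mu> by simp
    qed
    then show False using one[OF b] by linarith
  qed
  have "(\<Sum>b\<in>B. \<mu> * (1 - a b)) = (\<Sum>b\<in>B. \<mu> - a b * p b)"
    using pb by (intro sum.cong) (auto simp: algebra_simps)
  then show "(\<Sum>b\<in>B. \<mu> * (1 - a b)) < 1" using def by simp
qed

section \<open>Wall crossing\<close>

text \<open>
  The map \<open>uD\<close> assigns to every maximal cone the local datum of \<open>D\<close>. The coefficient \<open>c\<close>
  stands for the intersection number of \<open>D\<close> with the invariant curve of the wall.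
\<close>

locale wall_positive_fan = complete_fan \<Sigma> for \<Sigma> :: "(real^'n::finite) set set" +
  fixes D :: "'n T_divisor" and uD :: "(real^'n) set \<Rightarrow> real^'n"
  assumes datum: "\<sigma> \<in> maximal_cones \<Sigma> \<Longrightarrow> local_datum D \<sigma> (uD \<sigma>)"
    and wall: "\<lbrakk>\<sigma> \<in> maximal_cones \<Sigma>; \<tau> \<in> maximal_cones \<Sigma>; \<tau> \<noteq> \<sigma>; g \<in> facet_normals \<sigma>;
      \<sigma> \<inter> \<tau> = \<sigma> \<inter> {x. g \<bullet> x = 0}\<rbrakk> \<Longrightarrow> \<exists>c\<ge>real CARD('n) + 1. uD \<tau> = uD \<sigma> + c *\<^sub>R g"
begin

lemma wall_decrease:
  assumes "\<sigma> \<in> maximal_cones \<Sigma>" "g \<in> facet_normals \<sigma>" "g \<bullet> v \<le> 0"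
  obtains \<tau> where "\<tau> \<in> maximal_cones \<Sigma>" "- g \<in> facet_normals \<tau>" "\<sigma> \<inter> {x. g \<bullet> x = 0} \<subseteq> \<tau>"
    "uD \<tau> \<bullet> v \<le> uD \<sigma> \<bullet> v + (real CARD('n) + 1) * (g \<bullet> v)"
proof -
  obtain \<tau> where \<tau>: "\<tau> \<in> maximal_cones \<Sigma>" "\<tau> \<noteq> \<sigma>" "\<sigma> \<inter> \<tau> = \<sigma> \<inter> {x. g \<bullet> x = 0}" "- g \<in> facet_normals \<tau>"
    using facet_neighbour[OF assms(1,2)] by metis
  obtain c where c: "c \<ge> real CARD('n) + 1" "uD \<tau> = uD \<sigma> + c *\<^sub>R g"
    using wall[OF assms(1) \<tau>(1,2) assms(2) \<tau>(3)] by blast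
  have "c * (g \<bullet> v) \<le> (real CARD('n) + 1) * (g \<bullet> v)"
    using c(1) assms(3) by (rule mult_right_mono_neg)
  then show thesis using that[OF \<tau>(1,4)] \<tau>(3) c(2) by (auto simp: inner_add_left)
qed

text \<open>
  This says that the points \<open>uD \<sigma>\<close> satisfy the inequalities of the polytope of \<open>D\<close>. A cone at which the pairing with the
  ray generator is least must contain it, since otherwise crossing a suitable wall would make the
  pairing smaller.
\<close>

lemma datum_ge:
  assumes "\<rho> \<in> rays \<Sigma>" "\<sigma> \<in> maximal_cones \<Sigma>"
  shows "- D \<rho> \<le> uD \<sigma> \<bullet> prim_gen \<rho>"
proof -
  let ?v = "prim_gen \<rho>"
  have fin: "finite (maximal_cones \<Sigma>)" using finite_fan by (simp add: maximal_cones_eq)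
  obtain \<tau> where \<tau>: "\<tau> \<in> maximal_cones \<Sigma>" "\<And>\<sigma>. \<sigma> \<in> maximal_cones \<Sigma> \<Longrightarrow> uD \<tau> \<bullet> ?v \<le> uD \<sigma> \<bullet> ?v"
    using arg_min_if_finite(1)[OF fin maximal_nonempty, of "\<lambda>\<sigma>. uD \<sigma> \<bullet> ?v"]
      arg_min_least[OF fin maximal_nonempty, of _ "\<lambda>\<sigma>. uD \<sigma> \<bullet> ?v"] by metis
  have "?v \<in> \<tau>"
  proof (rule ccontr)
    assume "?v \<notin> \<tau>"
    then obtain g where g: "g \<in> facet_normals \<tau>" "g \<bullet> ?v \<le> -1"
      using not_mem_maximal[OF \<tau>(1)] ray_gen(1)[OF assms(1)] by (metis primitive_def)
    then obtain \<kappa> where \<kappa>: "\<kappa> \<in> maximal_cones \<Sigma>" "uD \<kappa> \<bullet> ?v \<le> uD \<tau> \<bullet> ?v + (real CARD('n) + 1) * (g \<bullet> ?v)"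
      using wall_decrease[OF \<tau>(1) g(1), of ?v] by (metis order_trans neg_le_0_iff_le zero_le_one)
    have "(real CARD('n) + 1) * (g \<bullet> ?v) < 0" using g(2) by (intro mult_pos_neg) auto
    then show False using \<tau>(2)[OF \<kappa>(1)] \<kappa>(2) by linarith
  qed
  then have "\<rho> \<in> rays_of \<tau>" using ray_mem_cone[OF assms(1) maximalD(1)[OF \<tau>(1)]] by blast
  then have "uD \<tau> \<bullet> ?v = - D \<rho>" using datum[OF \<tau>(1)] by (simp add: local_datum_def)
  then show ?thesis using \<tau>(2)[OF assms(2)] by simp
qed

text \<open>
  The slack of the point \<open>uD \<sigma>\<close> in the inequality of the polytope of \<open>D\<close> given by the ray \<open>\<rho>\<close>.
\<close>

definition excess :: "(real^'n) set \<Rightarrow> (real^'n) set \<Rightarrow> real" where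
  "excess \<sigma> \<rho> = D \<rho> + uD \<sigma> \<bullet> prim_gen \<rho>"

lemma excess_ge:
  assumes "\<rho> \<in> rays \<Sigma>" "\<sigma> \<in> maximal_cones \<Sigma>" "g \<in> facet_normals \<sigma>"
  shows "(real CARD('n) + 1) * (- (g \<bullet> prim_gen \<rho>)) \<le> excess \<sigma> \<rho>"
proof (cases "g \<bullet> prim_gen \<rho> \<le> 0")
  case True
  then show ?thesis
    using wall_decrease[OF assms(2,3) True] datum_ge[OF assms(1)] unfolding excess_def by (smt (verit) mult_minus_right)
next
  case False
  then have "(real CARD('n) + 1) * (- (g \<bullet> prim_gen \<rho>)) \<le> 0" by (intro mult_nonneg_nonpos) auto
  then show ?thesis using datum_ge[OF assms(1,2)] by (simp add: excess_def)
qed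

text \<open>
  If the cone behind the facet does not contain the ray generator, its own excess is at least
  \<open>n + 1\<close>, in addition to the drop at the first wall.
\<close>

lemma excess_ge_two_walls:
  assumes \<rho>: "\<rho> \<in> rays \<Sigma>" and \<sigma>: "\<sigma> \<in> maximal_cones \<Sigma>" "g \<in> facet_normals \<sigma>" "g \<bullet> prim_gen \<rho> \<le> 0"
    and lt: "excess \<sigma> \<rho> < (real CARD('n) + 1) * (- (g \<bullet> prim_gen \<rho>)) + (real CARD('n) + 1)"
  obtains \<tau> where "\<tau> \<in> maximal_cones \<Sigma>" "- g \<in> facet_normals \<tau>" "\<sigma> \<inter> {x. g \<bullet> x = 0} \<subseteq> \<tau>" "prim_gen \<rho> \<in> \<tau>"
proof -
  let ?v = "prim_gen \<rho>"
  obtain \<tau> where \<tau>: "\<tau> \<in> maximal_cones \<Sigma>" "- g \<in> facet_normals \<tau>" "\<sigma> \<inter> {x. g \<bullet> x = 0} \<subseteq> \<tau>"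
    "uD \<tau> \<bullet> ?v \<le> uD \<sigma> \<bullet> ?v + (real CARD('n) + 1) * (g \<bullet> ?v)"
    using wall_decrease[OF \<sigma>] by metis
  have "?v \<in> \<tau>"
  proof (rule ccontr)
    assume "?v \<notin> \<tau>"
    then obtain h where h: "h \<in> facet_normals \<tau>" "h \<bullet> ?v \<le> -1"
      using not_mem_maximal[OF \<tau>(1)] ray_gen(1)[OF \<rho>] by (metis primitive_def)
    have "(real CARD('n) + 1) * 1 \<le> (real CARD('n) + 1) * (- (h \<bullet> ?v))"
      using h(2) by (intro mult_left_mono) auto
    then have "real CARD('n) + 1 \<le> excess \<tau> \<rho>"
      using order_trans[OF _ excess_ge[OF \<rho> \<tau>(1) h(1)]] by simp
    then show False using \<tau>(4) lt by (simp add: excess_def)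
  qed
  then show thesis using that \<tau> by blast
qed

end

section \<open>Generators of the dual semigroup\<close>

locale adjoint_fan = wall_positive_fan \<Sigma> D uD for \<Sigma> :: "(real^'n::finite) set set" and D uD +
  fixes D' :: "'n T_divisor" and uD' :: "(real^'n) set \<Rightarrow> real^'n"
  assumes datum': "\<sigma> \<in> maximal_cones \<Sigma> \<Longrightarrow> local_datum D' \<sigma> (uD' \<sigma>)"
    and D'_le: "\<rho> \<in> rays \<Sigma> \<Longrightarrow> D' \<rho> \<le> 0" and D'_ge: "\<rho> \<in> rays \<Sigma> \<Longrightarrow> - 1 \<le> D' \<rho>"
    and not_projective_space: "\<not> projective_space_fan \<Sigma>"
begin

context
  fixes \<sigma> assumes \<sigma>: "\<sigma> \<in> maximal_cones \<Sigma>"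
begin

lemma cone_facts: "\<sigma> \<in> \<Sigma>" "dim \<sigma> = CARD('n)" "rational_cone \<sigma>" "convex_cone \<sigma>"
  using maximalD[OF \<sigma>] rational convex_cone by auto

definition dual_lattice :: "(real^'n) set" where
  "dual_lattice = dual_cone \<sigma> \<inter> int_lattice"

lemma mem_dual_lattice: "x \<in> dual_lattice \<longleftrightarrow> x \<in> int_lattice \<and> (\<forall>\<rho>\<in>rays_of \<sigma>. 0 \<le> x \<bullet> prim_gen \<rho>)"
  unfolding dual_lattice_def dual_cone_def nonneg_on_cone_iff[OF cone_facts(3), symmetric]
  using int_lattice_rat by auto

text \<open>
  The polytope of \<open>D + D'\<close> is moved to the origin by \<open>uD \<sigma> + uD' \<sigma>\<close>, so \<open>uD' \<sigma>\<close> is the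
  additional shift caused by \<open>D'\<close>. The bounds on the coefficients of \<open>D'\<close> are bounds on its
  pairings.
\<close>

lemma shift_nonneg: "\<rho> \<in> rays_of \<sigma> \<Longrightarrow> 0 \<le> uD' \<sigma> \<bullet> prim_gen \<rho> \<and> uD' \<sigma> \<bullet> prim_gen \<rho> \<le> 1"
  using datum'[OF \<sigma>] D'_le[OF rays_of_rays[OF cone_facts(1)]] D'_ge[OF rays_of_rays[OF cone_facts(1)]]
  unfolding local_datum_def by force

lemma facet_normal_positive_ray:
  assumes "g \<in> facet_normals \<sigma>" shows "\<exists>\<rho>\<in>rays_of \<sigma>. 1 \<le> g \<bullet> prim_gen \<rho>"
proof (rule ccontr)
  assume n: "\<not> ?thesis"
  have g: "g \<in> int_lattice" "g \<noteq> 0" "\<forall>x\<in>\<sigma>. 0 \<le> g \<bullet> x" using assms by (auto simp: facet_normals_def primitive_def)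
  have "g \<bullet> prim_gen \<rho> = 0" if \<rho>: "\<rho> \<in> rays_of \<sigma>" for \<rho>
  proof -
    note r = rays_of_generator[OF cone_facts(3) \<rho>]
    have "g \<bullet> prim_gen \<rho> \<in> \<int>" using r(1) g(1) by (auto simp: primitive_def intro: int_lattice_inner)
    then show ?thesis using Int_less_imp_le_minus_1[of 0 "g \<bullet> prim_gen \<rho>"] g(3) r(2) n \<rho> by force
  qed
  then show False using full_cone_eq_zero[OF cone_facts(3,2)] g(2) by blast
qed

text \<open>
  The facet normals generate the dual cone by Farkas' lemma, and Caratheodory's theorem selects
  independent ones.
\<close>

lemma dual_combination:
  assumes "\<And>\<rho>. \<rho> \<in> rays_of \<sigma> \<Longrightarrow> 0 \<le> x \<bullet> prim_gen \<rho>"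
  obtains B a where "B \<subseteq> facet_normals \<sigma>" "independent B" "finite B" "card B \<le> CARD('n)"
    "\<forall>b\<in>B. 0 \<le> a b" "x = (\<Sum>b\<in>B. a b *\<^sub>R b)"
proof -
  have "x \<in> convex_cone hull (facet_normals \<sigma>)"
  proof (rule dual_in_convex_cone_hull[OF finite_facet_normals[OF cone_facts(3,2)]])
    fix y assume "\<And>g. g \<in> facet_normals \<sigma> \<Longrightarrow> 0 \<le> g \<bullet> y"
    then have "y \<in> \<sigma>" using facet_normals_halfspaces[OF cone_facts(3,2)] by blast
    then show "0 \<le> x \<bullet> y" using assms nonneg_on_cone_iff[OF cone_facts(3), of x] by blast
  qed
  then obtain B a where B: "B \<subseteq> facet_normals \<sigma>" "independent B" "\<forall>b\<in>B. 0 \<le> a b" "x = (\<Sum>b\<in>B. a b *\<^sub>R b)"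
    by (rule conical_caratheodory[OF finite_facet_normals[OF cone_facts(3,2)]])
  have "finite B" "card B \<le> CARD('n)" using independent_bound[OF B(2)] by auto
  then show thesis using that B by blast
qed

definition slope :: "(real^'n) set \<Rightarrow> real" where
  "slope \<rho> = Max ((\<lambda>g. - (g \<bullet> prim_gen \<rho>)) ` facet_normals \<sigma>)"

lemma slope:
  assumes \<rho>: "\<rho> \<in> rays \<Sigma>" "prim_gen \<rho> \<notin> \<sigma>"
  shows "\<And>g. g \<in> facet_normals \<sigma> \<Longrightarrow> - (g \<bullet> prim_gen \<rho>) \<le> slope \<rho>"
    and "1 \<le> slope \<rho>" "slope \<rho> \<in> \<int>" "(real CARD('n) + 1) * slope \<rho> \<le> excess \<sigma> \<rho>"
proof -
  let ?S = "(\<lambda>g. - (g \<bullet> prim_gen \<rho>)) ` facet_normals \<sigma>"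
  have v: "prim_gen \<rho> \<in> int_lattice" using ray_gen(1)[OF \<rho>(1)] by (simp add: primitive_def)
  have fin: "finite ?S" using finite_facet_normals[OF cone_facts(3,2)] by simp
  then show le: "\<And>g. g \<in> facet_normals \<sigma> \<Longrightarrow> - (g \<bullet> prim_gen \<rho>) \<le> slope \<rho>"
    unfolding slope_def by (intro Max_ge) auto
  obtain g where g: "g \<in> facet_normals \<sigma>" "g \<bullet> prim_gen \<rho> \<le> -1" using not_mem_maximal[OF \<sigma> \<rho>(2) v] .
  then show "1 \<le> slope \<rho>" using le[OF g(1)] by linarith
  have "slope \<rho> \<in> ?S" unfolding slope_def using fin g(1) by (intro Max_in) auto
  then obtain h where h: "h \<in> facet_normals \<sigma>" "slope \<rho> = - (h \<bullet> prim_gen \<rho>)" by blast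
  then show "slope \<rho> \<in> \<int>" using v by (auto simp: facet_normals_def primitive_def intro: int_lattice_inner)
  show "(real CARD('n) + 1) * slope \<rho> \<le> excess \<sigma> \<rho>" using excess_ge[OF \<rho>(1) \<sigma> h(1)] h(2) by simp
qed

lemma combination_bound:
  assumes "\<rho> \<in> rays \<Sigma>" "prim_gen \<rho> \<notin> \<sigma>" "B \<subseteq> facet_normals \<sigma>" "finite B" "card B \<le> CARD('n)"
    "\<And>b. b \<in> B \<Longrightarrow> 0 \<le> a b" "\<And>b. b \<in> B \<Longrightarrow> a b \<le> 1"
  shows "1 \<le> (\<Sum>b\<in>B. a b *\<^sub>R b) \<bullet> prim_gen \<rho> + excess \<sigma> \<rho>"
proof -
  note s = slope[OF assms(1,2)]
  have "a b * (- (b \<bullet> prim_gen \<rho>)) \<le> slope \<rho>" if b: "b \<in> B" for b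
  proof -
    have "a b * (- (b \<bullet> prim_gen \<rho>)) \<le> a b * slope \<rho>" using s(1) assms(3,6) b by (intro mult_left_mono) auto
    also have "\<dots> \<le> 1 * slope \<rho>" using assms(7)[OF b] s(2) by (intro mult_right_mono) auto
    finally show ?thesis by simp
  qed
  then have "(\<Sum>b\<in>B. a b * (- (b \<bullet> prim_gen \<rho>))) \<le> (\<Sum>b\<in>B. slope \<rho>)" by (rule sum_mono)
  also have "\<dots> = real (card B) * slope \<rho>" by simp
  also have "\<dots> \<le> real CARD('n) * slope \<rho>" using s(2) assms(5) by (intro mult_right_mono) auto
  finally have "- ((\<Sum>b\<in>B. a b *\<^sub>R b) \<bullet> prim_gen \<rho>) \<le> real CARD('n) * slope \<rho>"
    by (simp add: inner_sum_left sum_negf)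
  then show ?thesis using s(2,4) by (simp add: algebra_simps)
qed

text \<open>
  A coefficient \<open>a b > 1\<close> would make \<open>x - b\<close> an element of the dual semigroup: where \<open>b\<close> is positive,
  its pairings exceed \<open>-1\<close> and are integers, and where \<open>b\<close> vanishes they are those of \<open>x\<close>. So all
  coefficients are at most \<open>1\<close> and the bound for \<open>n\<close> terms applies.
\<close>

lemma indecomposable_in_polytope:
  assumes x: "x \<in> dual_lattice" "x \<notin> facet_normals \<sigma>" "x \<noteq> 0"
    and ind: "\<And>y z. y \<in> dual_lattice \<Longrightarrow> z \<in> dual_lattice \<Longrightarrow> x = y + z \<Longrightarrow> y = 0 \<or> z = 0"
    and \<rho>: "\<rho> \<in> rays \<Sigma>" "prim_gen \<rho> \<notin> \<sigma>"
  shows "1 \<le> (x + uD' \<sigma>) \<bullet> prim_gen \<rho> + excess \<sigma> \<rho>"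
proof -
  have nn: "0 \<le> (x + uD' \<sigma>) \<bullet> prim_gen \<rho>" if "\<rho> \<in> rays_of \<sigma>" for \<rho>
    using shift_nonneg[OF that] x(1) that by (auto simp: mem_dual_lattice inner_add_left)
  obtain B a where B0: "B \<subseteq> facet_normals \<sigma>" "independent B" "finite B" "card B \<le> CARD('n)"
    "\<forall>b\<in>B. 0 \<le> a b" "x + uD' \<sigma> = (\<Sum>b\<in>B. a b *\<^sub>R b)"
    by (rule dual_combination[OF nn])
  note B = B0(1-4) bspec[OF B0(5)] B0(6)
  have bl: "b \<in> dual_lattice" "b \<noteq> 0" if "b \<in> B" for b
    using that B(1) nonneg_on_cone_iff[OF cone_facts(3), of b] by (auto simp: facet_normals_def primitive_def mem_dual_lattice)
  have "a b \<le> 1" if b: "b \<in> B" for b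
  proof (rule ccontr)
    assume ab: "\<not> a b \<le> 1"
    have "0 \<le> (x - b) \<bullet> prim_gen \<rho>" if \<rho>: "\<rho> \<in> rays_of \<sigma>" for \<rho>
    proof -
      let ?v = "prim_gen \<rho>"
      have v: "?v \<in> int_lattice" using rays_of_generator[OF cone_facts(3) \<rho>] by (simp add: primitive_def)
      have i: "(x - b) \<bullet> ?v \<in> \<int>" "b \<bullet> ?v \<in> \<int>"
        using x(1) bl(1)[OF b] v by (auto simp: mem_dual_lattice intro!: int_lattice_inner int_lattice_diff)
      have b0: "0 \<le> c \<bullet> ?v" if "c \<in> B" for c using bl(1)[OF that] \<rho> by (simp add: mem_dual_lattice)
      show ?thesis
      proof (cases "b \<bullet> ?v = 0")
        case True
        then show ?thesis using x(1) \<rho> by (simp add: mem_dual_lattice inner_diff_left)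
      next
        case False
        then have "0 < b \<bullet> ?v" using b0[OF b] by linarith
        then have "b \<bullet> ?v < a b * (b \<bullet> ?v)" using ab by simp
        also have "\<dots> \<le> (\<Sum>c\<in>B. a c * (c \<bullet> ?v))"
          using B(3,5) b0 b by (intro member_le_sum) auto
        also have "\<dots> = (x + uD' \<sigma>) \<bullet> ?v" by (simp add: B(6) inner_sum_left)
        finally have "-1 < (x - b) \<bullet> ?v"
          using shift_nonneg[OF \<rho>] by (simp add: inner_add_left inner_diff_left)
        then show ?thesis using Int_less_imp_le_minus_1[of "-1" "(x - b) \<bullet> ?v"] i by simp
      qed
    qed
    then have "x - b \<in> dual_lattice"
      using x(1) bl(1)[OF b] int_lattice_diff by (auto simp: mem_dual_lattice)
    then have "x - b = 0" using ind[OF bl(1)[OF b], of "x - b"] bl(2)[OF b] by simp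
    then show False using x(2) b B(1) by auto
  qed
  then show ?thesis using combination_bound[OF \<rho> B(1,3,4), of a] B(5,6) by simp
qed

text \<open>
  The vector \<open>x + uD' \<sigma>\<close> is a combination of \<open>n + 1\<close> normals with coefficients at most \<open>1\<close>. A failure
  of the inequality is the situation of near equality. It makes \<open>\<sigma>\<close> a smooth cone all of whose
  neighbours contain the ray generator, so that the fan is the one of projective space.
\<close>

lemma facet_normal_in_polytope:
  assumes x: "x \<in> facet_normals \<sigma>" and \<rho>: "\<rho> \<in> rays \<Sigma>" "prim_gen \<rho> \<notin> \<sigma>"
  shows "1 \<le> (x + uD' \<sigma>) \<bullet> prim_gen \<rho> + excess \<sigma> \<rho>"
proof (rule ccontr)
  assume neg: "\<not> ?thesis"
  let ?v = "prim_gen \<rho>" and ?\<mu> = "slope \<rho>"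
  note s = slope[OF \<rho>]
  have v: "primitive ?v" "?v \<in> int_lattice" using ray_gen(1)[OF \<rho>(1)] by (auto simp: primitive_def)
  obtain B a where B0: "B \<subseteq> facet_normals \<sigma>" "independent B" "finite B" "card B \<le> CARD('n)"
    "\<forall>b\<in>B. 0 \<le> a b" "uD' \<sigma> = (\<Sum>b\<in>B. a b *\<^sub>R b)"
    by (rule dual_combination[OF shift_nonneg[THEN conjunct1]])
  note B = B0(1-4) bspec[OF B0(5)] B0(6)
  have bl: "b \<in> int_lattice" "\<And>\<rho>. \<rho> \<in> rays_of \<sigma> \<Longrightarrow> 0 \<le> b \<bullet> prim_gen \<rho>" if "b \<in> B" for b
    using that B(1) nonneg_on_cone_iff[OF cone_facts(3), of b] by (auto simp: facet_normals_def primitive_def)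
  have le1: "(\<Sum>b\<in>B. a b * (b \<bullet> prim_gen \<eta>)) \<le> 1" if "\<eta> \<in> rays_of \<sigma>" for \<eta>
    using shift_nonneg[OF that] by (simp add: B(6) inner_sum_left)
  have a1: "a b \<le> 1" if b: "b \<in> B" for b
  proof -
    obtain \<eta> where \<eta>: "\<eta> \<in> rays_of \<sigma>" "1 \<le> b \<bullet> prim_gen \<eta>" using facet_normal_positive_ray b B(1) by blast
    have "a b * 1 \<le> a b * (b \<bullet> prim_gen \<eta>)" using \<eta>(2) B(5)[OF b] by (rule mult_left_mono)
    also have "\<dots> \<le> (\<Sum>c\<in>B. a c * (c \<bullet> prim_gen \<eta>))"
      using B(3,5) bl(2) \<eta>(1) b by (intro member_le_sum) auto
    finally show ?thesis using le1[OF \<eta>(1)] by simp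
  qed
  have big: "(real CARD('n) + 1) * ?\<mu> - 1 < - (x \<bullet> ?v) + (\<Sum>b\<in>B. a b * (- (b \<bullet> ?v)))"
    using neg s(4) by (simp add: inner_add_left B(6) inner_sum_left sum_negf)
  have pint: "- (b \<bullet> ?v) \<in> \<int>" if "b \<in> B" for b using bl(1)[OF that] v(2) int_lattice_inner by auto
  have ple: "- (b \<bullet> ?v) \<le> ?\<mu>" if "b \<in> B" for b using s(1) B(1) that by blast
  have ext: "card B = CARD('n)" "\<And>b. b \<in> B \<Longrightarrow> - (b \<bullet> ?v) = ?\<mu>" "(\<Sum>b\<in>B. ?\<mu> * (1 - a b)) < 1"
    using near_equality_all_extremal[of B _ a "\<lambda>b. - (b \<bullet> ?v)", OF B(3,4) _ _ _ _ s(1)[OF x] s(2,3) big]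
      B(5) a1 pint ple by blast+
  obtain w :: "'n \<Rightarrow> real^'n" where w: "bij_betw w UNIV B"
    using ext(1) B(3) by (metis finite_same_card_bij finite)
  then have winj: "inj w" and wB: "range w = B" by (auto simp: bij_betw_def)
  have wBi: "w i \<in> B" for i using wB by blast
  have sumw: "(\<Sum>b\<in>B. f b) = (\<Sum>i\<in>UNIV. f (w i))" for f :: "_ \<Rightarrow> real"
    using sum.reindex_bij_betw[OF w, of f] by simp
  obtain r where r: "range r = prim_gen ` rays_of \<sigma>" "\<And>i j. w i \<bullet> r j = (if i = j then 1 else 0)"
      "?v = - (\<Sum>i\<in>UNIV. r i)"
  proof (rule near_equality_smooth[of w "prim_gen ` rays_of \<sigma>" "\<lambda>i. a (w i)" ?v ?\<mu>])
    show "\<And>i. \<exists>r\<in>prim_gen ` rays_of \<sigma>. 1 \<le> w i \<bullet> r" using facet_normal_positive_ray B(1) wBi by blast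
    show "\<And>r. r \<in> prim_gen ` rays_of \<sigma> \<Longrightarrow> (\<Sum>i\<in>UNIV. a (w i) * (w i \<bullet> r)) \<le> 1"
      using le1 by (auto simp: sumw)
    show "\<And>i. w i \<bullet> ?v = - ?\<mu>" using ext(2)[OF wBi] by (metis minus_minus)
    show "(\<Sum>i\<in>UNIV. ?\<mu> * (1 - a (w i))) < 1" using ext(3) by (simp add: sumw)
  qed (use winj wB B wBi bl a1 s v rays_of_generator[OF cone_facts(3)] in auto)
  have \<sigma>r: "\<sigma> = convex_cone hull (range r)" using rational_cone_rays[OF cone_facts(3)] r(1) by simp
  have rint: "r i \<in> int_lattice" for i
    using r(1) rays_of_generator(1)[OF cone_facts(3)] by (metis imageE primitive_def rangeI)
  have r\<sigma>: "r i \<in> \<sigma>" for i using \<sigma>r by (simp add: hull_inc)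
  have wv: "w i \<bullet> ?v = - ?\<mu>" for i using ext(2)[OF wBi] by (metis minus_minus)
  have "\<exists>\<tau>. \<tau> \<in> maximal_cones \<Sigma> \<and> - w i \<in> facet_normals \<tau> \<and> \<sigma> \<inter> {x. w i \<bullet> x = 0} \<subseteq> \<tau> \<and> ?v \<in> \<tau>" for i
  proof -
    have wi: "w i \<in> facet_normals \<sigma>" using wBi B(1) by blast
    have "w i \<bullet> ?v \<le> 0" using wv[of i] s(2) by simp
    moreover have "(\<Sum>b\<in>B. a b * (- (b \<bullet> ?v))) \<le> (\<Sum>b\<in>B. 1 * ?\<mu>)"
      using ext(2) a1 s(2) by (intro sum_mono) (simp add: mult_right_mono)
    then have "- ((x + uD' \<sigma>) \<bullet> ?v) \<le> (real CARD('n) + 1) * ?\<mu>"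
      using s(1)[OF x] ext(1) by (simp add: inner_add_left B(6) inner_sum_left sum_negf algebra_simps)
    then have "excess \<sigma> \<rho> < (real CARD('n) + 1) * (- (w i \<bullet> ?v)) + (real CARD('n) + 1)"
      using neg wv[of i] zero_less_card_finite[where 'a='n] by (simp add: algebra_simps)
    ultimately show ?thesis using excess_ge_two_walls[OF \<rho>(1) \<sigma> wi] by metis
  qed
  then obtain \<tau> where \<tau>: "\<And>i. \<tau> i \<in> maximal_cones \<Sigma>" "\<And>i. - w i \<in> facet_normals (\<tau> i)"
    "\<And>i. \<sigma> \<inter> {x. w i \<bullet> x = 0} \<subseteq> \<tau> i" "\<And>i. ?v \<in> \<tau> i" by metis
  have "projective_space_fan \<Sigma>"
  proof (rule projective_space_fanI[of r w \<sigma> \<tau>])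
    show "\<And>i x. x \<in> \<tau> i \<Longrightarrow> w i \<bullet> x \<le> 0" using \<tau>(2) by (auto simp: facet_normals_def)
    show "r j \<in> \<tau> i" if "i \<noteq> j" for i j
      using \<tau>(3)[of i] r\<sigma>[of j] r(2)[of i j] that by auto
    show "\<And>i. - (\<Sum>i\<in>UNIV. r i) \<in> \<tau> i" using \<tau>(4) r(3) by simp
    show "w i \<in> int_lattice" for i using bl(1)[OF wBi] .
  qed (rule rint r(2) \<sigma> \<sigma>r \<tau>(1))+
  then show False using not_projective_space by blast
qed

text \<open>
  Induction on the sum of the pairings with all ray generators, which is a positive integer for every
  nonzero element: an element outside \<open>G\<close> decomposes into two such elements.
\<close>

lemma dual_lattice_generated:
  assumes "x \<in> dual_lattice"
    and good: "\<And>y. y \<in> dual_lattice \<Longrightarrow>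
      (\<And>\<rho>. \<rho> \<in> rays \<Sigma> \<Longrightarrow> prim_gen \<rho> \<notin> \<sigma> \<Longrightarrow> 1 \<le> (y + uD' \<sigma>) \<bullet> prim_gen \<rho> + excess \<sigma> \<rho>) \<Longrightarrow> y \<in> G"
  shows "\<exists>F c. finite F \<and> F \<subseteq> G \<and> x = (\<Sum>s\<in>F. real (c s :: nat) *\<^sub>R s)"
proof -
  define h where "h y = (\<Sum>\<rho>\<in>rays_of \<sigma>. y \<bullet> prim_gen \<rho>)" for y
  have fin: "finite (rays_of \<sigma>)" by (rule finite_rays_of[OF cone_facts(3)])
  have hint: "h y \<in> \<int>" "0 \<le> h y" if "y \<in> dual_lattice" for y
  proof -
    show "h y \<in> \<int>" unfolding h_def using that rays_of_generator(1)[OF cone_facts(3)]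
      by (intro Ints_sum int_lattice_inner) (auto simp: mem_dual_lattice primitive_def)
    show "0 \<le> h y" unfolding h_def using that by (intro sum_nonneg) (auto simp: mem_dual_lattice)
  qed
  have h0: "y = 0" if "y \<in> dual_lattice" "h y = 0" for y
  proof (rule full_cone_eq_zero[OF cone_facts(3,2)])
    fix \<rho> assume "\<rho> \<in> rays_of \<sigma>"
    then show "y \<bullet> prim_gen \<rho> = 0" using that fin unfolding h_def
      by (subst (asm) sum_nonneg_eq_0_iff) (auto simp: mem_dual_lattice)
  qed
  have "\<forall>x. x \<in> dual_lattice \<longrightarrow> h x < real n \<longrightarrow> (\<exists>F c. finite F \<and> F \<subseteq> G \<and> x = (\<Sum>s\<in>F. real (c s :: nat) *\<^sub>R s))" for n :: nat
  proof (induction n)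
    case 0
    then show ?case using hint by (force simp: not_less)
  next
    case (Suc n)
    show ?case
    proof (intro allI impI)
      fix x assume x: "x \<in> dual_lattice" "h x < real (Suc n)"
      show "\<exists>F c. finite F \<and> F \<subseteq> G \<and> x = (\<Sum>s\<in>F. real (c s :: nat) *\<^sub>R s)"
      proof (cases "x = 0 \<or> x \<in> G")
        case True
        then show ?thesis
        proof
          assume "x = 0" then show ?thesis by (intro exI[of _ "{}"]) auto
        next
          assume "x \<in> G" then show ?thesis by (intro exI[of _ "{x}"] exI[of _ "\<lambda>_. 1"]) auto
        qed
      next
        case False
        then have "x \<notin> facet_normals \<sigma>" using good[OF x(1)] facet_normal_in_polytope by blast
        then obtain y z where yz: "y \<in> dual_lattice" "z \<in> dual_lattice" "x = y + z" "y \<noteq> 0" "z \<noteq> 0"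
          using good[OF x(1)] indecomposable_in_polytope[OF x(1)] False by blast
        have "1 \<le> h t" if "t \<in> dual_lattice" "t \<noteq> 0" for t
        proof -
          have "h t \<noteq> 0" using h0 that by blast
          then show ?thesis using hint[OF that(1)] Int_less_imp_le_minus_1[of 0 "h t"] by simp
        qed
        then have "1 \<le> h y" "1 \<le> h z" using yz by blast+
        moreover have "h x = h y + h z" by (simp add: yz(3) h_def inner_add_left sum.distrib)
        ultimately have "h y < real n" "h z < real n" using x(2) by auto
        then have "\<exists>F c. finite F \<and> F \<subseteq> G \<and> y = (\<Sum>s\<in>F. real (c s :: nat) *\<^sub>R s)"
          "\<exists>F c. finite F \<and> F \<subseteq> G \<and> z = (\<Sum>s\<in>F. real (c s :: nat) *\<^sub>R s)"
          using Suc yz(1,2) by blast+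
        then obtain F1 c1 F2 c2 where F: "finite F1" "F1 \<subseteq> G" "y = (\<Sum>s\<in>F1. real (c1 s :: nat) *\<^sub>R s)"
          "finite F2" "F2 \<subseteq> G" "z = (\<Sum>s\<in>F2. real (c2 s :: nat) *\<^sub>R s)"
          by (elim exE conjE) rule
        let ?c = "\<lambda>s. (if s \<in> F1 then c1 s else 0) + (if s \<in> F2 then c2 s else 0)"
        have "y = (\<Sum>s\<in>F1 \<union> F2. real (if s \<in> F1 then c1 s else 0) *\<^sub>R s)"
          unfolding F(3) using F(1,4) by (intro sum.mono_neutral_cong_left) auto
        moreover have "z = (\<Sum>s\<in>F1 \<union> F2. real (if s \<in> F2 then c2 s else 0) *\<^sub>R s)"
          unfolding F(6) using F(1,4) by (intro sum.mono_neutral_cong_left) auto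
        ultimately have "x = (\<Sum>s\<in>F1 \<union> F2. real (?c s) *\<^sub>R s)"
          unfolding yz(3) by (simp add: scaleR_left_distrib sum.distrib)
        then show ?thesis using F by (intro exI[of _ "F1 \<union> F2"] exI[of _ ?c]) auto
      qed
    qed
  qed
  moreover obtain n :: nat where "h x < real n" using reals_Archimedean2 by blast
  ultimately show ?thesis using assms(1) by blast
qed

end

theorem shifted_polytope_generates:
  assumes \<sigma>: "\<sigma> \<in> maximal_cones \<Sigma>" and rat: "uD \<sigma> \<in> rat_vectors" "uD' \<sigma> \<in> rat_vectors"
  shows "generates_semigroup (shifted_polytope \<Sigma> (\<lambda>\<rho>. D \<rho> + D' \<rho>) \<sigma> \<inter> int_lattice)
           (dual_cone \<sigma> \<inter> int_lattice)"
proof -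
  let ?E = "\<lambda>\<rho>. D \<rho> + D' \<rho>" and ?u = "uD \<sigma> + uD' \<sigma>"
  let ?G = "shifted_polytope \<Sigma> ?E \<sigma> \<inter> int_lattice"
  note \<sigma>' = maximalD[OF \<sigma>]
  note rc = rational[OF \<sigma>'(1)]
  have ld: "local_datum D \<sigma> (uD \<sigma>)" "local_datum D' \<sigma> (uD' \<sigma>)" using datum datum' \<sigma> by auto
  have vertex: "vertex ?E \<sigma> = ?u" unfolding vertex_def
  proof (rule the_equality)
    show "?u \<in> rat_vectors \<and> local_datum ?E \<sigma> ?u"
      using rat ld by (auto simp: local_datum_def inner_add_left intro: rat_vectors_add)
    fix u assume u: "u \<in> rat_vectors \<and> local_datum ?E \<sigma> u"
    have "u - ?u = 0"
    proof (rule full_cone_eq_zero[OF rc \<sigma>'(2)])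
      fix \<rho> assume "\<rho> \<in> rays_of \<sigma>"
      then show "(u - ?u) \<bullet> prim_gen \<rho> = 0"
        using u ld by (auto simp: local_datum_def inner_add_left inner_diff_left)
    qed
    then show "u = ?u" by simp
  qed
  have ray_cond: "- (D \<rho> + D' \<rho>) \<le> (x + ?u) \<bullet> prim_gen \<rho>" if x: "x \<in> dual_lattice \<sigma>" and \<rho>: "\<rho> \<in> rays \<Sigma>"
    and far: "\<And>\<rho>. \<rho> \<in> rays \<Sigma> \<Longrightarrow> prim_gen \<rho> \<notin> \<sigma> \<Longrightarrow> 1 \<le> (x + uD' \<sigma>) \<bullet> prim_gen \<rho> + excess \<sigma> \<rho>" for x \<rho>
  proof (cases "prim_gen \<rho> \<in> \<sigma>")
    case True
    then have "\<rho> \<in> rays_of \<sigma>" using ray_mem_cone[OF \<rho> \<sigma>'(1)] by blast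
    then show ?thesis using x ld by (auto simp: mem_dual_lattice[OF \<sigma>] local_datum_def inner_add_left)
  next
    case False
    then show ?thesis using far[OF \<rho>] D'_ge[OF \<rho>] by (simp add: excess_def inner_add_left)
  qed
  have G: "y \<in> ?G" if y: "y \<in> dual_lattice \<sigma>"
    and far: "\<And>\<rho>. \<rho> \<in> rays \<Sigma> \<Longrightarrow> prim_gen \<rho> \<notin> \<sigma> \<Longrightarrow> 1 \<le> (y + uD' \<sigma>) \<bullet> prim_gen \<rho> + excess \<sigma> \<rho>" for y
  proof -
    have yl: "y \<in> int_lattice" using y by (simp add: mem_dual_lattice[OF \<sigma>])
    have "y + ?u \<in> rat_vectors" using int_lattice_rat[OF yl] rat by (intro rat_vectors_add)
    then have "y + ?u \<in> divisor_polytope \<Sigma> ?E"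
      using ray_cond[OF y _ far] by (auto simp: divisor_polytope_def)
    then show ?thesis using yl unfolding shifted_polytope_def vertex by (auto simp: image_iff intro!: bexI[of _ "y + ?u"])
  qed
  have "?G \<subseteq> dual_cone \<sigma> \<inter> int_lattice"
  proof
    fix y assume y: "y \<in> ?G"
    then obtain z where z: "z \<in> divisor_polytope \<Sigma> ?E" "y = z - ?u" by (auto simp: shifted_polytope_def vertex)
    have "0 \<le> y \<bullet> prim_gen \<rho>" if \<rho>: "\<rho> \<in> rays_of \<sigma>" for \<rho>
      using z ld rays_of_rays[OF \<sigma>'(1) \<rho>] \<rho>
      by (force simp: divisor_polytope_def local_datum_def inner_add_left inner_diff_left)
    then have "y \<in> dual_lattice \<sigma>" using y by (simp add: mem_dual_lattice[OF \<sigma>])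
    then show "y \<in> dual_cone \<sigma> \<inter> int_lattice" by (simp add: dual_lattice_def[OF \<sigma>])
  qed
  moreover have "\<exists>F c. finite F \<and> F \<subseteq> ?G \<and> x = (\<Sum>s\<in>F. real (c s :: nat) *\<^sub>R s)" if "x \<in> dual_cone \<sigma> \<inter> int_lattice" for x
    using dual_lattice_generated[OF \<sigma>, of x ?G] G that by (simp add: dual_lattice_def[OF \<sigma>])
  ultimately show ?thesis unfolding generates_semigroup_def by blast
qed

end

section \<open>Polynomials over an algebraically closed field\<close>

lemma infinite_UNIV_alg_closed: "infinite (UNIV :: 'k::alg_closed_field set)"
proof
  assume fin: "finite (UNIV :: 'k set)"
  define p :: "'k poly" where "p = (\<Prod>a\<in>UNIV. [:- a, 1:]) + 1"
  have "degree (\<Prod>a\<in>(UNIV::'k set). [:- a, 1:]) = CARD('k)"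
    by (subst degree_prod_eq_sum_degree) auto
  moreover have "CARD('k) > 0" using fin by (simp add: card_gt_0_iff)
  ultimately have "degree p > 0" unfolding p_def by (subst degree_add_eq_left) auto
  then obtain x where "poly p x = 0" using alg_closed_imp_poly_has_root by blast
  moreover have "poly p x = 1" using fin by (simp add: p_def poly_prod prod.remove[of UNIV x])
  ultimately show False by simp
qed

lemma cofinite_alg_closed_neq_bot: "(cofinite :: 'k::alg_closed_field filter) \<noteq> bot"
  unfolding eventually_False[symmetric] eventually_cofinite by (simp add: infinite_UNIV_alg_closed)

lemma eventually_poly_nonzero: "(p :: 'k::idom poly) \<noteq> 0 \<Longrightarrow> \<forall>\<^sub>F t in cofinite. poly p t \<noteq> 0"
  by (simp add: eventually_cofinite poly_roots_finite)

lemma eventually_neq_cofinite: "\<forall>\<^sub>F t in cofinite. t \<noteq> a"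
  by (simp add: eventually_cofinite)

lemma poly_eqI_cofinite:
  fixes p q :: "'k::alg_closed_field poly"
  assumes "\<forall>\<^sub>F t in cofinite. poly p t = poly q t" shows "p = q"
proof (rule ccontr)
  assume "p \<noteq> q"
  then have "\<forall>\<^sub>F t in cofinite. poly (p - q) t \<noteq> 0" by (intro eventually_poly_nonzero) auto
  then have "\<forall>\<^sub>F t in (cofinite :: 'k filter). False" using assms by eventually_elim auto
  then show False using cofinite_alg_closed_neq_bot[where 'k='k] by (simp only: eventually_False)
qed

section \<open>Charts of projective space\<close>

lemma algebra_gen_one: "(\<lambda>_. 1) \<in> algebra_gen S"
  by (rule algebra_gen.const)

lemma algebra_gen_power: "f \<in> algebra_gen S \<Longrightarrow> (\<lambda>z. f z ^ k) \<in> algebra_gen S"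
  by (induction k) (auto intro: algebra_gen.intros)

lemma zariski_open_chart:
  assumes "(U, A) \<in> At" "(\<lambda>_. 1) \<in> A"
  shows "zariski_open At (U :: 'p set)" "f \<in> A \<Longrightarrow> regular_on At U (f :: 'p \<Rightarrow> 'k::field)"
proof -
  show "zariski_open At U"
    unfolding zariski_open_def by (intro ballI bexI[OF _ assms(1)]) (auto intro!: bexI[OF _ assms(2)])
  show "regular_on At U f" if "f \<in> A"
    unfolding regular_on_def using that
    by (intro ballI bexI[OF _ assms(1)]) (simp, intro bexI[OF _ that] bexI[OF _ assms(2)], simp)
qed

lemma pts_subvariety: "pts (subvariety At Z) = pts At \<inter> Z"
  by (simp add: pts_def subvariety_def case_prod_beta image_image)

definition coord_line :: "(nat \<Rightarrow> 'k::field) \<Rightarrow> (nat \<Rightarrow> 'k) set" where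
  "coord_line x = {\<lambda>i. c * x i | c. c \<noteq> 0}"

lemma coord_line_self: "x \<in> coord_line x"
  unfolding coord_line_def by (intro CollectI exI[of _ 1]) auto

lemma coord_line_scale: "c \<noteq> 0 \<Longrightarrow> coord_line (\<lambda>i. c * x i) = coord_line x"
proof -
  have sub: "coord_line (\<lambda>i. c * x i) \<subseteq> coord_line x" if "c \<noteq> 0" for c and x :: "nat \<Rightarrow> 'a"
  proof
    fix y assume "y \<in> coord_line (\<lambda>i. c * x i)"
    then obtain d where "d \<noteq> 0" "y = (\<lambda>i. d * (c * x i))" by (auto simp: coord_line_def)
    then show "y \<in> coord_line x" using that unfolding coord_line_def
      by (intro CollectI exI[of _ "d * c"]) (auto simp: mult.assoc)
  qed
  assume c: "c \<noteq> 0"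
  have "coord_line (\<lambda>i. inverse c * (c * x i)) = coord_line x" using c by (simp flip: mult.assoc)
  then show ?thesis using sub[OF c, of x] sub[of "inverse c" "\<lambda>i. c * x i"] c by auto
qed

lemma proj_points_eq: "proj_points m = {coord_line x | x. (\<forall>i>m. x i = 0) \<and> (\<exists>i. x i \<noteq> 0)}"
  by (simp add: proj_points_def coord_line_def)

lemma proj_ratio_line: "proj_ratio i j (coord_line x) = x i / (x j :: 'k::field)"
proof -
  have "(SOME y. y \<in> coord_line x) \<in> coord_line x" by (rule someI[of "\<lambda>y. y \<in> coord_line x"]) (rule coord_line_self)
  then obtain c where "c \<noteq> 0" "(SOME y. y \<in> coord_line x) = (\<lambda>i. c * x i)" by (auto simp: coord_line_def)
  then show ?thesis by (simp add: proj_ratio_def)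
qed

lemma coord_line_nonzero_iff: "(\<forall>y\<in>coord_line x. y j \<noteq> 0) \<longleftrightarrow> x j \<noteq> (0 :: 'k::field)"
  using coord_line_self by (auto simp: coord_line_def)

definition proj_chart :: "nat \<Rightarrow> nat \<Rightarrow> (nat \<Rightarrow> 'k::field) set set" where
  "proj_chart m j = {L \<in> proj_points m. \<forall>x\<in>L. x j \<noteq> 0}"

definition proj_algebra :: "nat \<Rightarrow> nat \<Rightarrow> ((nat \<Rightarrow> 'k::field) set \<Rightarrow> 'k) set" where
  "proj_algebra m j = algebra_gen {proj_ratio i j | i. i \<le> m}"

lemma proj_space_eq: "proj_space m = (\<lambda>j. (proj_chart m j, proj_algebra m j)) ` {..m}"
  by (simp add: proj_space_def proj_chart_def proj_algebra_def)

lemma line_in_proj_chart: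
  assumes "\<forall>i>m. x i = 0" "x j \<noteq> (0 :: 'k::field)"
  shows "coord_line x \<in> proj_chart m j"
  using assms coord_line_nonzero_iff[of x j] by (auto simp: proj_chart_def proj_points_eq)

lemma proj_chart_cases:
  assumes "L \<in> proj_chart m j"
  obtains x where "L = coord_line x" "\<forall>i>m. x i = 0" "x j \<noteq> (0 :: 'k::field)"
  using assms coord_line_nonzero_iff[of _ j] by (auto simp: proj_chart_def proj_points_eq)

text \<open>
  Along a curve with polynomial homogeneous coordinates, a function of the \<open>j\<close>-th chart becomes a
  rational function whose denominator is a power of the \<open>j\<close>-th coordinate.
\<close>

lemma proj_algebra_polynomial_curve:
  fixes R :: "nat \<Rightarrow> 'k::field poly"
  assumes "q \<in> proj_algebra m j"
  shows "\<exists>P N. \<forall>t. poly (R j) t \<noteq> 0 \<longrightarrow> q (coord_line (\<lambda>i. poly (R i) t)) = poly P t / poly (R j) t ^ N"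
  using assms unfolding proj_algebra_def
proof induction
  case (const c)
  show ?case by (intro exI[of _ "[:c:]"] exI[of _ 0]) auto
next
  case (gen f)
  then obtain i where "f = proj_ratio i j" by blast
  then show ?case by (intro exI[of _ "R i"] exI[of _ 1]) (auto simp: proj_ratio_line)
next
  case (add f g)
  then obtain P N Q M where
    "\<forall>t. poly (R j) t \<noteq> 0 \<longrightarrow> f (coord_line (\<lambda>i. poly (R i) t)) = poly P t / poly (R j) t ^ N"
    "\<forall>t. poly (R j) t \<noteq> 0 \<longrightarrow> g (coord_line (\<lambda>i. poly (R i) t)) = poly Q t / poly (R j) t ^ M" by blast
  then show ?case
    by (intro exI[of _ "P * R j ^ M + Q * R j ^ N"] exI[of _ "N + M"]) (auto simp: field_simps power_add)
next
  case (mult f g)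
  then obtain P N Q M where
    "\<forall>t. poly (R j) t \<noteq> 0 \<longrightarrow> f (coord_line (\<lambda>i. poly (R i) t)) = poly P t / poly (R j) t ^ N"
    "\<forall>t. poly (R j) t \<noteq> 0 \<longrightarrow> g (coord_line (\<lambda>i. poly (R i) t)) = poly Q t / poly (R j) t ^ M" by blast
  then show ?case
    by (intro exI[of _ "P * Q"] exI[of _ "N + M"]) (auto simp: power_add)
qed

section \<open>One-parameter subgroups\<close>

text \<open>
  The value at \<open>t\<close> of the one-parameter subgroup of the torus given by a lattice vector \<open>v\<close>.
\<close>

definition one_param :: "real^'n::finite \<Rightarrow> 'k::field \<Rightarrow> ('n, 'k) toric_point" where
  "one_param v t = ({0}, \<lambda>u. if u \<in> int_lattice then t powi \<lfloor>u \<bullet> v\<rfloor> else 0)"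

lemma perp_lattice_0: "perp_lattice {0} = int_lattice"
  by (auto simp: perp_lattice_def)

lemma one_param_orbit:
  assumes "v \<in> int_lattice" "t \<noteq> 0"
  shows "one_param v t \<in> orbit {0}"
proof -
  have "t powi \<lfloor>(u + u') \<bullet> v\<rfloor> = t powi \<lfloor>u \<bullet> v\<rfloor> * t powi \<lfloor>u' \<bullet> v\<rfloor>"
    if "u \<in> int_lattice" "u' \<in> int_lattice" for u u'
  proof -
    have "\<lfloor>(u + u') \<bullet> v\<rfloor> = \<lfloor>u \<bullet> v\<rfloor> + \<lfloor>u' \<bullet> v\<rfloor>"
      using int_lattice_inner[OF that(1) assms(1)] by (auto simp: inner_add_left elim!: Ints_cases)
    then show ?thesis using assms(2) by (simp add: power_int_add)
  qed
  then show ?thesis unfolding one_param_def orbit_def perp_lattice_0 using assms(2)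
    by (auto intro: int_lattice_add)
qed

lemma character_one_param: "u \<in> int_lattice \<Longrightarrow> character u (one_param v t) = t powi \<lfloor>u \<bullet> v\<rfloor>"
  by (simp add: character_def one_param_def)

lemma powi_Laurent: "\<exists>P N. \<forall>t. t \<noteq> 0 \<longrightarrow> t powi k = poly P t / (t::'k::field) ^ N"
proof (cases "k \<ge> 0")
  case True
  then show ?thesis by (intro exI[of _ "monom 1 (nat k)"] exI[of _ 0]) (auto simp: poly_monom power_int_def)
next
  case False
  then show ?thesis by (intro exI[of _ 1] exI[of _ "nat (- k)"]) (auto simp: power_int_def divide_inverse power_inverse)
qed

lemma toric_algebra_one_param:
  fixes f :: "('n::finite, 'k::field) toric_point \<Rightarrow> 'k"
  assumes "f \<in> algebra_gen {character u | u. u \<in> dual_cone \<sigma> \<inter> int_lattice}"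
  shows "\<exists>P N. \<forall>t. t \<noteq> 0 \<longrightarrow> f (one_param v t) = poly P t / t ^ N"
  using assms
proof induction
  case (const c)
  show ?case by (intro exI[of _ "[:c:]"] exI[of _ 0]) auto
next
  case (gen f)
  then obtain u where "f = character u" "u \<in> int_lattice" by blast
  then show ?case using powi_Laurent[of "\<lfloor>u \<bullet> v\<rfloor>"] by (simp add: character_one_param)
next
  case (add f g)
  obtain P N where "\<forall>t. t \<noteq> 0 \<longrightarrow> f (one_param v t) = poly P t / t ^ N" using add.IH(1) by blast
  moreover obtain Q M where "\<forall>t. t \<noteq> 0 \<longrightarrow> g (one_param v t) = poly Q t / t ^ M" using add.IH(2) by blast
  ultimately show ?case
    by (intro exI[of _ "P * monom 1 M + Q * monom 1 N"] exI[of _ "N + M"]) (auto simp: field_simps power_add poly_monom)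
next
  case (mult f g)
  obtain P N where "\<forall>t. t \<noteq> 0 \<longrightarrow> f (one_param v t) = poly P t / t ^ N" using mult.IH(1) by blast
  moreover obtain Q M where "\<forall>t. t \<noteq> 0 \<longrightarrow> g (one_param v t) = poly Q t / t ^ M" using mult.IH(2) by blast
  ultimately show ?case
    by (intro exI[of _ "P * Q"] exI[of _ "N + M"]) (auto simp: power_add)
qed

lemma cone_face_zero:
  assumes "rational_cone \<sigma>" shows "cone_face {0} \<sigma>"
proof -
  have cc: "convex_cone \<sigma>" using assms by (rule rational_cone_convex_cone)
  have "a = 0 \<and> b = 0" if "a \<in> \<sigma>" "b \<in> \<sigma>" "a + b = 0" for a b
  proof -
    have "b = - a" using that(3) by (simp add: eq_neg_iff_add_eq_0 add.commute)
    then show ?thesis using assms that by (auto simp: rational_cone_def)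
  qed
  then show ?thesis unfolding cone_face_iff[OF cc] using cc by (auto simp: convex_cone_iff)
qed

definition toric_open :: "(real^'n::finite) set \<Rightarrow> ('n, 'k::field) toric_point set" where
  "toric_open \<sigma> = (\<Union>\<tau>\<in>{\<tau>. cone_face \<tau> \<sigma>}. orbit \<tau>)"

definition toric_algebra :: "(real^'n::finite) set \<Rightarrow> (('n, 'k::field) toric_point \<Rightarrow> 'k) set" where
  "toric_algebra \<sigma> = algebra_gen {character u | u. u \<in> dual_cone \<sigma> \<inter> int_lattice}"

lemma toric_variety_eq: "toric_variety \<Sigma> = (\<lambda>\<sigma>. (toric_open \<sigma>, toric_algebra \<sigma>)) ` \<Sigma>"
  by (simp add: toric_variety_def toric_chart_def toric_open_def toric_algebra_def)

lemma one_param_toric_open: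
  assumes "rational_cone \<sigma>" "v \<in> int_lattice" "t \<noteq> 0"
  shows "one_param v t \<in> toric_open \<sigma>"
  using one_param_orbit[OF assms(2,3)] cone_face_zero[OF assms(1)] by (auto simp: toric_open_def)

text \<open>
  On the subgroup a function of a chart is a Laurent polynomial in \<open>t\<close>. It is not zero at \<open>t = 1\<close>, hence
  nonzero for almost all \<open>t\<close>.
\<close>

lemma one_param_eventually_open:
  fixes \<Sigma> :: "(real^'n::finite) set set"
  assumes "fan \<Sigma>" "v \<in> int_lattice" "zariski_open (toric_variety \<Sigma>) W" "one_param v (1::'k::alg_closed_field) \<in> W"
  shows "\<forall>\<^sub>F t in cofinite. one_param v (t::'k) \<in> W"
proof -
  obtain \<sigma> q where q: "\<sigma> \<in> \<Sigma>" "q \<in> toric_algebra \<sigma>" "q (one_param v 1) \<noteq> 0" "{z\<in>toric_open \<sigma>. q z \<noteq> 0} \<subseteq> W"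
    using assms(3,4) unfolding zariski_open_def toric_variety_eq by fastforce
  obtain P N where P: "\<forall>t. t \<noteq> 0 \<longrightarrow> q (one_param v t) = poly P t / t ^ N"
    using toric_algebra_one_param q(2) unfolding toric_algebra_def by blast
  have "P \<noteq> 0" using P q(3) by force
  then have "\<forall>\<^sub>F t in cofinite. poly P t \<noteq> 0" by (rule eventually_poly_nonzero)
  moreover have "\<forall>\<^sub>F t in cofinite. t \<noteq> (0::'k)" by (rule eventually_neq_cofinite)
  ultimately show ?thesis
  proof eventually_elim
    case (elim t)
    have "rational_cone \<sigma>" using assms(1) q(1) by (auto simp: fan_def)
    then have "one_param v t \<in> toric_open \<sigma>" using elim by (intro one_param_toric_open assms(2))
    moreover have "q (one_param v t) \<noteq> 0" using P elim by simp
    ultimately show ?case using q(4) by blast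
  qed
qed

lemma one_param_eventually_regular:
  fixes \<Sigma> :: "(real^'n::finite) set set"
  assumes "fan \<Sigma>" "v \<in> int_lattice" "zariski_open (toric_variety \<Sigma>) W" "one_param v (1::'k::alg_closed_field) \<in> W"
    "regular_on (toric_variety \<Sigma>) W f"
  shows "\<exists>P Q. Q \<noteq> 0 \<and> (\<forall>\<^sub>F t in cofinite. f (one_param v (t::'k)) * poly Q t = poly P t)"
proof -
  obtain \<sigma> p q where q: "\<sigma> \<in> \<Sigma>" "p \<in> toric_algebra \<sigma>" "q \<in> toric_algebra \<sigma>" "q (one_param v 1) \<noteq> 0"
    "\<forall>z\<in>toric_open \<sigma> \<inter> W. q z \<noteq> 0 \<longrightarrow> f z = p z / q z"
    using assms(4,5) unfolding regular_on_def toric_variety_eq by fastforce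
  obtain P N where P: "\<forall>t. t \<noteq> 0 \<longrightarrow> p (one_param v t) = poly P t / t ^ N"
    using toric_algebra_one_param q(2) unfolding toric_algebra_def by blast
  obtain Q M where Q: "\<forall>t. t \<noteq> 0 \<longrightarrow> q (one_param v t) = poly Q t / t ^ M"
    using toric_algebra_one_param q(3) unfolding toric_algebra_def by blast
  have "Q \<noteq> 0" using Q q(4) by force
  have rc: "rational_cone \<sigma>" using assms(1) q(1) by (auto simp: fan_def)
  have "\<forall>\<^sub>F t in cofinite. f (one_param v t) * poly (Q * monom 1 N) t = poly (P * monom 1 M) t"
    using eventually_poly_nonzero[OF \<open>Q \<noteq> 0\<close>] eventually_neq_cofinite[of "0::'k"]
      one_param_eventually_open[OF assms(1-4)]
  proof eventually_elim
    case (elim t)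
    have "q (one_param v t) \<noteq> 0" using Q elim by simp
    then have "f (one_param v t) = p (one_param v t) / q (one_param v t)"
      using q(5) elim one_param_toric_open[OF rc assms(2), of t] by blast
    then show ?case using P Q elim by (simp add: poly_monom field_simps)
  qed
  moreover have "Q * monom 1 N \<noteq> 0" using \<open>Q \<noteq> 0\<close> by (simp add: monom_eq_0_iff)
  ultimately show ?thesis by blast
qed

lemma closure_rat_vectors: "closure (rat_vectors :: (real^'n::finite) set) = UNIV"
proof -
  have sm: "sum f A \<in> rat_vectors" if "\<And>i. i \<in> A \<Longrightarrow> f i \<in> (rat_vectors :: (real^'n) set)" for f :: "real^'n \<Rightarrow> real^'n" and A
    using that by (induction A rule: infinite_finite_induct) (auto intro: rat_vectors_add)
  have "(\<Union>f \<in> Basis \<rightarrow> \<rat>. { \<Sum>i :: real^'n \<in> Basis. f i *\<^sub>R i }) \<subseteq> rat_vectors"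
    by (auto intro!: sm rat_vectors_scale simp: Basis_vec_def int_lattice_rat axis_in_int_lattice)
  then show ?thesis using closure_mono closure_rational_coordinates[where 'a="real^'n"] by blast
qed

text \<open>
  A separating functional can be perturbed by one that is strictly positive on the nonzero elements,
  which exists since the cone is pointed. The conditions on the functional are then open, and rational
  vectors are dense.
\<close>

lemma rational_cone_separation:
  fixes \<sigma> :: "(real^'n::finite) set"
  assumes "rational_cone \<sigma>" "v \<notin> \<sigma>"
  obtains u where "u \<in> dual_cone \<sigma>" "u \<in> int_lattice" "u \<bullet> v < 0"
proof -
  obtain S0 where S0: "finite S0" "\<sigma> = convex_cone hull S0"
    using assms by (auto simp: rational_cone_def)
  define S where "S = S0 - {0}"
  have cc: "convex_cone \<sigma>" using assms(1) by (rule rational_cone_convex_cone)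
  have S: "finite S" "S \<subseteq> \<sigma>" using S0 by (auto simp: S_def hull_inc)
  have sub: "\<sigma> \<subseteq> {x. 0 \<le> u \<bullet> x}" if "\<forall>s\<in>S. 0 \<le> u \<bullet> s" for u
    unfolding S0(2) using that by (intro hull_minimal) (auto simp: S_def convex_cone_halfspace_ge)
  \<comment> \<open>some functional is strictly positive on \<open>S\<close>, since the cone is pointed\<close>
  have "0 \<notin> convex hull S"
  proof
    assume "0 \<in> convex hull S"
    then obtain c where c: "\<forall>s\<in>S. 0 \<le> c s" "sum c S = 1" "(\<Sum>s\<in>S. c s *\<^sub>R s) = 0"
      using S(1) by (auto simp: convex_hull_finite)
    have "c s = 0" if "s \<in> S" for s
    proof -
      have "c s *\<^sub>R s = 0"
        by (rule pointed_cone_sum_zero[OF cc _ S(1) _ c(3) that])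
           (use assms(1) c S cc in \<open>auto simp: rational_cone_def intro: convex_cone_scaleR\<close>)
      then show ?thesis using that by (auto simp: S_def)
    qed
    then show False using c(2) by simp
  qed
  then obtain u0 b where u0: "0 < b" "\<forall>x\<in>convex hull S. u0 \<bullet> x > b"
    using separating_hyperplane_closed_0[of "convex hull S"] S(1)
    by (metis compact_imp_closed convex_convex_hull finite_imp_compact_convex_hull)
  have u0pos: "0 < u0 \<bullet> s" if "s \<in> S" for s using u0 that hull_inc[of s S convex] by force
  have "closed \<sigma>" "convex \<sigma>"
    using rational_cone_polyhedron[OF assms(1)] by (auto simp: polyhedron_imp_closed polyhedron_imp_convex)
  then obtain a b where ab: "a \<bullet> v < b" "\<forall>x\<in>\<sigma>. b < a \<bullet> x"
    using separating_hyperplane_closed_point[of \<sigma> v] assms(2) by metis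
  have b0: "b < 0" using ab(2) convex_cone_contains_0[OF cc] by force
  have a0: "0 \<le> a \<bullet> s" if "s \<in> S" for s
  proof (rule ccontr)
    assume n: "\<not> 0 \<le> a \<bullet> s"
    have "(b / (a \<bullet> s)) *\<^sub>R s \<in> \<sigma>" using n b0 S(2) that by (intro convex_cone_scaleR[OF cc]) (auto simp: divide_nonpos_neg)
    then have "b < a \<bullet> ((b / (a \<bullet> s)) *\<^sub>R s)" using ab(2) by blast
    then show False using n by simp
  qed
  \<comment> \<open>small enough that adding \<open>e u0\<close> keeps the pairing with \<open>v\<close> negative\<close>
  define e where "e = (- (a \<bullet> v)) / (2 * (\<bar>u0 \<bullet> v\<bar> + 1))"
  have av: "a \<bullet> v < 0" using ab b0 by linarith
  have e: "e > 0" unfolding e_def using av by (intro divide_pos_pos) (auto intro: add_nonneg_pos)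
  have "e * (u0 \<bullet> v) \<le> e * (\<bar>u0 \<bullet> v\<bar> + 1)" using e by (intro mult_left_mono) auto
  also have "\<dots> = - (a \<bullet> v) / 2" by (simp add: e_def field_simps add_nonneg_eq_0_iff)
  finally have neg: "(a + e *\<^sub>R u0) \<bullet> v < 0" using av by (simp add: inner_add_left)
  have pos: "0 < (a + e *\<^sub>R u0) \<bullet> s" if "s \<in> S" for s
    using a0[OF that] u0pos[OF that] e by (simp add: inner_add_left add_nonneg_pos)
  let ?U = "(\<Inter>s\<in>S. {u. 0 < u \<bullet> s}) \<inter> {u. u \<bullet> v < 0}"
  have "open ?U" using S(1)
    by (intro open_Int open_INT ballI open_Collect_less continuous_intros) auto
  moreover have "a + e *\<^sub>R u0 \<in> ?U" using neg pos by auto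
  ultimately obtain d where d: "d > 0" "ball (a + e *\<^sub>R u0) d \<subseteq> ?U" by (meson open_contains_ball)
  have "a + e *\<^sub>R u0 \<in> closure rat_vectors" by (simp add: closure_rat_vectors)
  then obtain u1 where u1: "u1 \<in> rat_vectors" "dist u1 (a + e *\<^sub>R u0) < d"
    using d(1) by (auto simp: closure_approachable)
  obtain m :: nat where m: "m > 0" "real m *\<^sub>R u1 \<in> int_lattice" using clear_denominators[OF u1(1)] .
  have "u1 \<in> ?U" using u1(2) d(2) by (auto simp: dist_commute subset_iff)
  then have *: "\<forall>s\<in>S. 0 \<le> (real m *\<^sub>R u1) \<bullet> s" "(real m *\<^sub>R u1) \<bullet> v < 0"
    using m(1) by (auto simp: mult_pos_neg intro: less_imp_le)
  show thesis using that[of "real m *\<^sub>R u1"] sub[OF *(1)] *(2) m(2) int_lattice_rat[OF m(2)]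
    by (auto simp: dual_cone_def)
qed

section \<open>Projective toric varieties have complete fans\<close>

text \<open>
  Clearing denominators turns the coordinate ratios into polynomials. Dividing by the common power of
  \<open>t\<close> makes them not all vanish at \<open>t = 0\<close>, so that the curve has a limit there.
\<close>

lemma curve_normal_form:
  fixes L :: "'k::alg_closed_field \<Rightarrow> (nat \<Rightarrow> 'k) set"
  assumes j: "j \<le> m" and L: "\<forall>\<^sub>F t in cofinite. L t \<in> proj_chart m j"
    and ratio: "\<And>i. i \<le> m \<Longrightarrow> \<exists>P Q. Q \<noteq> 0 \<and> (\<forall>\<^sub>F t in cofinite. proj_ratio i j (L t) * poly Q t = poly P t)"
  obtains R where "\<forall>\<^sub>F t in cofinite. L t = coord_line (\<lambda>i. poly (R i) t)" "\<forall>i>m. R i = 0" "\<exists>i\<le>m. poly (R i) 0 \<noteq> 0"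
proof -
  define good where "good R \<longleftrightarrow> R j \<noteq> 0 \<and> (\<forall>i>m. R i = 0) \<and>
    (\<forall>i\<le>m. \<forall>\<^sub>F t in cofinite. proj_ratio i j (L t) * poly (R j) t = poly (R i) t)" for R :: "nat \<Rightarrow> 'k poly"
  obtain P Q where PQ: "\<And>i. i \<le> m \<Longrightarrow> Q i \<noteq> 0 \<and> (\<forall>\<^sub>F t in cofinite. proj_ratio i j (L t) * poly (Q i) t = poly (P i) t)"
    using ratio by metis
  have jj: "\<forall>\<^sub>F t in cofinite. proj_ratio j j (L t) = 1"
    using L by eventually_elim (auto elim!: proj_chart_cases simp: proj_ratio_line)
  have ex: "\<exists>R. good R"
  proof -
    define R where "R i = (if i \<le> m then if i = j then prod Q {..m} else P i * prod Q ({..m} - {i}) else 0)" for i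
    have "R j \<noteq> 0" using j PQ by (simp add: R_def prod_zero_iff)
    moreover have "\<forall>\<^sub>F t in cofinite. proj_ratio i j (L t) * poly (R j) t = poly (R i) t" if i: "i \<le> m" for i
    proof (cases "i = j")
      case True
      then show ?thesis using jj by (auto elim: eventually_mono)
    next
      case False
      have "R j = Q i * prod Q ({..m} - {i})" using i j by (simp add: R_def prod.remove)
      moreover have "R i = P i * prod Q ({..m} - {i})" using i False by (simp add: R_def)
      ultimately show ?thesis using PQ[OF i] by (auto elim!: eventually_mono simp: mult.assoc[symmetric])
    qed
    moreover have "\<forall>i>m. R i = 0" by (simp add: R_def)
    ultimately show ?thesis unfolding good_def by blast
  qed
  \<comment> \<open>a representative whose \<open>j\<close>-th coordinate has least degree has no common factor \<open>t\<close>\<close>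
  obtain R where R: "good R" "\<And>R'. good R' \<Longrightarrow> degree (R j) \<le> degree (R' j)"
    using ex_has_least_nat[of good _ "\<lambda>R. degree (R j)"] ex by blast
  have Rj: "R j \<noteq> 0" using R(1) by (simp add: good_def)
  have "\<exists>i\<le>m. poly (R i) 0 \<noteq> 0"
  proof (rule ccontr)
    assume n: "\<not> ?thesis"
    have "\<exists>S. R i = [:0, 1:] * S" for i
    proof (cases "i \<le> m")
      case True
      then have "[:- 0, 1:] dvd R i" using n poly_eq_0_iff_dvd by blast
      then show ?thesis by (auto elim: dvdE)
    next
      case False
      then show ?thesis using R(1) by (intro exI[of _ 0]) (auto simp: good_def)
    qed
    then obtain S where S: "\<And>i. R i = [:0, 1:] * S i" by metis
    have Sj: "S j \<noteq> 0" using R(1) S[of j] by (auto simp: good_def)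
    have "good S" unfolding good_def
    proof (intro conjI allI impI Sj)
      fix i assume "m < i" then show "S i = 0" using R(1) S[of i] by (auto simp: good_def)
    next
      fix i assume "i \<le> m"
      then have "\<forall>\<^sub>F t in cofinite. proj_ratio i j (L t) * poly (R j) t = poly (R i) t" using R(1) by (auto simp: good_def)
      then show "\<forall>\<^sub>F t in cofinite. proj_ratio i j (L t) * poly (S j) t = poly (S i) t"
        using eventually_neq_cofinite[of "0::'k"] by eventually_elim (simp add: S)
    qed
    moreover have "degree (R j) = Suc (degree (S j))" using Sj by (simp add: S)
    ultimately show False using R(2)[of S] by simp
  qed
  moreover have "\<forall>\<^sub>F t in cofinite. \<forall>i\<in>{..m}. proj_ratio i j (L t) * poly (R j) t = poly (R i) t"
    using R(1) by (intro eventually_ball_finite) (auto simp: good_def)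
  then have "\<forall>\<^sub>F t in cofinite. L t = coord_line (\<lambda>i. poly (R i) t)"
    using L eventually_poly_nonzero[OF Rj]
  proof eventually_elim
    case (elim t)
    obtain x where x: "L t = coord_line x" "\<forall>i>m. x i = 0" "x j \<noteq> 0" using elim(2) by (rule proj_chart_cases)
    have "(\<lambda>i. poly (R i) t) = (\<lambda>i. poly (R j) t / x j * x i)"
    proof
      fix i show "poly (R i) t = poly (R j) t / x j * x i"
        using elim(1) x R(1) by (cases "i \<le> m") (auto simp: proj_ratio_line good_def field_simps)
    qed
    then show ?case using elim(3) x coord_line_scale[of "poly (R j) t / x j" x] by simp
  qed
  ultimately show thesis using that R(1) by (auto simp: good_def)
qed

text \<open>
  The one-parameter subgroup of \<open>v\<close> has a limit for $t \to 0$ in projective space, hence in the closed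
  image of the toric variety, and this limit lies in the chart of some cone $\sigma$. Characters
  \<open>u\<close> in $\sigma^\vee$ are regular there; on the subgroup they are $t^{\langle u, v\rangle}$, so the
  exponent is not negative.
\<close>

lemma one_param_limit_in_chart:
  fixes \<Sigma> :: "(real^'n::finite) set set"
  assumes fan: "fan \<Sigma>" and proj: "projective (toric_variety \<Sigma> :: (('n, 'k::alg_closed_field) toric_point, 'k) atlas)"
    and v: "v \<in> int_lattice"
  shows "\<exists>\<sigma>\<in>\<Sigma>. \<forall>u\<in>dual_cone \<sigma> \<inter> int_lattice. 0 \<le> u \<bullet> v"
proof -
  let ?At = "toric_variety \<Sigma> :: (('n, 'k) toric_point, 'k) atlas"
  obtain m and Z :: "(nat \<Rightarrow> 'k) set set" where Z: "zariski_closed (proj_space m) Z" "isomorphic ?At (subvariety (proj_space m) Z)"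
    using proj unfolding projective_def by blast
  let ?Bt = "subvariety (proj_space m) Z"
  obtain \<phi> \<psi> where \<phi>: "morphism ?At ?Bt \<phi>" and \<psi>: "morphism ?Bt ?At \<psi>" and inv: "\<forall>x\<in>pts ?At. \<psi> (\<phi> x) = x" "\<forall>y\<in>pts ?Bt. \<phi> (\<psi> y) = y"
    using Z(2) unfolding isomorphic_def by blast
  have Bt: "?Bt = (\<lambda>j. (proj_chart m j \<inter> Z, proj_algebra m j)) ` {..m}"
    by (simp add: subvariety_def proj_space_eq image_image)
  note ptsB = pts_subvariety[of "proj_space m" Z]
  obtain \<sigma>0 where \<sigma>0: "\<sigma>0 \<in> \<Sigma>" using fan by (auto simp: fan_def)
  have rc: "rational_cone \<sigma>" if "\<sigma> \<in> \<Sigma>" for \<sigma> using fan that by (auto simp: fan_def)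
  have lam: "one_param v t \<in> pts ?At" if "t \<noteq> 0" for t :: 'k
    using one_param_toric_open[OF rc[OF \<sigma>0] v that] \<sigma>0 by (auto simp: pts_def toric_variety_eq)
  have "\<phi> (one_param v 1) \<in> pts ?Bt" using \<phi> lam[of 1] by (auto simp: morphism_def)
  then obtain j where j: "j \<le> m" "\<phi> (one_param v 1) \<in> proj_chart m j \<inter> Z" by (auto simp: pts_def Bt)
  let ?W = "proj_chart m j \<inter> Z"
  have Wj: "(?W, proj_algebra m j) \<in> ?Bt" using j(1) by (auto simp: Bt)
  have one: "(\<lambda>_. 1) \<in> proj_algebra m j" for j by (simp add: proj_algebra_def algebra_gen_one)
  have Wo: "zariski_open ?Bt ?W" by (rule zariski_open_chart(1)[OF Wj one])
  let ?V = "pts ?At \<inter> \<phi> -` ?W"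
  have Vo: "zariski_open ?At ?V" using \<phi> Wo unfolding morphism_def by blast
  have V1: "one_param v 1 \<in> ?V" using lam[of 1] j(2) by auto
  have ev: "\<forall>\<^sub>F t in cofinite. \<phi> (one_param v t) \<in> ?W"
    using one_param_eventually_open[OF fan v Vo V1] by (auto elim: eventually_mono)
  obtain R where R: "\<forall>\<^sub>F t in cofinite. \<phi> (one_param v t) = coord_line (\<lambda>i. poly (R i) t)" "\<forall>i>m. R i = 0" "\<exists>i\<le>m. poly (R i) 0 \<noteq> 0"
  proof (rule curve_normal_form[OF j(1), of "\<lambda>t. \<phi> (one_param v t)"])
    show "\<forall>\<^sub>F t in cofinite. \<phi> (one_param v t) \<in> proj_chart m j" using ev by (auto elim: eventually_mono)
    fix i assume "i \<le> m"
    then have "proj_ratio i j \<in> proj_algebra m j" by (auto simp: proj_algebra_def intro: algebra_gen.gen)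
    then have "regular_on ?Bt ?W (proj_ratio i j)" using zariski_open_chart(2)[OF Wj one] by blast
    then have "regular_on ?At ?V (proj_ratio i j \<circ> \<phi>)" using \<phi> Wo unfolding morphism_def by blast
    from one_param_eventually_regular[OF fan v Vo V1 this]
    show "\<exists>P Q. Q \<noteq> 0 \<and> (\<forall>\<^sub>F t in cofinite. proj_ratio i j (\<phi> (one_param v t)) * poly Q t = poly P t)" by simp
  qed
  define \<gamma> where "\<gamma> t = coord_line (\<lambda>i. poly (R i) t)" for t
  have R0: "\<forall>i>m. poly (R i) t = 0" for t using R(2) by simp
  have \<gamma>chart: "\<gamma> t \<in> proj_chart m i \<longleftrightarrow> poly (R i) t \<noteq> 0" for t i
    using line_in_proj_chart[OF R0[of t], of i] coord_line_nonzero_iff[of "\<lambda>i. poly (R i) t" i]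
    unfolding \<gamma>_def by (auto simp: proj_chart_def)
  have \<gamma>ev: "\<forall>\<^sub>F t in cofinite. \<phi> (one_param v t) = \<gamma> t \<and> \<gamma> t \<in> Z \<and> \<psi> (\<gamma> t) = one_param v t"
    using R(1) ev eventually_neq_cofinite[of "0::'k"]
  proof eventually_elim
    case (elim t)
    then show ?case using inv(1) lam[of t] by (auto simp: \<gamma>_def[symmetric])
  qed
  have alg: "\<exists>P N. \<forall>t. poly (R i) t \<noteq> 0 \<longrightarrow> q (\<gamma> t) = poly P t / poly (R i) t ^ N" if "q \<in> proj_algebra m i" for q i
    unfolding \<gamma>_def using proj_algebra_polynomial_curve[OF that] .
  \<comment> \<open>\<open>Z\<close> is closed and contains \<open>\<gamma> t\<close> for almost all \<open>t\<close>, so it contains the limit\<close>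
  have z: "\<gamma> 0 \<in> pts ?Bt"
  proof (rule ccontr)
    assume nz: "\<gamma> 0 \<notin> pts ?Bt"
    have "\<gamma> 0 \<in> pts (proj_space m)" using R(3) \<gamma>chart by (auto simp: pts_def proj_space_eq)
    then have "\<gamma> 0 \<in> pts (proj_space m) - Z" using nz ptsB by blast
    then obtain i q where q: "i \<le> m" "q \<in> proj_algebra m i" "\<gamma> 0 \<in> proj_chart m i" "q (\<gamma> 0) \<noteq> 0"
       "{x\<in>proj_chart m i. q x \<noteq> 0} \<subseteq> pts (proj_space m) - Z"
      using Z(1) unfolding zariski_closed_def zariski_open_def proj_space_eq by fastforce
    obtain P N where P: "\<forall>t. poly (R i) t \<noteq> 0 \<longrightarrow> q (\<gamma> t) = poly P t / poly (R i) t ^ N" using alg[OF q(2)] by blast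
    have Ri: "poly (R i) 0 \<noteq> 0" using q(3) \<gamma>chart by blast
    then have "P \<noteq> 0" "R i \<noteq> 0" using P q(4) by auto
    from this[THEN eventually_poly_nonzero] have "\<forall>\<^sub>F t in (cofinite :: 'k filter). False"
      using \<gamma>ev
    proof eventually_elim
      case (elim t)
      then have "q (\<gamma> t) \<noteq> 0" "\<gamma> t \<in> proj_chart m i" using P \<gamma>chart by auto
      then show ?case using q(5) elim by blast
    qed
    then show False using cofinite_alg_closed_neq_bot[where 'k='k] by (simp only: eventually_False)
  qed
  then have "\<psi> (\<gamma> 0) \<in> pts ?At" using \<psi> by (auto simp: morphism_def)
  then obtain \<sigma> where \<sigma>: "\<sigma> \<in> \<Sigma>" "\<psi> (\<gamma> 0) \<in> toric_open \<sigma>" by (auto simp: pts_def toric_variety_eq)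
  have ch: "(toric_open \<sigma>, toric_algebra \<sigma>) \<in> ?At" using \<sigma>(1) by (auto simp: toric_variety_eq)
  have onet: "(\<lambda>_. 1) \<in> toric_algebra \<sigma>" by (simp add: toric_algebra_def algebra_gen_one)
  have "0 \<le> u \<bullet> v" if u: "u \<in> dual_cone \<sigma> \<inter> int_lattice" for u
  proof (rule ccontr)
    assume "\<not> 0 \<le> u \<bullet> v"
    then have k: "\<lfloor>u \<bullet> v\<rfloor> < 0" by linarith
    have "character u \<in> toric_algebra \<sigma>" using u by (auto simp: toric_algebra_def intro: algebra_gen.gen)
    then have "regular_on ?At (toric_open \<sigma>) (character u)" using zariski_open_chart(2)[OF ch onet] by blast
    then have reg: "regular_on ?Bt (pts ?Bt \<inter> \<psi> -` toric_open \<sigma>) (character u \<circ> \<psi>)"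
      using \<psi> zariski_open_chart(1)[OF ch onet] unfolding morphism_def by blast
    have "\<gamma> 0 \<in> pts ?Bt \<inter> \<psi> -` toric_open \<sigma>" using z \<sigma>(2) by auto
    then obtain U A p q where UA: "(U, A) \<in> ?Bt" "\<gamma> 0 \<in> U" "p \<in> A" "q \<in> A" "q (\<gamma> 0) \<noteq> 0"
      "\<forall>x\<in>U \<inter> (pts ?Bt \<inter> \<psi> -` toric_open \<sigma>). q x \<noteq> 0 \<longrightarrow> (character u \<circ> \<psi>) x = p x / q x"
      using reg unfolding regular_on_def by fastforce
    then obtain i where i: "i \<le> m" "U = proj_chart m i \<inter> Z" "A = proj_algebra m i" by (auto simp: Bt)
    obtain P N where P: "\<forall>t. poly (R i) t \<noteq> 0 \<longrightarrow> p (\<gamma> t) = poly P t / poly (R i) t ^ N" using alg UA(3) i(3) by blast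
    obtain Q M where Q: "\<forall>t. poly (R i) t \<noteq> 0 \<longrightarrow> q (\<gamma> t) = poly Q t / poly (R i) t ^ M" using alg UA(4) i(3) by blast
    have Ri: "poly (R i) 0 \<noteq> 0" using UA(2) i \<gamma>chart by blast
    have Q0: "poly Q 0 \<noteq> 0" using Q Ri UA(5) by auto
    have "Q \<noteq> 0" "R i \<noteq> 0" using Q0 Ri by auto
    let ?n = "nat (- \<lfloor>u \<bullet> v\<rfloor>)"
    have "\<forall>\<^sub>F t in cofinite. poly (Q * R i ^ N) t = poly (monom 1 ?n * P * R i ^ M) t"
      using eventually_poly_nonzero[OF \<open>Q \<noteq> 0\<close>] eventually_poly_nonzero[OF \<open>R i \<noteq> 0\<close>] \<gamma>ev eventually_neq_cofinite[of "0::'k"]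
    proof eventually_elim
      case (elim t)
      have "q (\<gamma> t) \<noteq> 0" "\<gamma> t \<in> U" using Q \<gamma>chart elim i by auto
      moreover have "\<gamma> t \<in> pts ?Bt" using \<open>\<gamma> t \<in> U\<close> UA(1) by (auto simp: pts_def)
      moreover have "\<psi> (\<gamma> t) \<in> toric_open \<sigma>" using elim one_param_toric_open[OF rc[OF \<sigma>(1)] v, of t] by simp
      ultimately have "character u (one_param v t) = p (\<gamma> t) / q (\<gamma> t)" using UA(6) elim by force
      moreover have "character u (one_param v t) = inverse (t ^ ?n)"
        using u k by (simp add: character_one_param power_int_def power_inverse)
      ultimately show ?case using P Q elim by (simp add: field_simps poly_monom)
    qed
    then have "Q * R i ^ N = monom 1 ?n * P * R i ^ M" by (rule poly_eqI_cofinite)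
    then have "poly (Q * R i ^ N) 0 = poly (monom 1 ?n * P * R i ^ M) 0" by simp
    then show False using Q0 Ri k by (simp add: poly_monom zero_power)
  qed
  then show ?thesis using \<sigma>(1) by blast
qed

text \<open>
  By the duality of a rational cone and its dual semigroup, the limit cone contains \<open>v\<close>. So the support
  of the fan contains all lattice vectors, hence all rational ones, and it is closed.
\<close>

theorem projective_imp_complete:
  fixes \<Sigma> :: "(real^'n::finite) set set"
  assumes fan: "fan \<Sigma>" and proj: "projective (toric_variety \<Sigma> :: (('n, 'k::alg_closed_field) toric_point, 'k) atlas)"
  shows "\<Union>\<Sigma> = UNIV"
proof -
  have rc: "rational_cone \<sigma>" if "\<sigma> \<in> \<Sigma>" for \<sigma> using fan that by (auto simp: fan_def)
  have int: "v \<in> \<Union>\<Sigma>" if v: "v \<in> int_lattice" for v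
  proof -
    obtain \<sigma> where \<sigma>: "\<sigma> \<in> \<Sigma>" "\<forall>u\<in>dual_cone \<sigma> \<inter> int_lattice. 0 \<le> u \<bullet> v"
      using one_param_limit_in_chart[OF fan proj v] by blast
    have "v \<in> \<sigma>"
    proof (rule ccontr)
      assume "v \<notin> \<sigma>"
      then obtain u where "u \<in> dual_cone \<sigma>" "u \<in> int_lattice" "u \<bullet> v < 0"
        by (rule rational_cone_separation[OF rc[OF \<sigma>(1)]])
      then show False using \<sigma>(2) by (meson IntI not_le)
    qed
    then show ?thesis using \<sigma>(1) by blast
  qed
  have "v \<in> \<Union>\<Sigma>" if v: "v \<in> rat_vectors" for v
  proof -
    obtain m :: nat where m: "m > 0" "real m *\<^sub>R v \<in> int_lattice" using clear_denominators[OF v] .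
    then obtain \<sigma> where \<sigma>: "\<sigma> \<in> \<Sigma>" "real m *\<^sub>R v \<in> \<sigma>" using int by blast
    have "(1 / real m) *\<^sub>R (real m *\<^sub>R v) \<in> \<sigma>"
      by (rule convex_cone_scaleR[OF rational_cone_convex_cone[OF rc[OF \<sigma>(1)]] _ \<sigma>(2)]) simp
    then show ?thesis using \<sigma>(1) m(1) by auto
  qed
  then have "rat_vectors \<subseteq> \<Union>\<Sigma>" by blast
  moreover have "closed (\<Union>\<Sigma>)" using fan rc rational_cone_polyhedron polyhedron_imp_closed
    by (intro closed_Union) (auto simp: fan_def)
  ultimately have "closure rat_vectors \<subseteq> \<Union>\<Sigma>" by (rule closure_minimal)
  then show ?thesis by (auto simp: closure_rat_vectors)
qed

section \<open>Orders of vanishing on an affine line\<close>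

text \<open>
  The only chart of the atlas around the point \<open>pt 0\<close> is an affine line: it is parametrized by \<open>pt\<close>,
  and the functions of the chart restrict to exactly the polynomials in the parameter.
\<close>

locale line_chart =
  fixes Bt :: "('p, 'k::alg_closed_field) atlas" and pt :: "'k \<Rightarrow> 'p" and A :: "('p \<Rightarrow> 'k) set"
  assumes chart: "(range pt, A) \<in> Bt" and inj_pt: "inj pt"
    and polynomial: "f \<in> A \<Longrightarrow> \<exists>P. \<forall>s. f (pt s) = poly P s"
    and polynomial_ex: "\<exists>f\<in>A. \<forall>s. f (pt s) = poly P s"
    and only_chart: "(U', A') \<in> Bt \<Longrightarrow> pt 0 \<in> U' \<Longrightarrow> U' = range pt \<and> A' = A"
begin

lemma open_principal:
  assumes "zariski_open Bt W" "pt 0 \<in> W"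
  shows "\<exists>Q. poly Q 0 \<noteq> 0 \<and> (\<forall>s. poly Q s \<noteq> 0 \<longrightarrow> pt s \<in> W)"
proof -
  obtain U' A' q where q: "(U', A') \<in> Bt" "pt 0 \<in> U'" "q \<in> A'" "q (pt 0) \<noteq> 0" "{z\<in>U'. q z \<noteq> 0} \<subseteq> W"
    using assms unfolding zariski_open_def by fastforce
  then have U': "U' = range pt" "A' = A" using only_chart by auto
  then obtain Q where "\<forall>s. q (pt s) = poly Q s" using polynomial q(3) by blast
  then show ?thesis using q(4,5) U' by (intro exI[of _ Q]) auto
qed

lemma regular_quotient:
  assumes "zariski_open Bt W" "pt 0 \<in> W" "regular_on Bt W f"
  shows "\<exists>P Q. poly Q 0 \<noteq> 0 \<and> (\<forall>s. poly Q s \<noteq> 0 \<longrightarrow> pt s \<in> W \<and> f (pt s) = poly P s / poly Q s)"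
proof -
  obtain U' A' p q where q: "(U', A') \<in> Bt" "pt 0 \<in> U'" "p \<in> A'" "q \<in> A'" "q (pt 0) \<noteq> 0"
    "\<forall>z\<in>U' \<inter> W. q z \<noteq> 0 \<longrightarrow> f z = p z / q z"
    using assms(2,3) unfolding regular_on_def by fastforce
  then have U': "U' = range pt" "A' = A" using only_chart by auto
  obtain P where P: "\<forall>s. p (pt s) = poly P s" using polynomial q(3) U' by blast
  obtain Q where Q: "\<forall>s. q (pt s) = poly Q s" using polynomial q(4) U' by blast
  obtain Q0 where Q0: "poly Q0 0 \<noteq> 0" "\<forall>s. poly Q0 s \<noteq> 0 \<longrightarrow> pt s \<in> W" using open_principal[OF assms(1,2)] by blast
  show ?thesis
    using q(5,6) P Q Q0 U' by (intro exI[of _ "P * Q0"] exI[of _ "Q * Q0"]) auto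
qed

lemma principal_open:
  assumes "poly Q 0 \<noteq> 0"
  shows "zariski_open Bt {pt s | s. poly Q s \<noteq> 0}"
    "(\<And>s. poly Q s \<noteq> 0 \<Longrightarrow> f (pt s) = poly P s / poly Q s) \<Longrightarrow> regular_on Bt {pt s | s. poly Q s \<noteq> 0} f"
proof -
  obtain q where q: "q \<in> A" "\<forall>s. q (pt s) = poly Q s" using polynomial_ex by blast
  show "zariski_open Bt {pt s | s. poly Q s \<noteq> 0}"
    unfolding zariski_open_def using q by (intro ballI bexI[OF _ chart]) (auto intro!: bexI[of _ q])
  obtain p where p: "p \<in> A" "\<forall>s. p (pt s) = poly P s" using polynomial_ex by blast
  assume f: "\<And>s. poly Q s \<noteq> 0 \<Longrightarrow> f (pt s) = poly P s / poly Q s"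
  show "regular_on Bt {pt s | s. poly Q s \<noteq> 0} f"
    unfolding regular_on_def
  proof
    fix x assume "x \<in> {pt s | s. poly Q s \<noteq> 0}"
    then obtain s where s: "x = pt s" "poly Q s \<noteq> 0" by auto
    have "\<forall>z\<in>range pt \<inter> {pt s | s. poly Q s \<noteq> 0}. q z \<noteq> 0 \<longrightarrow> f z = p z / q z"
      using f p(2) q(2) by force
    then have "\<exists>p\<in>A. \<exists>q\<in>A. q x \<noteq> 0 \<and> (\<forall>z\<in>range pt \<inter> {pt s |s. poly Q s \<noteq> 0}. q z \<noteq> 0 \<longrightarrow> f z = p z / q z)"
      using p(1) q s by (intro bexI[of _ p] bexI[of _ q]) auto
    then show "\<exists>(U, A)\<in>Bt. x \<in> U \<and> (\<exists>p\<in>A. \<exists>q\<in>A. q x \<noteq> 0 \<and>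
        (\<forall>z\<in>U \<inter> {pt s |s. poly Q s \<noteq> 0}. q z \<noteq> 0 \<longrightarrow> f z = p z / q z))"
      using s(1) by (intro bexI[OF _ chart]) simp
  qed
qed

lemma whole_line: "zariski_open Bt (range pt)" "(\<And>s. f (pt s) = poly P s) \<Longrightarrow> regular_on Bt (range pt) f"
proof -
  have "{pt s | s. poly 1 s \<noteq> (0::'k)} = range pt" by auto
  then show "zariski_open Bt (range pt)" "(\<And>s. f (pt s) = poly P s) \<Longrightarrow> regular_on Bt (range pt) f"
    using principal_open(1)[of 1] principal_open(2)[of 1 f P] by simp_all
qed

lemma coordinate_uniformizer:
  assumes t: "\<And>s. t (pt s) = s"
  shows "uniformizer Bt (pt 0) t"
  unfolding uniformizer_def
proof (intro conjI allI impI)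
  show "\<exists>W. zariski_open Bt W \<and> pt 0 \<in> W \<and> regular_on Bt W t"
    using whole_line(1) whole_line(2)[of t "[:0, 1:]"] t by (intro exI[of _ "range pt"]) auto
  show "t (pt 0) = 0" by (rule t)
next
  fix W g assume W: "zariski_open Bt W \<and> pt 0 \<in> W \<and> regular_on Bt W g \<and> g (pt 0) = 0"
  then obtain P Q where PQ: "poly Q 0 \<noteq> 0" "\<forall>s. poly Q s \<noteq> 0 \<longrightarrow> pt s \<in> W \<and> g (pt s) = poly P s / poly Q s"
    using regular_quotient by blast
  then have "poly P 0 = 0" using W by auto
  then have "[:- 0, 1:] dvd P" using poly_eq_0_iff_dvd by blast
  then obtain P1 where P1: "P = [:0, 1:] * P1" by (auto elim: dvdE)
  define h where "h z = poly P1 (inv pt z) / poly Q (inv pt z)" for z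
  have h: "h (pt s) = poly P1 s / poly Q s" for s by (simp add: h_def inv_f_f[OF inj_pt])
  show "\<exists>W' h. zariski_open Bt W' \<and> pt 0 \<in> W' \<and> W' \<subseteq> W \<and> regular_on Bt W' h \<and> (\<forall>z\<in>W'. g z = t z * h z)"
    using principal_open(1)[OF PQ(1)] principal_open(2)[OF PQ(1), of h P1] h PQ P1 t
    by (intro exI[of _ "{pt s | s. poly Q s \<noteq> 0}"] exI[of _ h]) auto
qed

lemma coordinate_power_has_order:
  assumes f: "\<And>s. s \<noteq> 0 \<Longrightarrow> f (pt s) = s powi k"
  shows "has_order Bt (pt 0) f k"
proof -
  define t where "t = inv pt"
  have t: "t (pt s) = s" for s by (simp add: t_def inv_f_f[OF inj_pt])
  show ?thesis unfolding has_order_def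
  proof (rule exI[of _ t], rule exI[of _ "\<lambda>_. 1"], rule exI[of _ "range pt"], intro conjI)
    show "regular_on Bt (range pt) (\<lambda>_. 1)" by (rule whole_line(2)[of _ 1]) simp
    show "\<forall>z\<in>range pt - {pt 0}. t z \<noteq> 0 \<and> f z = t z powi k * 1"
    proof
      fix z assume "z \<in> range pt - {pt 0}"
      then obtain s where "z = pt s" "s \<noteq> 0" by auto
      then show "t z \<noteq> 0 \<and> f z = t z powi k * 1" using f t by simp
    qed
  qed (use coordinate_uniformizer[of t] t whole_line(1) in auto)
qed

text \<open>
  Any uniformizer \<open>t\<close> is the coordinate times a unit, because the coordinate is a multiple of \<open>t\<close> and
  \<open>t\<close> vanishes at the origin. Comparing two powers that differ by a unit as polynomials
  and evaluating at the origin shows that the exponents agree.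
\<close>

lemma has_order_unique:
  assumes f: "\<And>s. s \<noteq> 0 \<Longrightarrow> f (pt s) = s powi k" and o: "has_order Bt (pt 0) f k'"
  shows "k' = k"
proof -
  obtain t h W where t: "uniformizer Bt (pt 0) t" and W: "zariski_open Bt W" "pt 0 \<in> W"
    and h: "regular_on Bt W h" "\<forall>z\<in>W. h z \<noteq> 0" and eq: "\<forall>z\<in>W - {pt 0}. t z \<noteq> 0 \<and> f z = t z powi k' * h z"
    using o unfolding has_order_def by blast
  obtain Wt where Wt: "zariski_open Bt Wt" "pt 0 \<in> Wt" "regular_on Bt Wt t" using t unfolding uniformizer_def by blast
  obtain P Q where PQ: "poly Q 0 \<noteq> 0" "\<forall>s. poly Q s \<noteq> 0 \<longrightarrow> t (pt s) = poly P s / poly Q s"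
    using regular_quotient[OF Wt] by blast
  have "t (pt 0) = 0" using t unfolding uniformizer_def by blast
  then have "poly P 0 = 0" using PQ by auto
  then have "[:- 0, 1:] dvd P" using poly_eq_0_iff_dvd by blast
  then obtain P1 where P1: "P = [:0, 1:] * P1" by (auto elim: dvdE)
  define t0 where "t0 = inv pt"
  have t0: "t0 (pt s) = s" for s by (simp add: t0_def inv_f_f[OF inj_pt])
  have "regular_on Bt (range pt) t0" by (rule whole_line(2)[of t0 "[:0, 1:]"]) (simp add: t0)
  then obtain W1 h1 where W1: "zariski_open Bt W1" "pt 0 \<in> W1" "regular_on Bt W1 h1" "\<forall>z\<in>W1. t0 z = t z * h1 z"
    using t whole_line(1) t0[of 0] unfolding uniformizer_def by blast
  obtain H1 Q1 where H1: "poly Q1 0 \<noteq> 0" "\<forall>s. poly Q1 s \<noteq> 0 \<longrightarrow> pt s \<in> W1 \<and> h1 (pt s) = poly H1 s / poly Q1 s"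
    using regular_quotient[OF W1(1-3)] by blast
  obtain H Q2 where H: "poly Q2 0 \<noteq> 0" "\<forall>s. poly Q2 s \<noteq> 0 \<longrightarrow> pt s \<in> W \<and> h (pt s) = poly H s / poly Q2 s"
    using regular_quotient[OF W h(1)] by blast
  have H0: "poly H 0 \<noteq> 0" using H h(2) W(2) by auto
  have nz: "Q \<noteq> 0" "Q1 \<noteq> 0" "Q2 \<noteq> 0" using PQ H1 H by auto
  note ev = eventually_poly_nonzero[OF nz(1)] eventually_poly_nonzero[OF nz(2)] eventually_poly_nonzero[OF nz(3)]
    eventually_neq_cofinite[of "0::'k"]
  have "\<forall>\<^sub>F s in cofinite. poly (Q * Q1) s = poly (P1 * H1) s"
    using ev
  proof eventually_elim
    case (elim s)
    then have "s = t (pt s) * h1 (pt s)" using W1(4) H1(2) t0[of s] by metis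
    also have "\<dots> = (s * poly P1 s / poly Q s) * (poly H1 s / poly Q1 s)" using PQ(2) H1(2) elim P1 by simp
    finally have "s * (poly Q s * poly Q1 s) = s * (poly P1 s * poly H1 s)" using elim by (simp add: field_simps)
    then show ?case using elim by simp
  qed
  then have "Q * Q1 = P1 * H1" by (rule poly_eqI_cofinite)
  then have "poly (P1 * H1) 0 = poly Q 0 * poly Q1 0" by (metis poly_mult)
  then have P10: "poly P1 0 \<noteq> 0" using PQ H1 by auto
  obtain A1 B1 where AB: "poly A1 0 \<noteq> 0" "poly B1 0 \<noteq> 0"
    "\<And>s. poly Q s \<noteq> 0 \<Longrightarrow> poly P1 s \<noteq> 0 \<Longrightarrow> (poly P1 s / poly Q s) powi k' = poly A1 s / poly B1 s"
  proof (cases "k' \<ge> 0")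
    case True
    then show ?thesis using that[of "P1 ^ nat k'" "Q ^ nat k'"] P10 PQ by (auto simp: power_int_def power_divide)
  next
    case False
    then show ?thesis using that[of "Q ^ nat (-k')" "P1 ^ nat (-k')"] P10 PQ
      by (auto simp: power_int_def power_divide)
  qed
  have "P1 \<noteq> 0" "A1 \<noteq> 0" "B1 \<noteq> 0" using P10 AB by auto
  note ev' = ev eventually_poly_nonzero[OF this(1)] eventually_poly_nonzero[OF this(2)] eventually_poly_nonzero[OF this(3)]
  have key: "\<forall>\<^sub>F s in cofinite. s powi (k - k') * poly (B1 * Q2) s = poly (A1 * H) s"
    using ev'
  proof eventually_elim
    case (elim s)
    have "pt s \<in> W - {pt 0}" using H(2) elim inj_pt by (auto simp: inj_eq)
    then have "s powi k = t (pt s) powi k' * h (pt s)" using f[of s] eq elim by auto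
    also have "t (pt s) = s * (poly P1 s / poly Q s)" using PQ(2) elim P1 by simp
    also have "(s * (poly P1 s / poly Q s)) powi k' = s powi k' * (poly A1 s / poly B1 s)"
      using AB(3)[of s] elim by (simp add: power_int_mult_distrib del: times_divide_eq_right)
    also have "h (pt s) = poly H s / poly Q2 s" using H(2) elim by simp
    finally have "s powi k / s powi k' = (poly A1 s / poly B1 s) * (poly H s / poly Q2 s)"
      using elim by (simp add: field_simps)
    then have "s powi (k - k') = (poly A1 s / poly B1 s) * (poly H s / poly Q2 s)"
      using elim by (simp add: power_int_diff)
    then show ?case using elim by (simp add: field_simps)
  qed
  consider "k = k'" | "k > k'" | "k < k'" by linarith
  then show ?thesis
  proof cases
    case 2
    have "\<forall>\<^sub>F s in cofinite. poly (monom 1 (nat (k - k')) * (B1 * Q2)) s = poly (A1 * H) s"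
      using key 2 by (auto elim!: eventually_mono simp: power_int_def poly_monom)
    then have "monom 1 (nat (k - k')) * (B1 * Q2) = A1 * H" by (rule poly_eqI_cofinite)
    then have "poly (A1 * H) 0 = 0 ^ nat (k - k') * poly (B1 * Q2) 0" by (metis poly_monom poly_mult mult_1)
    then show ?thesis using AB H0 2 by (simp add: zero_power)
  next
    case 3
    have "\<forall>\<^sub>F s in cofinite. poly (B1 * Q2) s = poly (monom 1 (nat (k' - k)) * (A1 * H)) s"
      using key ev(4)
    proof eventually_elim
      case (elim s)
      have "s ^ nat (k' - k) * s powi (k - k') = 1" using 3 elim by (simp add: power_int_def power_inverse)
      then have "poly (B1 * Q2) s = s ^ nat (k' - k) * (s powi (k - k') * poly (B1 * Q2) s)"
        by (simp only: mult.assoc[symmetric] mult_1)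
      then show ?case unfolding elim(1) by (simp add: poly_monom mult.assoc)
    qed
    then have "B1 * Q2 = monom 1 (nat (k' - k)) * (A1 * H)" by (rule poly_eqI_cofinite)
    then have "poly (B1 * Q2) 0 = 0 ^ nat (k' - k) * poly (A1 * H) 0" by (metis poly_monom poly_mult mult_1)
    then show ?thesis using AB H 3 by (simp add: zero_power)
  qed simp
qed

end

section \<open>Torus orbits\<close>

lemma perp_lattice_closed:
  "0 \<in> perp_lattice \<tau>" "u \<in> perp_lattice \<tau> \<Longrightarrow> u' \<in> perp_lattice \<tau> \<Longrightarrow> u + u' \<in> perp_lattice \<tau>"
  "u \<in> perp_lattice \<tau> \<Longrightarrow> real_of_int k *\<^sub>R u \<in> perp_lattice \<tau>"
  by (auto simp: perp_lattice_def int_lattice_add int_lattice_scale inner_add_left)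

lemma orbit_hom:
  assumes "(\<tau>, h) \<in> orbit \<tau>"
  shows "u \<in> perp_lattice \<tau> \<Longrightarrow> h u \<noteq> 0"
    "u \<in> perp_lattice \<tau> \<Longrightarrow> u' \<in> perp_lattice \<tau> \<Longrightarrow> h (u + u') = h u * h u'"
    "u \<notin> perp_lattice \<tau> \<Longrightarrow> h u = 0" "h 0 = 1"
proof -
  show *: "u \<in> perp_lattice \<tau> \<Longrightarrow> h u \<noteq> 0"
    "u \<in> perp_lattice \<tau> \<Longrightarrow> u' \<in> perp_lattice \<tau> \<Longrightarrow> h (u + u') = h u * h u'"
    "u \<notin> perp_lattice \<tau> \<Longrightarrow> h u = 0" for u u' using assms by (auto simp: orbit_def)
  have "h 0 * h 0 = h 0 * 1" using *(2)[OF perp_lattice_closed(1) perp_lattice_closed(1)] by simp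
  then show "h 0 = 1" using *(1)[of 0] perp_lattice_closed(1) by (metis mult_cancel_left)
qed

lemma orbit_hom_power:
  assumes "(\<tau>, h) \<in> orbit \<tau>" "u \<in> perp_lattice \<tau>"
  shows "h (real_of_int k *\<^sub>R u) = h u powi k"
proof -
  note H = orbit_hom[OF assms(1)]
  have nat: "h (real n *\<^sub>R u) = h u ^ n" for n :: nat
  proof (induction n)
    case (Suc n)
    have "real n *\<^sub>R u \<in> perp_lattice \<tau>" using perp_lattice_closed(3)[OF assms(2), of "int n"] by simp
    then show ?case using H(2)[OF assms(2)] Suc by (simp add: scaleR_left_distrib)
  qed (simp add: H)
  show ?thesis
  proof (cases "k \<ge> 0")
    case True
    then show ?thesis using nat[of "nat k"] by (simp add: power_int_def)
  next
    case False
    have "h (real_of_int k *\<^sub>R u + real_of_int (-k) *\<^sub>R u) = h (real_of_int k *\<^sub>R u) * h (real_of_int (-k) *\<^sub>R u)"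
      by (intro H(2) perp_lattice_closed(3) assms)
    then have "h (real_of_int k *\<^sub>R u) * h u ^ nat (- k) = 1"
      using nat[of "nat (-k)"] False H(4) by simp
    then show ?thesis using False by (simp add: power_int_def power_inverse inverse_unique mult.commute)
  qed
qed

lemma orbit_hom_sum:
  assumes "(\<tau>, h) \<in> orbit \<tau>" "\<And>i. i \<in> J \<Longrightarrow> f i \<in> perp_lattice \<tau>"
  shows "h (\<Sum>i\<in>J. f i) = (\<Prod>i\<in>J. h (f i)) \<and> (\<Sum>i\<in>J. f i) \<in> perp_lattice \<tau>"
  using assms(2)
proof (induction J rule: infinite_finite_induct)
  case (insert i J)
  then have "f i \<in> perp_lattice \<tau>" "h (\<Sum>i\<in>J. f i) = (\<Prod>i\<in>J. h (f i))" "(\<Sum>i\<in>J. f i) \<in> perp_lattice \<tau>" by auto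
  then show ?case using insert.hyps orbit_hom(2)[OF assms(1)] by (simp add: perp_lattice_closed(2))
qed (use orbit_hom(4)[OF assms(1)] perp_lattice_closed(1) in auto)

lemma orbitI:
  assumes "\<And>u. u \<in> perp_lattice \<tau> \<Longrightarrow> h u \<noteq> 0"
    "\<And>u u'. u \<in> perp_lattice \<tau> \<Longrightarrow> u' \<in> perp_lattice \<tau> \<Longrightarrow> h (u + u') = h u * h u'"
  shows "(\<tau>, \<lambda>u. if u \<in> perp_lattice \<tau> then h u else 0) \<in> orbit \<tau>"
  using assms by (auto simp: orbit_def perp_lattice_closed(2))

lemma orbit_disjoint: "x \<in> orbit \<tau> \<Longrightarrow> fst x = \<tau>"
  by (auto simp: orbit_def)

lemma mem_orbit_closure: "x \<in> orbit_closure \<Sigma> \<tau> \<longleftrightarrow> fst x \<in> \<Sigma> \<and> cone_face \<tau> (fst x) \<and> x \<in> orbit (fst x)"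
  using orbit_disjoint by (fastforce simp: orbit_closure_def)

lemma mem_toric_open: "x \<in> toric_open \<sigma> \<longleftrightarrow> cone_face (fst x) \<sigma> \<and> x \<in> orbit (fst x)"
  using orbit_disjoint by (fastforce simp: toric_open_def)

section \<open>Invariant curves and intersection numbers\<close>

definition fixed_point :: "(real^'n::finite) set \<Rightarrow> ('n, 'k::field) toric_point" where
  "fixed_point \<sigma> = (\<sigma>, \<lambda>u. if u = 0 then 1 else 0)"

lemma perp_lattice_full:
  assumes "rational_cone \<sigma>" "dim \<sigma> = CARD('n)"
  shows "perp_lattice (\<sigma> :: (real^'n::finite) set) = {0}"
  using full_cone_eq_zero[OF assms] rays_of_generator(2)[OF assms(1)] by (auto simp: perp_lattice_def)

lemma orbit_full:
  assumes "rational_cone \<sigma>" "dim \<sigma> = CARD('n)"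
  shows "orbit (\<sigma> :: (real^'n::finite) set) = {fixed_point \<sigma> :: ('n, 'k::field) toric_point}"
proof
  show "{fixed_point \<sigma> :: ('n, 'k) toric_point} \<subseteq> orbit \<sigma>"
    by (auto simp: orbit_def fixed_point_def perp_lattice_full[OF assms])
  show "orbit \<sigma> \<subseteq> {fixed_point \<sigma> :: ('n, 'k) toric_point}"
  proof
    fix x :: "('n, 'k) toric_point" assume x: "x \<in> orbit \<sigma>"
    then obtain h where h: "x = (\<sigma>, h)" by (auto simp: orbit_def)
    note H = orbit_hom[OF x[unfolded h]]
    have "h = (\<lambda>u. if u = 0 then 1 else 0)"
      using H(3,4) by (auto simp: perp_lattice_full[OF assms] fun_eq_iff)
    then show "x \<in> {fixed_point \<sigma>}" by (simp add: h fixed_point_def)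
  qed
qed

text \<open>
  The chart at $\sigma$ of the invariant curve of the facet with normal \<open>g\<close>, parametrized by the value
  of the character \<open>g\<close>. A character of the facet lattice is \<open>k\<close> times \<open>g\<close> with
  $k = \langle u, g\rangle / \langle g, g\rangle$.
\<close>

definition curve_point :: "(real^'n::finite) set \<Rightarrow> real^'n \<Rightarrow> 'k::field \<Rightarrow> ('n, 'k) toric_point" where
  "curve_point \<sigma> g s = (if s = 0 then fixed_point \<sigma> else
     (\<sigma> \<inter> {x. g \<bullet> x = 0}, \<lambda>u. if u \<in> perp_lattice (\<sigma> \<inter> {x. g \<bullet> x = 0}) then s powi \<lfloor>(u \<bullet> g) / (g \<bullet> g)\<rfloor> else 0))"

lemma perp_lattice_facet:
  fixes g :: "real^'n::finite"
  assumes "Suc (dim \<omega>) = CARD('n)" "primitive g" "\<And>x. x \<in> \<omega> \<Longrightarrow> g \<bullet> x = 0"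
  shows "perp_lattice \<omega> = {real_of_int k *\<^sub>R g | k. True}"
proof
  show "perp_lattice \<omega> \<subseteq> {real_of_int k *\<^sub>R g | k. True}"
  proof
    fix u assume u: "u \<in> perp_lattice \<omega>"
    then obtain c where c: "u = c *\<^sub>R g"
      using normal_parallel[OF assms(1) _ assms(3), of u] assms(2) by (auto simp: primitive_def perp_lattice_def)
    then have "c \<in> \<int>" using u assms(2) by (auto simp: primitive_def perp_lattice_def)
    then show "u \<in> {real_of_int k *\<^sub>R g | k. True}" using c by (auto elim: Ints_cases)
  qed
  have "g \<in> perp_lattice \<omega>" using assms by (auto simp: perp_lattice_def primitive_def)
  then show "{real_of_int k *\<^sub>R g | k. True} \<subseteq> perp_lattice \<omega>" using perp_lattice_closed(3) by blast
qed

context complete_fan begin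

context
  fixes \<sigma> g \<omega> and C :: "('n, 'k::alg_closed_field) toric_point set"
  assumes \<sigma>: "\<sigma> \<in> maximal_cones \<Sigma>" and g: "g \<in> facet_normals \<sigma>"
  defines "\<omega> \<equiv> \<sigma> \<inter> {x. g \<bullet> x = 0}" and "C \<equiv> orbit_closure \<Sigma> \<omega>"
begin

lemma curve_facts: "\<sigma> \<in> \<Sigma>" "dim \<sigma> = CARD('n)" "rational_cone \<sigma>" "cone_face \<omega> \<sigma>" "\<omega> \<in> \<Sigma>" "\<omega> \<noteq> \<sigma>"
    "primitive g" "g \<noteq> 0" "perp_lattice \<omega> = {real_of_int k *\<^sub>R g | k. True}"
proof -
  show s: "\<sigma> \<in> \<Sigma>" "dim \<sigma> = CARD('n)" using maximalD[OF \<sigma>] by auto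
  show rc: "rational_cone \<sigma>" using rational[OF s(1)] .
  show f: "cone_face \<omega> \<sigma>" unfolding \<omega>_def by (rule facet_normal_cone_face[OF rc g])
  show "\<omega> \<in> \<Sigma>" using face_in_fan[OF s(1) f] .
  show p: "primitive g" "g \<noteq> 0" using g by (auto simp: facet_normals_def primitive_def)
  have d: "Suc (dim \<omega>) = CARD('n)" using g by (simp add: facet_normals_def \<omega>_def)
  then show "\<omega> \<noteq> \<sigma>" using s(2) by auto
  show "perp_lattice \<omega> = {real_of_int k *\<^sub>R g | k. True}"
    using p by (intro perp_lattice_facet[OF d]) (auto simp: \<omega>_def)
qed

lemma floor_multiple: "\<lfloor>((real_of_int k *\<^sub>R g) \<bullet> g) / (g \<bullet> g)\<rfloor> = k"
  using curve_facts(8) by simp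

lemma curve_point_nonzero: "s \<noteq> 0 \<Longrightarrow> curve_point \<sigma> g s = (\<omega>, \<lambda>u. if u \<in> perp_lattice \<omega> then s powi \<lfloor>(u \<bullet> g) / (g \<bullet> g)\<rfloor> else 0)"
  by (simp add: curve_point_def \<omega>_def)

lemma curve_point_orbit: "s \<noteq> 0 \<Longrightarrow> curve_point \<sigma> g (s :: 'k) \<in> orbit \<omega>"
proof -
  assume s: "s \<noteq> 0"
  have "s powi \<lfloor>((u + u') \<bullet> g) / (g \<bullet> g)\<rfloor> = s powi \<lfloor>(u \<bullet> g) / (g \<bullet> g)\<rfloor> * s powi \<lfloor>(u' \<bullet> g) / (g \<bullet> g)\<rfloor>"
    if uu: "u \<in> perp_lattice \<omega>" "u' \<in> perp_lattice \<omega>" for u u'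
  proof -
    obtain k k' where k: "u = real_of_int k *\<^sub>R g" "u' = real_of_int k' *\<^sub>R g"
      using uu unfolding curve_facts(9) by blast
    have "u + u' = real_of_int (k + k') *\<^sub>R g" using k by (simp add: scaleR_left_distrib)
    then show ?thesis using s k by (simp only: floor_multiple power_int_add simp_thms)
  qed
  then show ?thesis unfolding curve_point_nonzero[OF s] orbit_def using s perp_lattice_closed(2) by auto
qed

lemma character_curve_point:
  "s \<noteq> 0 \<Longrightarrow> character (real_of_int k *\<^sub>R g) (curve_point \<sigma> g s) = (s :: 'k) powi k"
proof -
  assume "s \<noteq> 0"
  moreover have "real_of_int k *\<^sub>R g \<in> perp_lattice \<omega>" unfolding curve_facts(9) by blast
  ultimately show ?thesis using floor_multiple[of k] by (simp add: character_def curve_point_nonzero del: inner_scaleR_left)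
qed

lemma character_curve_point_other:
  "u \<notin> perp_lattice \<omega> \<Longrightarrow> character u (curve_point \<sigma> g s) = 0"
proof (cases "s = 0")
  case True
  assume "u \<notin> perp_lattice \<omega>"
  then have "u \<noteq> 0" using perp_lattice_closed(1)[of \<omega>] by blast
  then show ?thesis using True by (simp add: character_def curve_point_def fixed_point_def)
qed (simp add: character_def curve_point_nonzero)

lemma character_coordinate: "character g (curve_point \<sigma> g s) = (s :: 'k)"
  using character_curve_point[of s 1] curve_facts(8)
  by (cases "s = 0") (auto simp: curve_point_def fixed_point_def character_def)

lemma curve_chart: "toric_open \<sigma> \<inter> C = range (curve_point \<sigma> g :: 'k \<Rightarrow> ('n, 'k) toric_point)"
proof
  have two: "cone_face \<gamma> \<sigma> \<Longrightarrow> cone_face \<omega> \<gamma> \<Longrightarrow> \<gamma> = \<omega> \<or> \<gamma> = \<sigma>" for \<gamma>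
  proof -
    assume f: "cone_face \<gamma> \<sigma>" "cone_face \<omega> \<gamma>"
    have "\<gamma> \<in> \<Sigma>" using face_in_fan[OF curve_facts(1) f(1)] .
    obtain \<tau> where \<tau>: "\<tau> \<in> maximal_cones \<Sigma>" "\<tau> \<noteq> \<sigma>"
      "\<And>\<gamma>. \<gamma> \<in> \<Sigma> \<Longrightarrow> \<omega> \<subseteq> \<gamma> \<Longrightarrow> \<gamma> = \<omega> \<or> \<gamma> = \<sigma> \<or> \<gamma> = \<tau>"
      using facet_neighbour[OF \<sigma> g] unfolding \<omega>_def by metis
    have "\<omega> \<subseteq> \<gamma>" "\<gamma> \<subseteq> \<sigma>" using f by (auto simp: cone_face_def face_of_def)
    then have "\<gamma> \<noteq> \<tau>" using \<tau>(1,2) curve_facts(1) unfolding maximal_cones_def by blast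
    then show ?thesis using \<tau>(3)[OF \<open>\<gamma> \<in> \<Sigma>\<close> \<open>\<omega> \<subseteq> \<gamma>\<close>] by blast
  qed
  show "toric_open \<sigma> \<inter> C \<subseteq> range (curve_point \<sigma> g)"
  proof
    fix x assume x: "x \<in> toric_open \<sigma> \<inter> C"
    then have f: "cone_face (fst x) \<sigma>" "cone_face \<omega> (fst x)" "x \<in> orbit (fst x)" by (auto simp: C_def mem_orbit_closure mem_toric_open)
    show "x \<in> range (curve_point \<sigma> g)"
    proof (cases "fst x = \<sigma>")
      case True
      then have "x = curve_point \<sigma> g 0" using f(3) orbit_full[OF curve_facts(3,2), where 'k='k] by (simp add: curve_point_def)
      then show ?thesis by blast
    next
      case False
      then have "fst x = \<omega>" using two f by blast
      then obtain h where h: "x = (\<omega>, h)" "(\<omega>, h) \<in> orbit \<omega>" using f(3) by (metis prod.collapse)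
      note H = orbit_hom[OF h(2)]
      have gp: "g \<in> perp_lattice \<omega>" unfolding curve_facts(9) by (auto intro: exI[of _ 1])
      have hu: "h u = (if u \<in> perp_lattice \<omega> then h g powi \<lfloor>(u \<bullet> g) / (g \<bullet> g)\<rfloor> else 0)" for u
      proof (cases "u \<in> perp_lattice \<omega>")
        case True
        then obtain k where "u = real_of_int k *\<^sub>R g" using curve_facts(9) by auto
        then show ?thesis using orbit_hom_power[OF h(2) gp, of k] True floor_multiple[of k] by simp
      qed (use H in auto)
      have "curve_point \<sigma> g (h g) = (\<omega>, \<lambda>u. if u \<in> perp_lattice \<omega> then h g powi \<lfloor>(u \<bullet> g) / (g \<bullet> g)\<rfloor> else 0)"
        by (rule curve_point_nonzero[OF H(1)[OF gp]])
      also have "(\<lambda>u. if u \<in> perp_lattice \<omega> then h g powi \<lfloor>(u \<bullet> g) / (g \<bullet> g)\<rfloor> else 0) = h"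
        by (rule ext, rule hu[symmetric])
      finally have "x = curve_point \<sigma> g (h g)" using h(1) by simp
      then show ?thesis by blast
    qed
  qed
  show "range (curve_point \<sigma> g) \<subseteq> toric_open \<sigma> \<inter> C"
  proof
    fix x :: "('n, 'k) toric_point" assume "x \<in> range (curve_point \<sigma> g)"
    then obtain s where s: "x = curve_point \<sigma> g s" by blast
    have "cone_face \<sigma> \<sigma>" "cone_face \<omega> \<omega>"
      using convex_cone[OF curve_facts(1)] convex_cone[OF curve_facts(5)] by (simp_all add: cone_face_iff)
    show "x \<in> toric_open \<sigma> \<inter> C"
    proof (cases "s = 0")
      case True
      then have "x = fixed_point \<sigma>" by (simp add: s curve_point_def)
      then have "x \<in> orbit \<sigma>" "fst x = \<sigma>" using orbit_full[OF curve_facts(3,2), where 'k='k] by (auto simp: fixed_point_def)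
      then show ?thesis using \<open>cone_face \<sigma> \<sigma>\<close> curve_facts(1,4) by (simp add: C_def mem_orbit_closure mem_toric_open)
    next
      case False
      then have "x \<in> orbit \<omega>" "fst x = \<omega>" using curve_point_orbit[OF False] orbit_disjoint[OF curve_point_orbit[OF False]] by (simp_all add: s)
      then show ?thesis using \<open>cone_face \<omega> \<omega>\<close> curve_facts(4,5) by (simp add: C_def mem_orbit_closure mem_toric_open)
    qed
  qed
qed

text \<open>
  On the curve, a character of $\sigma^\vee \cap M$ vanishes unless it is a multiple \<open>k\<close> of \<open>g\<close>, and \<open>k\<close>
  is nonnegative because \<open>g\<close> is. So the functions of the chart are the polynomials in the
  coordinate \<open>g\<close>.
\<close>

lemma curve_line_chart:
  "line_chart (subvariety (toric_variety \<Sigma>) C) (curve_point \<sigma> g) (toric_algebra \<sigma> :: (('n, 'k) toric_point \<Rightarrow> 'k) set)"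
proof
  have Ct: "subvariety (toric_variety \<Sigma>) C = (\<lambda>\<sigma>. (toric_open \<sigma> \<inter> C, toric_algebra \<sigma>)) ` \<Sigma>"
    by (simp add: subvariety_def toric_variety_eq image_image)
  show "(range (curve_point \<sigma> g), toric_algebra \<sigma>) \<in> subvariety (toric_variety \<Sigma>) C"
    unfolding Ct using curve_chart curve_facts(1) by (intro image_eqI[of _ _ \<sigma>]) auto
  show "inj (curve_point \<sigma> g :: 'k \<Rightarrow> _)" by (rule injI) (metis character_coordinate)
  show "U' = range (curve_point \<sigma> g) \<and> A' = toric_algebra \<sigma>"
    if UA: "(U', A') \<in> subvariety (toric_variety \<Sigma>) C" "curve_point \<sigma> g 0 \<in> U'" for U' A'
  proof -
    obtain \<gamma> where \<gamma>: "\<gamma> \<in> \<Sigma>" "U' = toric_open \<gamma> \<inter> C" "A' = toric_algebra \<gamma>" using UA(1) unfolding Ct by blast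
    then have "cone_face \<sigma> \<gamma>" using UA(2) by (simp add: curve_point_def fixed_point_def mem_toric_open)
    then have "\<gamma> = \<sigma>" using \<sigma> \<gamma>(1) unfolding maximal_cones_def cone_face_def face_of_def by blast
    then show ?thesis using \<gamma> curve_chart by simp
  qed
  show "\<exists>P. \<forall>s. f (curve_point \<sigma> g s) = poly P s" if "f \<in> toric_algebra \<sigma>" for f :: "('n, 'k) toric_point \<Rightarrow> 'k"
    using that unfolding toric_algebra_def
  proof induction
    case (const c)
    show ?case by (intro exI[of _ "[:c:]"]) auto
  next
    case (gen f)
    then obtain u where u: "f = character u" "u \<in> dual_cone \<sigma>" "u \<in> int_lattice" by blast
    show ?case
    proof (cases "u \<in> perp_lattice \<omega>")
      case False
      then show ?thesis using character_curve_point_other u(1) by (intro exI[of _ 0]) auto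
    next
      case True
      then obtain k where k: "u = real_of_int k *\<^sub>R g" using curve_facts(9) by auto
      have "k \<ge> 0"
      proof (rule ccontr)
        assume neg: "\<not> k \<ge> 0"
        have "g \<bullet> x = 0" if "x \<in> \<sigma>" for x
        proof -
          have "0 \<le> g \<bullet> x" using g that by (auto simp: facet_normals_def)
          moreover have "0 \<le> real_of_int k * (g \<bullet> x)" using u(2) that k by (auto simp: dual_cone_def)
          ultimately show ?thesis using neg by (auto simp: zero_le_mult_iff)
        qed
        then show False using curve_facts(6) unfolding \<omega>_def by blast
      qed
      have "character u (curve_point \<sigma> g s) = poly (monom 1 (nat k)) s" for s :: 'k
      proof (cases "s = 0")
        case True
        then show ?thesis using k \<open>k \<ge> 0\<close> curve_facts(8)
          by (auto simp: curve_point_def fixed_point_def character_def poly_monom zero_power)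
      next
        case False
        then show ?thesis using k \<open>k \<ge> 0\<close> character_curve_point[OF False, of k] by (simp add: poly_monom power_int_def)
      qed
      then show ?thesis using u(1) by blast
    qed
  next
    case (add f1 f2)
    obtain P where "\<forall>s. f1 (curve_point \<sigma> g s) = poly P s" using add.IH(1) by blast
    moreover obtain Q where "\<forall>s. f2 (curve_point \<sigma> g s) = poly Q s" using add.IH(2) by blast
    ultimately show ?case by (intro exI[of _ "P + Q"]) simp
  next
    case (mult f1 f2)
    obtain P where "\<forall>s. f1 (curve_point \<sigma> g s) = poly P s" using mult.IH(1) by blast
    moreover obtain Q where "\<forall>s. f2 (curve_point \<sigma> g s) = poly Q s" using mult.IH(2) by blast
    ultimately show ?case by (intro exI[of _ "P * Q"]) simp
  qed
  show "\<exists>f\<in>toric_algebra \<sigma>. \<forall>s. f (curve_point \<sigma> g s) = poly P s" for P :: "'k poly"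
  proof (induction P)
    case 0
    show ?case unfolding toric_algebra_def by (intro bexI[OF _ algebra_gen.const[of 0]]) simp
  next
    case (pCons a P)
    then obtain f where f: "f \<in> toric_algebra \<sigma>" "\<forall>s. f (curve_point \<sigma> g s) = poly P s" by blast
    have "g \<in> dual_cone \<sigma> \<inter> int_lattice"
      using g curve_facts(7) by (auto simp: facet_normals_def dual_cone_def primitive_def int_lattice_rat)
    then have "character g \<in> (toric_algebra \<sigma> :: (('n, 'k) toric_point \<Rightarrow> 'k) set)"
      unfolding toric_algebra_def by (intro algebra_gen.gen) blast
    then have "(\<lambda>z. a + character g z * f z) \<in> toric_algebra \<sigma>"
      using algebra_gen.add[OF algebra_gen.const algebra_gen.mult] f(1) unfolding toric_algebra_def by blast
    then show ?case using f(2) character_coordinate by (intro bexI[of _ "\<lambda>z. a + character g z * f z"]) simp_all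
  qed
qed

lemma local_mult_fixed_point:
  assumes E: "local_datum E \<sigma> (real_of_int k *\<^sub>R g)"
  shows "local_mult \<Sigma> E C (fixed_point \<sigma>) = - k"
proof -
  interpret L: line_chart "subvariety (toric_variety \<Sigma>) C" "curve_point \<sigma> g" "toric_algebra \<sigma> :: (('n, 'k) toric_point \<Rightarrow> 'k) set"
    by (rule curve_line_chart)
  have pt0: "curve_point \<sigma> g (0::'k) = fixed_point \<sigma>" by (simp add: curve_point_def)
  have fst: "fst (fixed_point \<sigma> :: ('n, 'k) toric_point) = \<sigma>" by (simp add: fixed_point_def)
  let ?u = "real_of_int k *\<^sub>R g"
  have uniq: "u = ?u" if "local_datum E \<sigma> u" for u
  proof -
    have "u - ?u = 0"
      by (rule full_cone_eq_zero[OF curve_facts(3,2)])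
         (use that E in \<open>auto simp: local_datum_def inner_diff_left\<close>)
    then show ?thesis by simp
  qed
  have ch: "character (- ?u) (curve_point \<sigma> g s) = s powi (- k)" if "s \<noteq> 0" for s :: 'k
    using character_curve_point[OF that, of "- k"] by simp
  have il: "?u \<in> int_lattice" using curve_facts(7) by (auto simp: primitive_def intro: int_lattice_scale)
  show ?thesis unfolding local_mult_def fst
  proof (rule the_equality)
    show "\<exists>u\<in>int_lattice. local_datum E \<sigma> u \<and>
        has_order (subvariety (toric_variety \<Sigma>) C) (fixed_point \<sigma>) (character (- u)) (- k)"
      using L.coordinate_power_has_order[OF ch] E il unfolding pt0 by (intro bexI[of _ ?u]) auto
    fix k' assume "\<exists>u\<in>int_lattice. local_datum E \<sigma> u \<and>
        has_order (subvariety (toric_variety \<Sigma>) C) (fixed_point \<sigma>) (character (- u)) k'"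
    then have "has_order (subvariety (toric_variety \<Sigma>) C) (fixed_point \<sigma>) (character (- ?u)) k'"
      using uniq by blast
    then show "k' = - k" using L.has_order_unique[OF ch] unfolding pt0 by blast
  qed
qed

end

lemma local_datum_unique:
  assumes "\<sigma> \<in> maximal_cones \<Sigma>" "local_datum E \<sigma> u" "local_datum E \<sigma> u'"
  shows "u = u'"
proof -
  have "u - u' = 0"
    by (rule full_cone_eq_zero[OF rational[OF maximalD(1)[OF assms(1)]] maximalD(2)[OF assms(1)]])
       (use assms(2,3) in \<open>auto simp: local_datum_def inner_diff_left\<close>)
  then show ?thesis by simp
qed

text \<open>
  Let \<open>E\<close> be linearly equivalent to \<open>m D\<close>, with a support that does not contain the curve. Its local data at $\sigma$ and
  $\tau$ vanish on the common facet, so they are \<open>a g\<close> and \<open>b g\<close>. The coordinates of the curve at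
  its two fixed points are \<open>g\<close> and \<open>- g\<close>, whence the multiplicities \<open>- a\<close> and \<open>b\<close>. Their sum
  \<open>b - a\<close> is also the change of the local datum of \<open>E\<close>, and this is \<open>m\<close> times the one for \<open>D\<close>, since
  linear equivalence adds the same vector to the local data at both cones.
\<close>

theorem intersection_number_wall:
  assumes \<sigma>: "\<sigma> \<in> maximal_cones \<Sigma>" and \<tau>: "\<tau> \<in> maximal_cones \<Sigma>" "\<tau> \<noteq> \<sigma>"
    and g: "g \<in> facet_normals \<sigma>" and eq: "\<sigma> \<inter> \<tau> = \<sigma> \<inter> {x. g \<bullet> x = 0}"
    and D: "T_QCartier \<Sigma> D" "local_datum D \<sigma> u\<sigma>" "local_datum D \<tau> u\<tau>"
  shows "\<exists>c. u\<tau> = u\<sigma> + c *\<^sub>R g \<and>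
    intersection_number \<Sigma> D (orbit_closure \<Sigma> (\<sigma> \<inter> {x. g \<bullet> x = 0}) :: ('n, 'k::alg_closed_field) toric_point set) = c"
proof -
  define \<omega> where "\<omega> = \<sigma> \<inter> {x. g \<bullet> x = 0}"
  define C where "C = (orbit_closure \<Sigma> \<omega> :: ('n, 'k) toric_point set)"
  note \<sigma>f = curve_facts[OF \<sigma> g, folded \<omega>_def]
  have "\<sigma> \<inter> {x. g \<bullet> x = 0} \<subseteq> \<tau>" using eq by blast
  note opp = facet_opposite[OF \<sigma> \<tau> g this]
  have "{x. - g \<bullet> x = 0} = {x. g \<bullet> x = 0}" by auto
  then have \<omega>': "\<tau> \<inter> {x. - g \<bullet> x = 0} = \<omega>" using opp(3) by (simp add: \<omega>_def)
  note \<tau>f = curve_facts[OF \<tau>(1) opp(2), unfolded \<omega>']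
  have \<omega>\<tau>: "\<omega> \<subseteq> \<tau>" "\<omega> \<subseteq> \<sigma>" using eq by (auto simp: \<omega>_def)
  have three: "\<gamma> = \<omega> \<or> \<gamma> = \<sigma> \<or> \<gamma> = \<tau>" if \<gamma>: "\<gamma> \<in> \<Sigma>" "\<omega> \<subseteq> \<gamma>" for \<gamma>
  proof -
    obtain \<kappa> where "\<And>\<gamma>. \<gamma> \<in> \<Sigma> \<Longrightarrow> \<omega> \<subseteq> \<gamma> \<Longrightarrow> \<gamma> = \<omega> \<or> \<gamma> = \<sigma> \<or> \<gamma> = \<kappa>"
      using facet_neighbour[OF \<sigma> g] unfolding \<omega>_def by metis
    then show ?thesis using \<gamma> \<omega>\<tau>(1) \<tau>(2) \<tau>f(1,6) by metis
  qed
  have ray\<omega>: "\<rho> \<in> rays_of \<sigma> \<and> \<rho> \<in> rays_of \<tau>" if "\<rho> \<in> rays_of \<omega>" for \<rho>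
    using that \<sigma>f(4) \<tau>f(4) cone_face_trans by (auto simp: rays_of_def)
  have multiple: "\<exists>c. w = c *\<^sub>R g" if w: "\<And>\<rho>. \<rho> \<in> rays_of \<omega> \<Longrightarrow> w \<bullet> prim_gen \<rho> = 0" for w
  proof (rule normal_parallel[of \<omega>])
    show "Suc (dim \<omega>) = CARD('n)" using g by (simp add: facet_normals_def \<omega>_def)
    have "\<forall>x\<in>\<omega>. 0 \<le> w \<bullet> x" "\<forall>x\<in>\<omega>. 0 \<le> (- w) \<bullet> x"
      unfolding nonneg_on_cone_iff[OF rational[OF \<sigma>f(5)]] using w by auto
    then show "w \<bullet> x = 0" if "x \<in> \<omega>" for x using that by force
  qed (use \<sigma>f(8) in \<open>auto simp: \<omega>_def\<close>)
  have int_multiple: "\<exists>k. w = real_of_int k *\<^sub>R g" if "w = c *\<^sub>R g" "w \<in> int_lattice" for w c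
    using that \<sigma>f(7) unfolding primitive_def by (metis Ints_cases)
  obtain c where c: "u\<tau> - u\<sigma> = c *\<^sub>R g"
    using multiple[of "u\<tau> - u\<sigma>"] D(2,3) ray\<omega> by (auto simp: local_datum_def inner_diff_left)
  have fp\<sigma>: "x = fixed_point \<sigma>" if "x \<in> orbit \<sigma>" for x :: "('n, 'k) toric_point"
    using orbit_full[OF \<sigma>f(3,2), where 'k='k] that by blast
  have fp\<tau>: "x = fixed_point \<tau>" if "x \<in> orbit \<tau>" for x :: "('n, 'k) toric_point"
    using orbit_full[OF \<tau>f(3,2), where 'k='k] that by blast
  have C: "x \<in> C \<longleftrightarrow> x \<in> orbit \<omega> \<or> x = fixed_point \<sigma> \<or> x = fixed_point \<tau>" for x
  proof -
    have "x \<in> C \<longleftrightarrow> (\<exists>\<gamma>\<in>{\<omega>, \<sigma>, \<tau>}. x \<in> orbit \<gamma>)"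
    proof -
      have "cone_face \<omega> \<omega>" using convex_cone[OF \<sigma>f(5)] by (simp add: cone_face_iff)
      then have "\<gamma> \<in> \<Sigma> \<and> cone_face \<omega> \<gamma> \<longleftrightarrow> \<gamma> \<in> {\<omega>, \<sigma>, \<tau>}" for \<gamma>
        using three \<sigma>f(1,4,5) \<tau>f(1,4) by (auto simp: cone_face_def face_of_def)
      then show ?thesis unfolding C_def orbit_closure_def by auto
    qed
    then show ?thesis
      using orbit_full[OF \<sigma>f(3,2), where 'k='k] orbit_full[OF \<tau>f(3,2), where 'k='k] by auto
  qed
  have val_eq: "real_of_int (\<Sum>x\<in>C \<inter> support \<Sigma> E. local_mult \<Sigma> E C x) / real m = c"
    if m: "m > 0" and u: "u \<in> int_lattice" and E: "E = (\<lambda>\<rho>. real m * D \<rho> + div_char u \<rho>)" "T_Cartier \<Sigma> E"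
      and nsub: "\<not> C \<subseteq> support \<Sigma> E" for m :: nat and u E
  proof -
    have E0: "E \<rho> = 0" if \<rho>: "\<rho> \<in> rays_of \<omega>" for \<rho>
    proof (rule ccontr)
      assume "E \<rho> \<noteq> 0"
      moreover have "\<rho> \<in> rays \<Sigma>" using rays_of_rays[OF \<sigma>f(5) \<rho>] .
      moreover have "C \<subseteq> orbit_closure \<Sigma> \<rho>"
        using \<rho> cone_face_trans unfolding C_def by (auto simp: mem_orbit_closure rays_of_def)
      ultimately have "C \<subseteq> support \<Sigma> E" by (auto simp: support_def)
      then show False using nsub by blast
    qed
    have datum: "\<exists>k. local_datum E \<gamma> (real_of_int k *\<^sub>R g)" if \<gamma>: "\<gamma> \<in> {\<sigma>, \<tau>}" for \<gamma>
    proof -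
      obtain w where w: "w \<in> int_lattice" "local_datum E \<gamma> w" using E(2) \<sigma> \<tau>(1) \<gamma> by (auto simp: T_Cartier_def)
      have "\<exists>c. w = c *\<^sub>R g"
        using w(2) ray\<omega> \<gamma> E0 by (intro multiple) (auto simp: local_datum_def)
      then show ?thesis using int_multiple w by metis
    qed
    obtain a where a: "local_datum E \<sigma> (real_of_int a *\<^sub>R g)" using datum by blast
    obtain b where b: "local_datum E \<tau> (real_of_int b *\<^sub>R g)" using datum by blast
    have "local_datum E \<sigma> (real m *\<^sub>R u\<sigma> - u)" "local_datum E \<tau> (real m *\<^sub>R u\<tau> - u)"
      using D(2,3) by (auto simp: E(1) local_datum_def div_char_def inner_diff_left)
    then have "real_of_int a *\<^sub>R g = real m *\<^sub>R u\<sigma> - u" "real_of_int b *\<^sub>R g = real m *\<^sub>R u\<tau> - u"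
      using local_datum_unique[OF \<sigma> a] local_datum_unique[OF \<tau>(1) b] by auto
    then have "(real_of_int b - real_of_int a) *\<^sub>R g = real m *\<^sub>R (u\<tau> - u\<sigma>)"
      by (simp add: scaleR_left_diff_distrib scaleR_right_diff_distrib)
    then have bac: "real_of_int b - real_of_int a = real m * c" using \<sigma>f(8) by (simp add: c)
    have supp: "(fixed_point \<gamma> :: ('n, 'k) toric_point) \<in> support \<Sigma> E \<longleftrightarrow> k \<noteq> 0"
      if \<gamma>: "\<gamma> \<in> maximal_cones \<Sigma>" and k: "local_datum E \<gamma> (real_of_int k *\<^sub>R g)" for \<gamma> k
    proof -
      note \<gamma>' = maximalD[OF \<gamma>]
      have fp: "fixed_point \<gamma> \<in> (orbit \<gamma> :: ('n, 'k) toric_point set)"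
        using orbit_full[OF rational[OF \<gamma>'(1)] \<gamma>'(2), where 'k='k] by blast
      have "(fixed_point \<gamma> :: ('n, 'k) toric_point) \<in> support \<Sigma> E \<longleftrightarrow> (\<exists>\<rho>\<in>rays_of \<gamma>. E \<rho> \<noteq> 0)"
        using fp \<gamma>'(1) rays_of_rays[OF \<gamma>'(1)] orbit_disjoint[OF fp]
        by (auto simp: support_def mem_orbit_closure rays_of_def rays_def)
      also have "\<dots> \<longleftrightarrow> k \<noteq> 0"
      proof
        show "\<exists>\<rho>\<in>rays_of \<gamma>. E \<rho> \<noteq> 0 \<Longrightarrow> k \<noteq> 0" using k by (auto simp: local_datum_def)
        assume "k \<noteq> 0"
        then have "real_of_int k *\<^sub>R g \<noteq> 0" using \<sigma>f(8) by simp
        then show "\<exists>\<rho>\<in>rays_of \<gamma>. E \<rho> \<noteq> 0"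
          using full_cone_eq_zero[OF rational[OF \<gamma>'(1)] \<gamma>'(2), of "real_of_int k *\<^sub>R g"] k
          by (force simp: local_datum_def)
      qed
      finally show ?thesis .
    qed
    have "x \<notin> support \<Sigma> E" if "x \<in> orbit \<omega>" for x :: "('n, 'k) toric_point"
      using that E0 orbit_disjoint[OF that] by (auto simp: support_def mem_orbit_closure rays_of_def rays_def)
    then have "C \<inter> support \<Sigma> E = (if a = 0 then {} else {fixed_point \<sigma>}) \<union> (if b = 0 then {} else {fixed_point \<tau>})"
      using supp[OF \<sigma> a] supp[OF \<tau>(1) b] C by auto
    moreover have "fixed_point \<sigma> \<noteq> (fixed_point \<tau> :: ('n, 'k) toric_point)" using \<tau>(2) by (simp add: fixed_point_def)
    moreover have "local_mult \<Sigma> E C (fixed_point \<sigma>) = - a"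
      using local_mult_fixed_point[OF \<sigma> g a, where 'k='k] by (simp add: C_def \<omega>_def)
    moreover have "local_datum E \<tau> (real_of_int (- b) *\<^sub>R (- g))" using b by simp
    then have "local_mult \<Sigma> E C (fixed_point \<tau>) = b"
      using local_mult_fixed_point[OF \<tau>(1) opp(2), of E "- b", where 'k='k] by (simp only: C_def \<omega>' minus_minus)
    ultimately have S: "(\<Sum>x\<in>C \<inter> support \<Sigma> E. local_mult \<Sigma> E C x) = b - a"
      by (auto split: if_splits)
    show ?thesis unfolding S using bac m by (simp add: field_simps)
  qed
  have "\<exists>(m::nat) u E. m > 0 \<and> u \<in> int_lattice \<and> E = (\<lambda>\<rho>. real m * D \<rho> + div_char u \<rho>) \<and> T_Cartier \<Sigma> E \<and> \<not> C \<subseteq> support \<Sigma> E"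
  proof -
    obtain m :: nat where m: "m > 0" "T_Cartier \<Sigma> (\<lambda>\<rho>. real m * D \<rho>)" using D(1) by (auto simp: T_QCartier_def)
    obtain w where w: "w \<in> int_lattice" "local_datum (\<lambda>\<rho>. real m * D \<rho>) \<sigma> w" using m(2) \<sigma> by (auto simp: T_Cartier_def)
    define E where "E = (\<lambda>\<rho>. real m * D \<rho> + div_char w \<rho>)"
    have "T_Cartier \<Sigma> E" unfolding T_Cartier_def
    proof (intro conjI ballI)
      fix \<rho> assume \<rho>: "\<rho> \<in> rays \<Sigma>"
      then have "real m * D \<rho> \<in> \<int>" using m(2) by (auto simp: T_Cartier_def)
      moreover have "w \<bullet> prim_gen \<rho> \<in> \<int>" using ray_gen(1)[OF \<rho>] w(1) by (auto simp: primitive_def intro: int_lattice_inner)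
      ultimately show "E \<rho> \<in> \<int>" by (simp add: E_def div_char_def)
    next
      fix \<gamma> assume "\<gamma> \<in> maximal_cones \<Sigma>"
      then obtain w' where "w' \<in> int_lattice" "local_datum (\<lambda>\<rho>. real m * D \<rho>) \<gamma> w'" using m(2) by (auto simp: T_Cartier_def)
      then show "\<exists>u\<in>int_lattice. local_datum E \<gamma> u"
        using w(1) by (intro bexI[of _ "w' - w"]) (auto simp: local_datum_def E_def div_char_def inner_diff_left int_lattice_diff)
    qed
    moreover have "\<not> C \<subseteq> support \<Sigma> E"
    proof
      assume sub: "C \<subseteq> support \<Sigma> E"
      let ?x = "curve_point \<sigma> g (1::'k)"
      have x: "?x \<in> orbit \<omega>" using curve_point_orbit[OF \<sigma> g, of "1::'k"] by (simp add: \<omega>_def)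
      then have "?x \<in> support \<Sigma> E" using sub C by blast
      then obtain \<rho> where "\<rho> \<in> rays \<Sigma>" "E \<rho> \<noteq> 0" "cone_face \<rho> \<omega>"
        using orbit_disjoint[OF x] by (auto simp: support_def mem_orbit_closure)
      then have "\<rho> \<in> rays_of \<sigma>" using ray\<omega> by (auto simp: rays_of_def rays_def)
      then show False using w(2) \<open>E \<rho> \<noteq> 0\<close> by (auto simp: E_def div_char_def local_datum_def)
    qed
    ultimately show ?thesis using m(1) w(1) E_def by blast
  qed
  then have "intersection_number \<Sigma> D C = c"
    unfolding intersection_number_def using val_eq by (intro the_equality) blast+
  then show ?thesis using c unfolding C_def \<omega>_def by (intro exI[of _ c]) (simp add: algebra_simps)
qed

end

section \<open>Morphisms between atlases\<close>

lemma algebra_gen_prod: "(\<And>i. i \<in> J \<Longrightarrow> f i \<in> algebra_gen S) \<Longrightarrow> (\<lambda>z. \<Prod>i\<in>J. f i z) \<in> algebra_gen S"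
  by (induction J rule: infinite_finite_induct) (auto intro: algebra_gen.intros)

lemma localized_algebra_gen:
  assumes S: "A = algebra_gen S" and r: "r \<in> A"
    and gen: "\<And>b. b \<in> T \<Longrightarrow> \<exists>p\<in>A. \<exists>N. \<forall>z\<in>U. r z \<noteq> (0::'k::field) \<longrightarrow> b (F z) = p z / r z ^ N"
    and b: "b \<in> algebra_gen T"
  shows "\<exists>p\<in>A. \<exists>N. \<forall>z\<in>U. r z \<noteq> 0 \<longrightarrow> b (F z) = p z / r z ^ N"
  using b
proof induction
  case (const c)
  show ?case unfolding S by (intro bexI[OF _ algebra_gen.const[of c]] exI[of _ 0]) simp
next
  case (gen b) then show ?case by (rule assms(3))
next
  case (add b b')
  obtain p N where p: "p \<in> A" "\<forall>z\<in>U. r z \<noteq> 0 \<longrightarrow> b (F z) = p z / r z ^ N" using add.IH(1) by blast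
  obtain p' N' where p': "p' \<in> A" "\<forall>z\<in>U. r z \<noteq> 0 \<longrightarrow> b' (F z) = p' z / r z ^ N'" using add.IH(2) by blast
  have "(\<lambda>z. p z * r z ^ N' + p' z * r z ^ N) \<in> A"
    using p(1) p'(1) r unfolding S by (intro algebra_gen.add algebra_gen.mult algebra_gen_power)
  then show ?case using p(2) p'(2)
    by (intro bexI[of _ "\<lambda>z. p z * r z ^ N' + p' z * r z ^ N"] exI[of _ "N + N'"]) (auto simp: field_simps power_add)
next
  case (mult b b')
  obtain p N where p: "p \<in> A" "\<forall>z\<in>U. r z \<noteq> 0 \<longrightarrow> b (F z) = p z / r z ^ N" using mult.IH(1) by blast
  obtain p' N' where p': "p' \<in> A" "\<forall>z\<in>U. r z \<noteq> 0 \<longrightarrow> b' (F z) = p' z / r z ^ N'" using mult.IH(2) by blast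
  have "(\<lambda>z. p z * p' z) \<in> A" using p(1) p'(1) unfolding S by (rule algebra_gen.mult)
  then show ?case using p(2) p'(2)
    by (intro bexI[of _ "\<lambda>z. p z * p' z"] exI[of _ "N + N'"]) (auto simp: power_add)
qed

text \<open>
  Open sets and regular functions are described by principal open sets and fractions, so it suffices
  that locally, on a principal open set of a chart, the generators of the target algebra
  pull back to fractions with powers of its equation as denominators.
\<close>

lemma morphismI:
  fixes At :: "('p, 'k::field) atlas" and Bt :: "('q, 'k) atlas"
  assumes maps: "\<And>x. x \<in> pts At \<Longrightarrow> F x \<in> pts Bt"
    and alg: "\<And>V B. (V, B) \<in> Bt \<Longrightarrow> B = algebra_gen (T V B)"
    and loc: "\<And>x V B. x \<in> pts At \<Longrightarrow> (V, B) \<in> Bt \<Longrightarrow> F x \<in> V \<Longrightarrow>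
      \<exists>U S r. (U, algebra_gen S) \<in> At \<and> x \<in> U \<and> r \<in> algebra_gen S \<and> r x \<noteq> 0 \<and> (\<forall>z\<in>U. r z \<noteq> 0 \<longrightarrow> F z \<in> V) \<and>
        (\<forall>b\<in>T V B. \<exists>p\<in>algebra_gen S. \<exists>N. \<forall>z\<in>U. r z \<noteq> 0 \<longrightarrow> b (F z) = p z / r z ^ N)"
  shows "morphism At Bt F"
  unfolding morphism_def
proof (intro conjI allI impI)
  show "F ` pts At \<subseteq> pts Bt" using maps by blast
  fix W assume W: "zariski_open Bt W"
  have key: "\<exists>U S r. (U, algebra_gen S) \<in> At \<and> x \<in> U \<and> r \<in> algebra_gen S \<and> r x \<noteq> 0 \<and> (\<forall>z\<in>U. r z \<noteq> 0 \<longrightarrow> F z \<in> V) \<and>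
        (\<forall>b\<in>B. \<exists>p\<in>algebra_gen S. \<exists>N. \<forall>z\<in>U. r z \<noteq> 0 \<longrightarrow> b (F z) = p z / r z ^ N)"
    if x: "x \<in> pts At" "(V, B) \<in> Bt" "F x \<in> V" for x V B
  proof -
    obtain U S r where U: "(U, algebra_gen S) \<in> At" "x \<in> U" "r \<in> algebra_gen S" "r x \<noteq> 0" "\<forall>z\<in>U. r z \<noteq> 0 \<longrightarrow> F z \<in> V"
      "\<forall>b\<in>T V B. \<exists>p\<in>algebra_gen S. \<exists>N. \<forall>z\<in>U. r z \<noteq> 0 \<longrightarrow> b (F z) = p z / r z ^ N"
      using loc[OF x] by (elim exE conjE) rule
    have "\<exists>p\<in>algebra_gen S. \<exists>N. \<forall>z\<in>U. r z \<noteq> 0 \<longrightarrow> b (F z) = p z / r z ^ N" if "b \<in> B" for b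
      using localized_algebra_gen[of "algebra_gen S" S r "T V B" U F b, OF refl U(3) bspec[OF U(6)]] that alg[OF x(2)] by simp
    then show ?thesis using U(1-5) by (intro exI[of _ U] exI[of _ S] exI[of _ r]) simp
  qed
  show "zariski_open At (pts At \<inter> F -` W)"
    unfolding zariski_open_def
  proof
    fix x assume x: "x \<in> pts At \<inter> F -` W"
    then obtain V B b where b: "(V, B) \<in> Bt" "F x \<in> V" "b \<in> B" "b (F x) \<noteq> 0" "{z\<in>V. b z \<noteq> 0} \<subseteq> W"
      using W unfolding zariski_open_def by fastforce
    obtain U S r where U: "(U, algebra_gen S) \<in> At" "x \<in> U" "r \<in> algebra_gen S" "r x \<noteq> 0" "\<forall>z\<in>U. r z \<noteq> 0 \<longrightarrow> F z \<in> V"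
      "\<forall>b\<in>B. \<exists>p\<in>algebra_gen S. \<exists>N. \<forall>z\<in>U. r z \<noteq> 0 \<longrightarrow> b (F z) = p z / r z ^ N"
      using key[of x V B] x b by blast
    obtain p N where p: "p \<in> algebra_gen S" "\<forall>z\<in>U. r z \<noteq> 0 \<longrightarrow> b (F z) = p z / r z ^ N" using U(6) b(3) by blast
    have "(\<lambda>z. p z * r z) \<in> algebra_gen S" using p(1) U(3) by (rule algebra_gen.mult)
    moreover have "p x * r x \<noteq> 0" using p(2) U(2,4) b(4) by auto
    moreover have "{z\<in>U. p z * r z \<noteq> 0} \<subseteq> pts At \<inter> F -` W"
    proof
      fix z assume z: "z \<in> {z\<in>U. p z * r z \<noteq> 0}"
      then have "F z \<in> V" "b (F z) \<noteq> 0" using U(5) p(2) by auto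
      moreover have "z \<in> pts At" using z U(1) by (auto simp: pts_def)
      ultimately show "z \<in> pts At \<inter> F -` W" using b(5) by blast
    qed
    ultimately have "\<exists>q\<in>algebra_gen S. q x \<noteq> 0 \<and> {z\<in>U. q z \<noteq> 0} \<subseteq> pts At \<inter> F -` W" by (rule_tac bexI) auto
    then show "\<exists>(U, A)\<in>At. x \<in> U \<and> (\<exists>q\<in>A. q x \<noteq> 0 \<and> {z\<in>U. q z \<noteq> 0} \<subseteq> pts At \<inter> F -` W)"
      using U(1,2) by blast
  qed
  fix f assume f: "regular_on Bt W f"
  show "regular_on At (pts At \<inter> F -` W) (f \<circ> F)"
    unfolding regular_on_def
  proof
    fix x assume x: "x \<in> pts At \<inter> F -` W"
    then obtain V B a b where b: "(V, B) \<in> Bt" "F x \<in> V" "a \<in> B" "b \<in> B" "b (F x) \<noteq> 0" "\<forall>z\<in>V \<inter> W. b z \<noteq> 0 \<longrightarrow> f z = a z / b z"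
      using f unfolding regular_on_def by fastforce
    obtain U S r where U: "(U, algebra_gen S) \<in> At" "x \<in> U" "r \<in> algebra_gen S" "r x \<noteq> 0" "\<forall>z\<in>U. r z \<noteq> 0 \<longrightarrow> F z \<in> V"
      "\<forall>b\<in>B. \<exists>p\<in>algebra_gen S. \<exists>N. \<forall>z\<in>U. r z \<noteq> 0 \<longrightarrow> b (F z) = p z / r z ^ N"
      using key[of x V B] x b by blast
    obtain p N where p: "p \<in> algebra_gen S" "\<forall>z\<in>U. r z \<noteq> 0 \<longrightarrow> a (F z) = p z / r z ^ N" using U(6) b(3) by blast
    obtain q M where q: "q \<in> algebra_gen S" "\<forall>z\<in>U. r z \<noteq> 0 \<longrightarrow> b (F z) = q z / r z ^ M" using U(6) b(4) by blast
    have mem: "(\<lambda>z. p z * r z ^ Suc M) \<in> algebra_gen S" "(\<lambda>z. q z * r z ^ Suc N) \<in> algebra_gen S"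
      by (rule algebra_gen.mult[OF p(1) algebra_gen_power[OF U(3)]], rule algebra_gen.mult[OF q(1) algebra_gen_power[OF U(3)]])
    have "q x * r x ^ Suc N \<noteq> 0" using q(2) U(2,4) b(5) by auto
    moreover have "\<forall>z\<in>U \<inter> (pts At \<inter> F -` W). q z * r z ^ Suc N \<noteq> 0 \<longrightarrow> (f \<circ> F) z = (p z * r z ^ Suc M) / (q z * r z ^ Suc N)"
    proof (intro ballI impI)
      fix z assume z: "z \<in> U \<inter> (pts At \<inter> F -` W)" "q z * r z ^ Suc N \<noteq> 0"
      then have nz: "r z \<noteq> 0" "q z \<noteq> 0" by auto
      then have "F z \<in> V \<inter> W" "b (F z) \<noteq> 0" using U(5) q(2) z by auto
      then have "f (F z) = a (F z) / b (F z)" using b(6) by blast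
      also have "a (F z) = p z / r z ^ N" using p(2) z nz by simp
      also have "b (F z) = q z / r z ^ M" using q(2) z nz by simp
      finally show "(f \<circ> F) z = (p z * r z ^ Suc M) / (q z * r z ^ Suc N)"
        using nz by (simp add: field_simps)
    qed
    ultimately have "\<exists>p\<in>algebra_gen S. \<exists>q\<in>algebra_gen S. q x \<noteq> 0 \<and> (\<forall>z\<in>U \<inter> (pts At \<inter> F -` W). q z \<noteq> 0 \<longrightarrow> (f \<circ> F) z = p z / q z)"
      by (intro bexI[OF _ mem(1)] bexI[OF _ mem(2)] conjI)
    then show "\<exists>(U, A)\<in>At. x \<in> U \<and> (\<exists>p\<in>A. \<exists>q\<in>A. q x \<noteq> 0 \<and> (\<forall>z\<in>U \<inter> (pts At \<inter> F -` W). q z \<noteq> 0 \<longrightarrow> (f \<circ> F) z = p z / q z))"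
      using U(1,2) by blast
  qed
qed

section \<open>The toric variety of the fan of projective space\<close>

text \<open>
  The fan of projective space with the rays numbered from \<open>0\<close> to \<open>n\<close>. The vectors \<open>E i\<close> are dual to the
  \<open>V l\<close> up to the correction at \<open>l = 0\<close>, which cancels in differences: the character
  \<open>E i - E j\<close> is the coordinate ratio $x_i / x_j$.
\<close>

locale simplex_fan =
  fixes \<Sigma> :: "(real^'n::finite) set set" and V E :: "nat \<Rightarrow> real^'n"
  assumes fan: "fan \<Sigma>"
    and V_int: "i \<le> CARD('n) \<Longrightarrow> V i \<in> int_lattice" and E_int: "E i \<in> int_lattice"
    and dual: "i \<le> CARD('n) \<Longrightarrow> l \<le> CARD('n) \<Longrightarrow> E i \<bullet> V l = of_bool (i = l) - of_bool (l = 0)"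
    and expansion: "u = (\<Sum>i\<le>CARD('n). (u \<bullet> V i) *\<^sub>R E i)" and sum_zero: "(\<Sum>i\<le>CARD('n). u \<bullet> V i) = 0"
    and cones: "\<Sigma> = {convex_cone hull (V ` I) | I. I \<subset> {..CARD('n)}}"
begin

definition cone :: "nat set \<Rightarrow> (real^'n) set" where
  "cone I = convex_cone hull (V ` I)"

lemma ratio_dual: "i \<le> CARD('n) \<Longrightarrow> j \<le> CARD('n) \<Longrightarrow> l \<le> CARD('n) \<Longrightarrow> (E i - E j) \<bullet> V l = of_bool (i = l) - of_bool (j = l)"
  by (simp add: inner_diff_left dual)

lemma ratio_int: "E i - E j \<in> int_lattice"
  by (intro int_lattice_diff E_int)

lemma \<Sigma>_cone: "\<gamma> \<in> \<Sigma> \<longleftrightarrow> (\<exists>I. I \<subset> {..CARD('n)} \<and> \<gamma> = cone I)"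
  by (auto simp: cones cone_def)

lemma nonneg_on_cone: "(\<forall>x\<in>cone I. 0 \<le> u \<bullet> x) \<longleftrightarrow> (\<forall>i\<in>I. 0 \<le> u \<bullet> V i)"
proof
  assume "\<forall>i\<in>I. 0 \<le> u \<bullet> V i"
  then have "cone I \<subseteq> {x. 0 \<le> u \<bullet> x}"
    unfolding cone_def by (intro hull_minimal) (auto simp: convex_cone_halfspace_ge)
  then show "\<forall>x\<in>cone I. 0 \<le> u \<bullet> x" by blast
qed (auto simp: cone_def hull_inc)

lemma perp_cone: "u \<in> perp_lattice (cone I) \<longleftrightarrow> u \<in> int_lattice \<and> (\<forall>i\<in>I. u \<bullet> V i = 0)"
proof -
  have "(\<forall>x\<in>cone I. u \<bullet> x = 0) \<longleftrightarrow> (\<forall>x\<in>cone I. 0 \<le> u \<bullet> x) \<and> (\<forall>x\<in>cone I. 0 \<le> (- u) \<bullet> x)" by (auto intro: antisym)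
  also have "\<dots> \<longleftrightarrow> (\<forall>i\<in>I. u \<bullet> V i = 0)" unfolding nonneg_on_cone by (auto intro: antisym)
  finally show ?thesis by (simp add: perp_lattice_def)
qed

lemma V_mem_cone:
  assumes "I \<subseteq> {..CARD('n)}" "i \<le> CARD('n)"
  shows "V i \<in> cone I \<longleftrightarrow> i \<in> I"
proof
  assume v: "V i \<in> cone I"
  show "i \<in> I"
  proof (rule ccontr)
    assume i: "i \<notin> I"
    obtain k where k: "k \<le> CARD('n)" "k \<noteq> i"
      using zero_less_card_finite[where 'a='n] by (metis le0 le_refl less_numeral_extra(3))
    have "\<forall>l\<in>I. 0 \<le> (E k - E i) \<bullet> V l"
      using assms i k by (auto simp: ratio_dual subset_iff)
    then have "0 \<le> (E k - E i) \<bullet> V i" using v nonneg_on_cone by blast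
    then show False using assms(2) k by (simp add: ratio_dual)
  qed
qed (simp add: cone_def hull_inc)

lemma cone_face_cone:
  assumes "I \<subset> {..CARD('n)}" "J \<subset> {..CARD('n)}"
  shows "cone_face (cone J) (cone I) \<longleftrightarrow> J \<subseteq> I"
proof
  assume "cone_face (cone J) (cone I)"
  then have "cone J \<subseteq> cone I" by (auto simp: cone_face_def face_of_def)
  then show "J \<subseteq> I" using V_mem_cone[of I] V_mem_cone[of J] assms by blast
next
  assume "J \<subseteq> I"
  then have "cone J \<subseteq> cone I" unfolding cone_def by (intro hull_mono) blast
  moreover have "cone J \<in> \<Sigma>" "cone I \<in> \<Sigma>" using assms \<Sigma>_cone by auto
  ultimately show "cone_face (cone J) (cone I)"
    using fan unfolding fan_def by (metis Int_absorb2)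
qed

lemma mem_toric_open_cone:
  assumes "I \<subset> {..CARD('n)}"
  shows "x \<in> toric_open (cone I) \<longleftrightarrow> (\<exists>J h. J \<subseteq> I \<and> x = (cone J, h) \<and> (cone J, h) \<in> orbit (cone J))"
proof
  assume x: "x \<in> toric_open (cone I)"
  then have f: "cone_face (fst x) (cone I)" "x \<in> orbit (fst x)" by (auto simp: mem_toric_open)
  then have "fst x \<in> \<Sigma>" using fan assms \<Sigma>_cone unfolding fan_def by blast
  then obtain J where J: "J \<subset> {..CARD('n)}" "fst x = cone J" using \<Sigma>_cone by blast
  then have "J \<subseteq> I" using f(1) cone_face_cone[OF assms J(1)] by simp
  then show "\<exists>J h. J \<subseteq> I \<and> x = (cone J, h) \<and> (cone J, h) \<in> orbit (cone J)"
    using J f(2) by (intro exI[of _ J] exI[of _ "snd x"]) (metis prod.collapse)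
next
  assume "\<exists>J h. J \<subseteq> I \<and> x = (cone J, h) \<and> (cone J, h) \<in> orbit (cone J)"
  then obtain J h where J: "J \<subseteq> I" "x = (cone J, h)" "(cone J, h) \<in> orbit (cone J)" by blast
  have "J \<subset> {..CARD('n)}" using J(1) assms by blast
  then show "x \<in> toric_open (cone I)" using J cone_face_cone[OF assms] by (simp add: mem_toric_open)
qed

text \<open>
  The character \<open>u\<close> takes the value $\prod_i x_i^{\langle u, v_i\rangle}$ with $v_i$ = \<open>V i\<close>. It is homogeneous of
  degree zero because the \<open>V i\<close> sum to zero. Vanishing coordinates have exponent zero on the lattice
  of the orbit, where \<open>0 powi 0 = 1\<close>.
\<close>

definition from_coords :: "(nat \<Rightarrow> 'k::field) \<Rightarrow> ('n, 'k) toric_point" where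
  "from_coords x = (cone {i. i \<le> CARD('n) \<and> x i = 0},
     \<lambda>u. if u \<in> perp_lattice (cone {i. i \<le> CARD('n) \<and> x i = 0}) then \<Prod>i\<le>CARD('n). x i powi \<lfloor>u \<bullet> V i\<rfloor> else 0)"

lemma exponent_int: "u \<in> int_lattice \<Longrightarrow> i \<le> CARD('n) \<Longrightarrow> real_of_int \<lfloor>u \<bullet> V i\<rfloor> = u \<bullet> V i"
  using int_lattice_inner[OF _ V_int] by (metis Ints_cases floor_of_int)

lemma exponent_sum: "u \<in> int_lattice \<Longrightarrow> (\<Sum>i\<le>CARD('n). \<lfloor>u \<bullet> V i\<rfloor>) = 0"
proof -
  assume u: "u \<in> int_lattice"
  have "real_of_int (\<Sum>i\<le>CARD('n). \<lfloor>u \<bullet> V i\<rfloor>) = (\<Sum>i\<le>CARD('n). u \<bullet> V i)"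
    unfolding of_int_sum by (intro sum.cong refl exponent_int[OF u]) simp
  then have "real_of_int (\<Sum>i\<le>CARD('n). \<lfloor>u \<bullet> V i\<rfloor>) = 0" by (simp only: sum_zero)
  then show ?thesis by (simp only: of_int_eq_0_iff)
qed

lemma prod_scale_powi:
  assumes "u \<in> int_lattice" "(c :: 'k::field) \<noteq> 0"
  shows "(\<Prod>i\<le>CARD('n). (c * x i) powi \<lfloor>u \<bullet> V i\<rfloor>) = (\<Prod>i\<le>CARD('n). x i powi \<lfloor>u \<bullet> V i\<rfloor>)"
proof -
  have "(\<Prod>i\<in>J. c powi f i) = c powi (\<Sum>i\<in>J. f i)" for f :: "nat \<Rightarrow> int" and J
    using assms(2) by (induction J rule: infinite_finite_induct) (auto simp: power_int_add)
  then show ?thesis by (simp add: power_int_mult_distrib prod.distrib exponent_sum[OF assms(1)])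
qed

lemma from_coords_scale:
  assumes "(c :: 'k::field) \<noteq> 0" shows "from_coords (\<lambda>i. c * x i) = from_coords x"
proof -
  have "(if u \<in> perp_lattice \<tau> then \<Prod>i\<le>CARD('n). (c * x i) powi \<lfloor>u \<bullet> V i\<rfloor> else 0) =
        (if u \<in> perp_lattice \<tau> then \<Prod>i\<le>CARD('n). x i powi \<lfloor>u \<bullet> V i\<rfloor> else 0)" for u and \<tau> :: "(real^'n) set"
    using prod_scale_powi[OF _ assms] by (auto simp: perp_lattice_def)
  then show ?thesis using assms by (simp add: from_coords_def)
qed

lemma character_from_coords:
  fixes x :: "nat \<Rightarrow> 'k::field"
  assumes u: "u \<in> int_lattice" "\<And>i. i \<le> CARD('n) \<Longrightarrow> x i = 0 \<Longrightarrow> 0 \<le> u \<bullet> V i"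
  shows "character u (from_coords x) = (\<Prod>i\<le>CARD('n). x i powi \<lfloor>u \<bullet> V i\<rfloor>)"
proof (cases "u \<in> perp_lattice (cone {i. i \<le> CARD('n) \<and> x i = 0})")
  case True
  then show ?thesis by (simp add: character_def from_coords_def)
next
  case False
  then obtain i where i: "i \<le> CARD('n)" "x i = 0" "u \<bullet> V i \<noteq> 0" using u(1) by (auto simp: perp_cone)
  then have "\<lfloor>u \<bullet> V i\<rfloor> \<noteq> 0" using exponent_int[OF u(1) i(1)] by auto
  then have "x i powi \<lfloor>u \<bullet> V i\<rfloor> = 0" using i(2) by (simp add: power_int_0_left)
  then have "(\<Prod>i\<le>CARD('n). x i powi \<lfloor>u \<bullet> V i\<rfloor>) = 0" using i(1) by (auto simp: prod_zero_iff)
  then show ?thesis using False by (simp add: character_def from_coords_def)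
qed

lemma from_coords_orbit:
  fixes x :: "nat \<Rightarrow> 'k::field"
  shows "from_coords x \<in> orbit (cone {i. i \<le> CARD('n) \<and> x i = 0})"
proof -
  let ?I = "{i. i \<le> CARD('n) \<and> x i = 0}"
  let ?h = "\<lambda>u. \<Prod>i\<le>CARD('n). x i powi \<lfloor>u \<bullet> V i\<rfloor>"
  have nz: "?h u \<noteq> 0" if "u \<in> perp_lattice (cone ?I)" for u
    using that by (auto simp: perp_cone prod_zero_iff power_int_eq_0_iff)
  have "?h (u + u') = ?h u * ?h u'" if u: "u \<in> perp_lattice (cone ?I)" "u' \<in> perp_lattice (cone ?I)" for u u'
    unfolding prod.distrib[symmetric]
  proof (intro prod.cong refl)
    fix i assume i: "i \<in> {..CARD('n)}"
    have ui: "u \<in> int_lattice" "u' \<in> int_lattice" using u by (auto simp: perp_cone)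
    have "\<lfloor>(u + u') \<bullet> V i\<rfloor> = \<lfloor>u \<bullet> V i\<rfloor> + \<lfloor>u' \<bullet> V i\<rfloor>"
      using int_lattice_inner[OF ui(1) V_int[of i]] i by (auto simp: inner_add_left elim!: Ints_cases)
    then show "x i powi \<lfloor>(u + u') \<bullet> V i\<rfloor> = x i powi \<lfloor>u \<bullet> V i\<rfloor> * x i powi \<lfloor>u' \<bullet> V i\<rfloor>"
      using u i by (cases "x i = 0") (auto simp: power_int_add perp_cone)
  qed
  then show ?thesis unfolding from_coords_def using nz by (intro orbitI)
qed

lemma ratio_from_coords:
  fixes x :: "nat \<Rightarrow> 'k::field"
  assumes "i \<le> CARD('n)" "j \<le> CARD('n)" "x j \<noteq> 0"
  shows "character (E i - E j) (from_coords x) = x i / x j"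
proof -
  have "character (E i - E j) (from_coords x) = (\<Prod>l\<le>CARD('n). x l powi \<lfloor>(E i - E j) \<bullet> V l\<rfloor>)"
    using assms by (intro character_from_coords ratio_int) (auto simp: ratio_dual)
  also have "\<dots> = (\<Prod>l\<le>CARD('n). (if l = i then x i else 1) * (if l = j then inverse (x j) else 1))"
    using assms by (intro prod.cong refl) (auto simp: ratio_dual power_int_minus)
  also have "\<dots> = x i / x j" using assms by (simp add: prod.distrib divide_inverse)
  finally show ?thesis .
qed

text \<open>
  The coordinates are ratios with respect to a coordinate that does not vanish at the point, chosen as
  the one with least index.
\<close>

definition to_line :: "('n, 'k::field) toric_point \<Rightarrow> (nat \<Rightarrow> 'k) set" where
  "to_line p = coord_line (\<lambda>i. if i \<le> CARD('n) then character (E i - E (LEAST j. V j \<notin> fst p)) p else 0)"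

lemma character_ratio:
  assumes h: "(cone I, h) \<in> orbit (cone I)" and I: "I \<subset> {..CARD('n)}" and ij: "i \<le> CARD('n)" "j \<le> CARD('n)" "j \<notin> I"
  shows "h (E i - E j) = 0 \<longleftrightarrow> i \<in> I" "i \<notin> I \<Longrightarrow> E i - E j \<in> perp_lattice (cone I)"
proof -
  have "E i - E j \<in> perp_lattice (cone I) \<longleftrightarrow> i \<notin> I"
    using I ij by (auto simp: perp_cone ratio_int ratio_dual subset_iff)
  then show "h (E i - E j) = 0 \<longleftrightarrow> i \<in> I" "i \<notin> I \<Longrightarrow> E i - E j \<in> perp_lattice (cone I)"
    using orbit_hom(1,3)[OF h] by auto
qed

lemma to_line_eq:
  assumes h: "(cone I, h) \<in> orbit (cone I)" and I: "I \<subset> {..CARD('n)}" and j: "j \<le> CARD('n)" "j \<notin> I"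
  shows "to_line (cone I, h) = coord_line (\<lambda>i. if i \<le> CARD('n) then h (E i - E j) else (0::'k::field))"
proof -
  define k where "k = (LEAST k. V k \<notin> cone I)"
  have "V j \<notin> cone I" using V_mem_cone[of I j] I j by blast
  then have "V k \<notin> cone I" "k \<le> j" unfolding k_def by (rule LeastI, rule Least_le)
  then have k: "k \<le> CARD('n)" "k \<notin> I" using j V_mem_cone[of I k] I by auto
  have "h (E i - E k) = h (E j - E k) * h (E i - E j)" if i: "i \<le> CARD('n)" for i
  proof (cases "i \<in> I")
    case True
    then show ?thesis using character_ratio(1)[OF h I i] j k by simp
  next
    case False
    then have "h ((E j - E k) + (E i - E j)) = h (E j - E k) * h (E i - E j)"
      using character_ratio(2)[OF h I] i j k by (intro orbit_hom(2)[OF h])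
    then show ?thesis by simp
  qed
  then have "(\<lambda>i. if i \<le> CARD('n) then h (E i - E k) else 0) =
      (\<lambda>i. h (E j - E k) * (if i \<le> CARD('n) then h (E i - E j) else 0))" by auto
  moreover have nz: "h (E j - E k) \<noteq> 0" using character_ratio(1)[OF h I j(1) k] j by simp
  moreover have "to_line (cone I, h) = coord_line (\<lambda>i. if i \<le> CARD('n) then h (E i - E k) else 0)"
    unfolding to_line_def k_def character_def fst_conv snd_conv ..
  ultimately show ?thesis by (simp only: coord_line_scale[OF nz])
qed

lemma to_line_chart:
  assumes h: "(cone I, h) \<in> orbit (cone I)" and I: "I \<subset> {..CARD('n)}" and j: "j \<le> CARD('n)"
  shows "(to_line (cone I, h) :: (nat \<Rightarrow> 'k::field) set) \<in> proj_chart CARD('n) j \<longleftrightarrow> j \<notin> I"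
proof -
  obtain k where k: "k \<le> CARD('n)" "k \<notin> I" using I by auto
  let ?x = "\<lambda>i. if i \<le> CARD('n) then h (E i - E k) else 0"
  have "to_line (cone I, h) = coord_line ?x" by (rule to_line_eq[OF h I k])
  moreover have "coord_line ?x \<in> proj_chart CARD('n) j \<longleftrightarrow> ?x j \<noteq> 0"
    using line_in_proj_chart[of "CARD('n)" ?x j] coord_line_nonzero_iff[of ?x j] by (auto simp: proj_chart_def)
  ultimately show ?thesis using character_ratio(1)[OF h I j k] j by simp
qed

definition from_line :: "(nat \<Rightarrow> 'k::field) set \<Rightarrow> ('n, 'k) toric_point" where
  "from_line L = from_coords (SOME x. x \<in> L)"

lemma from_line_eq: "from_line (coord_line x) = from_coords (x :: nat \<Rightarrow> 'k::field)"
proof -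
  have "(SOME y. y \<in> coord_line x) \<in> coord_line x" by (rule someI[of "\<lambda>y. y \<in> coord_line x"]) (rule coord_line_self)
  then obtain c where "c \<noteq> 0" "(SOME y. y \<in> coord_line x) = (\<lambda>i. c * x i)" by (auto simp: coord_line_def)
  then show ?thesis by (simp add: from_line_def from_coords_scale)
qed

lemma pts_toric:
  "p \<in> pts (toric_variety \<Sigma> :: (('n, 'k::field) toric_point, 'k) atlas) \<longleftrightarrow>
     (\<exists>I h. I \<subset> {..CARD('n)} \<and> p = (cone I, h) \<and> (cone I, h) \<in> orbit (cone I))"
proof -
  have "p \<in> pts (toric_variety \<Sigma>) \<longleftrightarrow> (\<exists>I. I \<subset> {..CARD('n)} \<and> p \<in> toric_open (cone I))"
    unfolding pts_def toric_variety_eq by (simp add: Bex_def \<Sigma>_cone) blast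
  also have "\<dots> \<longleftrightarrow> (\<exists>I h. I \<subset> {..CARD('n)} \<and> p = (cone I, h) \<and> (cone I, h) \<in> orbit (cone I))"
  proof
    assume "\<exists>I. I \<subset> {..CARD('n)} \<and> p \<in> toric_open (cone I)"
    then obtain I where I: "I \<subset> {..CARD('n)}" "p \<in> toric_open (cone I)" by blast
    then obtain J h where "J \<subseteq> I" "p = (cone J, h)" "(cone J, h) \<in> orbit (cone J)"
      unfolding mem_toric_open_cone[OF I(1)] by (elim exE conjE) rule
    then show "\<exists>I h. I \<subset> {..CARD('n)} \<and> p = (cone I, h) \<and> (cone I, h) \<in> orbit (cone I)"
      using I(1) by (intro exI[of _ J] exI[of _ h]) auto
  next
    assume "\<exists>I h. I \<subset> {..CARD('n)} \<and> p = (cone I, h) \<and> (cone I, h) \<in> orbit (cone I)"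
    then obtain I h where I: "I \<subset> {..CARD('n)}" "p = (cone I, h)" "(cone I, h) \<in> orbit (cone I)" by blast
    then have "p \<in> toric_open (cone I)" unfolding mem_toric_open_cone[OF I(1)] by blast
    then show "\<exists>I. I \<subset> {..CARD('n)} \<and> p \<in> toric_open (cone I)" using I(1) by blast
  qed
  finally show ?thesis .
qed

lemma pts_proj: "L \<in> pts (proj_space CARD('n)) \<longleftrightarrow> (\<exists>x j. L = coord_line x \<and> (\<forall>i>CARD('n). x i = 0) \<and> j \<le> CARD('n) \<and> x j \<noteq> (0::'k::field))"
proof
  assume "L \<in> pts (proj_space CARD('n))"
  then obtain j where j: "j \<le> CARD('n)" "L \<in> proj_chart CARD('n) j" by (auto simp: pts_def proj_space_eq)
  obtain x where "L = coord_line x" "\<forall>i>CARD('n). x i = 0" "x j \<noteq> 0" using j(2) by (rule proj_chart_cases)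
  then show "\<exists>x j. L = coord_line x \<and> (\<forall>i>CARD('n). x i = 0) \<and> j \<le> CARD('n) \<and> x j \<noteq> 0" using j(1) by blast
next
  assume "\<exists>x j. L = coord_line x \<and> (\<forall>i>CARD('n). x i = 0) \<and> j \<le> CARD('n) \<and> x j \<noteq> 0"
  then obtain x j where "L = coord_line x" "\<forall>i>CARD('n). x i = 0" "j \<le> CARD('n)" "x j \<noteq> 0" by blast
  then show "L \<in> pts (proj_space CARD('n))" using line_in_proj_chart[of "CARD('n)" x j] by (auto simp: pts_def proj_space_eq)
qed

lemma zero_set_proper:
  assumes "j \<le> CARD('n)" "x j \<noteq> 0" shows "{i. i \<le> CARD('n) \<and> x i = 0} \<subset> {..CARD('n)}"
proof (rule psubsetI)
  have "j \<in> {..CARD('n)}" "j \<notin> {i. i \<le> CARD('n) \<and> x i = 0}" using assms by auto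
  then show "{i. i \<le> CARD('n) \<and> x i = 0} \<noteq> {..CARD('n)}" by blast
qed auto

lemma to_line_from_coords:
  fixes x :: "nat \<Rightarrow> 'k::field"
  assumes "\<forall>i>CARD('n). x i = 0" "j \<le> CARD('n)" "x j \<noteq> 0"
  shows "to_line (from_coords x) = coord_line x"
proof -
  let ?I = "{i. i \<le> CARD('n) \<and> x i = 0}"
  obtain h where h: "from_coords x = (cone ?I, h)" by (simp add: from_coords_def)
  have o: "(cone ?I, h) \<in> orbit (cone ?I)" using from_coords_orbit[of x] h by simp
  have "(\<lambda>i. if i \<le> CARD('n) then h (E i - E j) else 0) = (\<lambda>i. inverse (x j) * x i)"
    using ratio_from_coords[of _ j x] assms h by (auto simp: character_def divide_inverse)
  then have "to_line (from_coords x) = coord_line (\<lambda>i. inverse (x j) * x i)"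
    using to_line_eq[OF o zero_set_proper[of j x, OF assms(2,3)] assms(2)] assms(3) h by simp
  then show ?thesis using coord_line_scale[of "inverse (x j)" x] assms(3) by simp
qed

lemma from_line_to_line:
  fixes h :: "real^'n \<Rightarrow> 'k::field"
  assumes h: "(cone I, h) \<in> orbit (cone I)" and I: "I \<subset> {..CARD('n)}"
  shows "from_line (to_line (cone I, h)) = (cone I, h)"
proof -
  obtain j where j: "j \<le> CARD('n)" "j \<notin> I" using I by auto
  let ?x = "\<lambda>i. if i \<le> CARD('n) then h (E i - E j) else 0"
  have Z: "{i. i \<le> CARD('n) \<and> ?x i = 0} = I" using character_ratio(1)[OF h I _ j] I by auto
  have "(if u \<in> perp_lattice (cone I) then \<Prod>i\<le>CARD('n). ?x i powi \<lfloor>u \<bullet> V i\<rfloor> else 0) = h u" for u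
  proof (cases "u \<in> perp_lattice (cone I)")
    case False
    then show ?thesis using orbit_hom(3)[OF h] by simp
  next
    case True
    then have u: "u \<in> int_lattice" "\<forall>i\<in>I. u \<bullet> V i = 0" by (auto simp: perp_cone)
    have "(\<Prod>i\<le>CARD('n). ?x i powi \<lfloor>u \<bullet> V i\<rfloor>) = (\<Prod>i\<in>{..CARD('n)} - I. h (E i - E j) powi \<lfloor>u \<bullet> V i\<rfloor>)"
      using u(2) by (intro prod.mono_neutral_cong_right) auto
    also have "\<dots> = (\<Prod>i\<in>{..CARD('n)} - I. h (real_of_int \<lfloor>u \<bullet> V i\<rfloor> *\<^sub>R (E i - E j)))"
      using character_ratio(2)[OF h I _ j] by (intro prod.cong refl orbit_hom_power[OF h, symmetric]) auto
    also have "\<dots> = h (\<Sum>i\<in>{..CARD('n)} - I. real_of_int \<lfloor>u \<bullet> V i\<rfloor> *\<^sub>R (E i - E j))"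
      using character_ratio(2)[OF h I _ j] perp_lattice_closed(3)
      by (intro orbit_hom_sum[OF h, THEN conjunct1, symmetric]) auto
    also have "(\<Sum>i\<in>{..CARD('n)} - I. real_of_int \<lfloor>u \<bullet> V i\<rfloor> *\<^sub>R (E i - E j)) = (\<Sum>i\<le>CARD('n). (u \<bullet> V i) *\<^sub>R (E i - E j))"
      using u exponent_int[OF u(1)] by (intro sum.mono_neutral_cong_left) auto
    also have "\<dots> = (\<Sum>i\<le>CARD('n). (u \<bullet> V i) *\<^sub>R E i) - (\<Sum>i\<le>CARD('n). u \<bullet> V i) *\<^sub>R E j"
      by (simp add: scaleR_diff_right sum_subtractf scaleR_sum_left)
    also have "\<dots> = u" using expansion[of u] sum_zero[of u] by simp
    finally show ?thesis using True by simp
  qed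
  then have "from_coords ?x = (cone I, h)" unfolding from_coords_def Z by (simp add: fun_eq_iff)
  then show ?thesis using to_line_eq[OF h I j] by (simp only: from_line_eq)
qed

lemma toric_charts: "(U, A) \<in> toric_variety \<Sigma> \<longleftrightarrow> (\<exists>I. I \<subset> {..CARD('n)} \<and> U = toric_open (cone I) \<and> A = toric_algebra (cone I))"
  unfolding toric_variety_eq image_iff Bex_def \<Sigma>_cone by blast

text \<open>
  The chart of a coordinate is the chart of the cone that omits the corresponding ray, and coordinate
  ratios pull back to characters.
\<close>

lemma to_line_morphism:
  "morphism (toric_variety \<Sigma> :: (('n, 'k::field) toric_point, 'k) atlas) (proj_space CARD('n)) to_line"
proof (rule morphismI[where T = "\<lambda>V' B. {proj_ratio i (SOME j. j \<le> CARD('n) \<and> V' = proj_chart CARD('n) j \<and> B = proj_algebra CARD('n) j) | i. i \<le> CARD('n)}"])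
  let ?At = "toric_variety \<Sigma> :: (('n, 'k) toric_point, 'k) atlas"
  let ?j = "\<lambda>V' B. SOME j. j \<le> CARD('n) \<and> V' = proj_chart CARD('n) j \<and> B = (proj_algebra CARD('n) j :: ((nat \<Rightarrow> 'k) set \<Rightarrow> 'k) set)"
  have j: "?j V' B \<le> CARD('n) \<and> V' = proj_chart CARD('n) (?j V' B) \<and> B = proj_algebra CARD('n) (?j V' B)"
    if "(V', B) \<in> proj_space CARD('n)" for V' and B :: "((nat \<Rightarrow> 'k) set \<Rightarrow> 'k) set"
    by (rule someI_ex) (use that in \<open>auto simp: proj_space_eq\<close>)
  show "B = algebra_gen {proj_ratio i (?j V' B) | i. i \<le> CARD('n)}" if "(V', B) \<in> proj_space CARD('n)" for V' and B :: "((nat \<Rightarrow> 'k) set \<Rightarrow> 'k) set"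
    using j[OF that] unfolding proj_algebra_def by blast
  show "to_line p \<in> pts (proj_space CARD('n))" if p: "p \<in> pts ?At" for p
  proof -
    obtain I h where I: "I \<subset> {..CARD('n)}" "p = (cone I, h)" "(cone I, h) \<in> orbit (cone I)" using p pts_toric by blast
    obtain k where "k \<le> CARD('n)" "k \<notin> I" using I(1) by auto
    then show ?thesis using to_line_chart[OF I(3,1)] I(2) by (auto simp: pts_def proj_space_eq)
  qed
  fix p V' and B :: "((nat \<Rightarrow> 'k) set \<Rightarrow> 'k) set"
  assume p: "p \<in> pts ?At" and VB: "(V', B) \<in> proj_space CARD('n)" and pV: "to_line p \<in> V'"
  define k where "k = ?j V' B"
  have k: "k \<le> CARD('n)" "V' = proj_chart CARD('n) k" using j[OF VB] by (auto simp: k_def)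
  obtain I h where I: "I \<subset> {..CARD('n)}" "p = (cone I, h)" "(cone I, h) \<in> orbit (cone I)" using p pts_toric by blast
  have kI: "k \<notin> I" using to_line_chart[OF I(3,1) k(1)] pV I(2) k(2) by simp
  let ?K = "{..CARD('n)} - {k}"
  have K: "?K \<subset> {..CARD('n)}" using k(1) by auto
  have point: "to_line z \<in> V' \<and> (\<forall>i\<le>CARD('n). proj_ratio i k (to_line z) = character (E i - E k) z)"
    if z: "z \<in> toric_open (cone ?K)" for z :: "('n, 'k) toric_point"
  proof -
    obtain J h where J: "J \<subseteq> ?K" "z = (cone J, h)" "(cone J, h) \<in> orbit (cone J)" using z mem_toric_open_cone[OF K] by blast
    then have J': "J \<subset> {..CARD('n)}" "k \<notin> J" using K by auto
    have "to_line z \<in> V'" using to_line_chart[OF J(3) J'(1) k(1)] J(2) J'(2) k(2) by simp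
    moreover have "proj_ratio i k (to_line z) = character (E i - E k) z" if "i \<le> CARD('n)" for i
      using that k(1) J(2) to_line_eq[OF J(3) J'(1) k(1) J'(2)] orbit_hom(4)[OF J(3)]
      by (simp add: proj_ratio_line character_def)
    ultimately show ?thesis by blast
  qed
  show "\<exists>U S r. (U, algebra_gen S) \<in> ?At \<and> p \<in> U \<and> r \<in> algebra_gen S \<and> r p \<noteq> 0 \<and> (\<forall>z\<in>U. r z \<noteq> 0 \<longrightarrow> to_line z \<in> V') \<and>
        (\<forall>b\<in>{proj_ratio i (?j V' B) | i. i \<le> CARD('n)}. \<exists>p\<in>algebra_gen S. \<exists>N. \<forall>z\<in>U. r z \<noteq> 0 \<longrightarrow> b (to_line z) = p z / r z ^ N)"
  proof (rule exI[of _ "toric_open (cone ?K)"], rule exI[of _ "{character u | u. u \<in> dual_cone (cone ?K) \<inter> int_lattice}"],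
      rule exI[of _ "\<lambda>_. 1"], intro conjI ballI)
    let ?S = "{character u | u. u \<in> dual_cone (cone ?K) \<inter> int_lattice} :: (('n, 'k) toric_point \<Rightarrow> 'k) set"
    show "(toric_open (cone ?K), algebra_gen ?S) \<in> ?At" using toric_charts K unfolding toric_algebra_def by blast
    have "I \<subseteq> ?K" using I(1) kI by auto
    then show "p \<in> toric_open (cone ?K)" using mem_toric_open_cone[OF K] I by blast
    show "(\<lambda>_. 1) \<in> algebra_gen ?S" by (rule algebra_gen_one)
    fix b :: "(nat \<Rightarrow> 'k) set \<Rightarrow> 'k" assume "b \<in> {proj_ratio i (?j V' B) | i. i \<le> CARD('n)}"
    then obtain i where i: "b = proj_ratio i k" "i \<le> CARD('n)" by (auto simp: k_def)
    have "\<forall>l\<in>?K. 0 \<le> (E i - E k) \<bullet> V l" using i(2) k(1) by (auto simp: ratio_dual)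
    then have "E i - E k \<in> dual_cone (cone ?K) \<inter> int_lattice"
      using nonneg_on_cone ratio_int[of i k] int_lattice_rat by (auto simp: dual_cone_def)
    then have "character (E i - E k) \<in> algebra_gen ?S" by (intro algebra_gen.gen) blast
    then show "\<exists>p\<in>algebra_gen ?S. \<exists>N. \<forall>z\<in>toric_open (cone ?K). (1::'k) \<noteq> 0 \<longrightarrow> b (to_line z) = p z / 1 ^ N"
      using point i by (intro bexI[of _ "character (E i - E k)"] exI[of _ 0]) auto
  qed (use point in auto)
qed

lemma from_coords_toric_open:
  fixes x :: "nat \<Rightarrow> 'k::field"
  assumes I: "I \<subset> {..CARD('n)}"
  shows "from_coords x \<in> toric_open (cone I) \<longleftrightarrow> {i. i \<le> CARD('n) \<and> x i = 0} \<subseteq> I"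
proof -
  let ?Z = "{i. i \<le> CARD('n) \<and> x i = 0}"
  obtain h where h: "from_coords x = (cone ?Z, h)" by (simp add: from_coords_def)
  show ?thesis
  proof
    assume "from_coords x \<in> toric_open (cone I)"
    then obtain J where J: "J \<subseteq> I" "cone ?Z = cone J" by (auto simp: h mem_toric_open_cone[OF I])
    then show "?Z \<subseteq> I" using V_mem_cone[of J] V_mem_cone[of ?Z] I by blast
  next
    assume "?Z \<subseteq> I"
    then show "from_coords x \<in> toric_open (cone I)"
      unfolding mem_toric_open_cone[OF I] using h from_coords_orbit[of x] by auto
  qed
qed

text \<open>
  The chart of the cone spanned by the rays in \<open>I\<close> corresponds to the open set where the coordinates
  outside \<open>I\<close> do not vanish. There a character is a monomial in the coordinate ratios with negative
  exponents only outside \<open>I\<close>, and a power of the product of these ratios clears the denominators.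
\<close>

lemma from_line_morphism:
  "morphism (proj_space CARD('n)) (toric_variety \<Sigma> :: (('n, 'k::field) toric_point, 'k) atlas) from_line"
proof (rule morphismI[where T = "\<lambda>U A. {character u | u. u \<in> dual_cone (SOME \<gamma>. \<gamma> \<in> \<Sigma> \<and> U = toric_open \<gamma> \<and> A = toric_algebra \<gamma>) \<inter> int_lattice}"])
  let ?At = "toric_variety \<Sigma> :: (('n, 'k) toric_point, 'k) atlas"
  let ?c = "\<lambda>U A. SOME \<gamma>. \<gamma> \<in> \<Sigma> \<and> U = toric_open \<gamma> \<and> A = (toric_algebra \<gamma> :: (('n, 'k) toric_point \<Rightarrow> 'k) set)"
  have c: "?c U A \<in> \<Sigma> \<and> U = toric_open (?c U A) \<and> A = toric_algebra (?c U A)" if "(U, A) \<in> ?At" for U A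
    by (rule someI_ex) (use that in \<open>auto simp: toric_variety_eq\<close>)
  show "A = algebra_gen {character u | u. u \<in> dual_cone (?c U A) \<inter> int_lattice}" if "(U, A) \<in> ?At" for U A
    using c[OF that] unfolding toric_algebra_def by blast
  show "from_line L \<in> pts ?At" if "L \<in> pts (proj_space CARD('n))" for L
  proof -
    obtain x j where x: "L = coord_line x" "j \<le> CARD('n)" "x j \<noteq> 0" using \<open>L \<in> _\<close> pts_proj by blast
    have Z: "{i. i \<le> CARD('n) \<and> x i = 0} \<subset> {..CARD('n)}" using x by auto
    obtain h where "from_coords x = (cone {i. i \<le> CARD('n) \<and> x i = 0}, h)" by (simp add: from_coords_def)
    then show ?thesis using from_coords_orbit[of x] Z by (auto simp: x(1) from_line_eq pts_toric)
  qed
  fix L U A assume L: "L \<in> pts (proj_space CARD('n))" and UA: "(U, A) \<in> ?At" and LU: "from_line L \<in> U"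
  define \<gamma> where "\<gamma> = ?c U A"
  have \<gamma>: "\<gamma> \<in> \<Sigma>" "U = toric_open \<gamma>" using c[OF UA] by (simp_all only: \<gamma>_def)
  then obtain I where I: "I \<subset> {..CARD('n)}" "\<gamma> = cone I" using \<Sigma>_cone by blast
  have U: "U = toric_open (cone I)" using \<gamma>(2) I(2) by simp
  obtain x where x: "L = coord_line x" "\<forall>i>CARD('n). x i = 0" using L pts_proj by blast
  have Zx: "{i. i \<le> CARD('n) \<and> x i = 0} \<subseteq> I" using LU by (simp add: x(1) from_line_eq U from_coords_toric_open[OF I(1)])
  obtain j where j: "j \<le> CARD('n)" "j \<notin> I" using I(1) by auto
  have xj: "x j \<noteq> 0" using Zx j by blast
  let ?S = "{proj_ratio i j | i. i \<le> CARD('n)} :: ((nat \<Rightarrow> 'k) set \<Rightarrow> 'k) set"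
  let ?r = "\<lambda>z. \<Prod>i\<in>{..CARD('n)} - I. proj_ratio i j z"
  have gen: "proj_ratio i j \<in> algebra_gen ?S" if "i \<le> CARD('n)" for i using that by (intro algebra_gen.gen) blast
  show "\<exists>V' S r. (V', algebra_gen S) \<in> proj_space CARD('n) \<and> L \<in> V' \<and> r \<in> algebra_gen S \<and> r L \<noteq> 0 \<and> (\<forall>z\<in>V'. r z \<noteq> 0 \<longrightarrow> from_line z \<in> U) \<and>
        (\<forall>b\<in>{character u | u. u \<in> dual_cone (?c U A) \<inter> int_lattice}. \<exists>p\<in>algebra_gen S. \<exists>N. \<forall>z\<in>V'. r z \<noteq> 0 \<longrightarrow> b (from_line z) = p z / r z ^ N)"
  proof (rule exI[of _ "proj_chart CARD('n) j"], rule exI[of _ ?S], rule exI[of _ ?r], intro conjI ballI impI)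
    show "(proj_chart CARD('n) j, algebra_gen ?S) \<in> proj_space CARD('n)" using j(1) by (auto simp: proj_space_eq proj_algebra_def)
    show "L \<in> proj_chart CARD('n) j" using line_in_proj_chart[OF x(2) xj] x(1) by simp
    show "?r \<in> algebra_gen ?S" using gen by (intro algebra_gen_prod) auto
    show "?r L \<noteq> 0" using Zx xj by (auto simp: x(1) proj_ratio_line prod_zero_iff)
    have mapsto: "from_coords y \<in> U" if "?r (coord_line y) \<noteq> 0" for y :: "nat \<Rightarrow> 'k"
    proof -
      have "{i. i \<le> CARD('n) \<and> y i = 0} \<subseteq> I" using that by (auto simp: proj_ratio_line prod_zero_iff)
      then show ?thesis by (simp add: U from_coords_toric_open[OF I(1)])
    qed
    show "from_line z \<in> U" if zz: "z \<in> proj_chart CARD('n) j" "?r z \<noteq> 0" for z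
    proof -
      obtain y where "z = coord_line y" using zz(1) by (rule proj_chart_cases)
      then show ?thesis using mapsto[of y] zz(2) by (simp add: from_line_eq)
    qed
    fix b :: "('n, 'k) toric_point \<Rightarrow> 'k" assume "b \<in> {character u | u. u \<in> dual_cone (?c U A) \<inter> int_lattice}"
    then obtain u where u: "b = character u" "u \<in> dual_cone (cone I)" "u \<in> int_lattice"
      unfolding \<gamma>_def[symmetric] I(2) by blast
    define a where "a i = \<lfloor>u \<bullet> V i\<rfloor>" for i
    have a0: "0 \<le> u \<bullet> V i" "0 \<le> a i" if "i \<in> I" for i
    proof -
      show "0 \<le> u \<bullet> V i" using u(2) that nonneg_on_cone unfolding dual_cone_def by blast
      then show "0 \<le> a i" by (simp add: a_def)
    qed
    \<comment> \<open>large enough to make all exponents nonnegative\<close>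
    define N where "N = nat (\<Sum>i\<le>CARD('n). \<bar>a i\<bar>)"
    have N: "0 \<le> a i + int N" if "i \<le> CARD('n)" for i
    proof -
      have "\<bar>a i\<bar> \<le> (\<Sum>i\<le>CARD('n). \<bar>a i\<bar>)" using that by (intro member_le_sum) auto
      then show ?thesis by (simp add: N_def)
    qed
    define e where "e i = (if i \<in> I then nat (a i) else nat (a i + int N))" for i
    let ?p = "\<lambda>z. \<Prod>i\<le>CARD('n). proj_ratio i j z ^ e i"
    have p: "?p \<in> algebra_gen ?S" using gen by (intro algebra_gen_prod algebra_gen_power) auto
    have "b (from_line z) = ?p z / ?r z ^ N" if z: "z \<in> proj_chart CARD('n) j" "?r z \<noteq> 0" for z
    proof -
      obtain y where y: "z = coord_line y" "\<forall>i>CARD('n). y i = 0" "y j \<noteq> 0" using z(1) by (rule proj_chart_cases)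
      have ynz: "y i \<noteq> 0" if "i \<le> CARD('n)" "i \<notin> I" for i using z(2) that by (auto simp: y(1) proj_ratio_line prod_zero_iff)
      have "b (from_line z) = (\<Prod>i\<le>CARD('n). y i powi a i)"
        unfolding u(1) y(1) from_line_eq a_def using ynz a0(1) by (intro character_from_coords u(3)) blast
      also have "\<dots> = (\<Prod>i\<le>CARD('n). (inverse (y j) * y i) powi a i)"
        unfolding a_def using y(3) by (intro prod_scale_powi[symmetric] u(3)) simp
      also have "\<dots> = (\<Prod>i\<le>CARD('n). (y i / y j) powi a i)" by (simp add: field_simps)
      finally have bz: "b (from_line z) = (\<Prod>i\<le>CARD('n). (y i / y j) powi a i)" .
      have "(\<Prod>i\<le>CARD('n). (y i / y j) powi a i) * (\<Prod>i\<in>{..CARD('n)} - I. (y i / y j) ^ N) = (\<Prod>i\<le>CARD('n). (y i / y j) ^ e i)"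
      proof -
        have "(\<Prod>i\<in>{..CARD('n)} - I. (y i / y j) ^ N) = (\<Prod>i\<le>CARD('n). if i \<in> I then 1 else (y i / y j) ^ N)"
          by (intro prod.mono_neutral_cong_left) auto
        then have "(\<Prod>i\<le>CARD('n). (y i / y j) powi a i) * (\<Prod>i\<in>{..CARD('n)} - I. (y i / y j) ^ N) =
          (\<Prod>i\<le>CARD('n). (y i / y j) powi a i * (if i \<in> I then 1 else (y i / y j) ^ N))" by (simp add: prod.distrib)
        also have "\<dots> = (\<Prod>i\<le>CARD('n). (y i / y j) ^ e i)"
        proof (intro prod.cong refl)
          fix i assume i: "i \<in> {..CARD('n)}"
          show "(y i / y j) powi a i * (if i \<in> I then 1 else (y i / y j) ^ N) = (y i / y j) ^ e i"
          proof (cases "i \<in> I")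
            case True
            then show ?thesis using a0(2)[OF True] by (simp add: e_def power_int_def)
          next
            case False
            then have "y i / y j \<noteq> 0" using ynz i y(3) by auto
            then have "(y i / y j) powi a i * (y i / y j) powi int N = (y i / y j) powi (a i + int N)" by (simp add: power_int_add)
            then show ?thesis using False N[of i] i by (simp add: e_def power_int_def)
          qed
        qed
        finally show ?thesis .
      qed
      then have "b (from_line z) * ?r z ^ N = ?p z"
        unfolding bz unfolding y(1) proj_ratio_line prod_power_distrib .
      then show ?thesis using z(2) by (simp add: nonzero_eq_divide_eq)
    qed
    then show "\<exists>p\<in>algebra_gen ?S. \<exists>N. \<forall>z\<in>proj_chart CARD('n) j. ?r z \<noteq> 0 \<longrightarrow> b (from_line z) = p z / ?r z ^ N"
      by (intro bexI[OF _ p] exI[of _ N] ballI impI)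
  qed
qed

theorem isomorphic_projective_space:
  "isomorphic (toric_variety \<Sigma> :: (('n, 'k::field) toric_point, 'k) atlas) (proj_space CARD('n))"
  unfolding isomorphic_def
proof (intro exI conjI ballI)
  show "from_line (to_line p) = p" if "p \<in> pts (toric_variety \<Sigma>)" for p :: "('n, 'k) toric_point"
    using that unfolding pts_toric by (elim exE conjE) (simp only: from_line_to_line)
  show "to_line (from_line L) = L" if "L \<in> pts (proj_space CARD('n))" for L :: "(nat \<Rightarrow> 'k) set"
  proof -
    obtain x j where x: "L = coord_line x" "\<forall>i>CARD('n). x i = 0" "j \<le> CARD('n)" "x j \<noteq> 0"
      using \<open>L \<in> _\<close> unfolding pts_proj by (elim exE conjE) rule
    then show ?thesis using to_line_from_coords[OF x(2-4)] by (simp add: from_line_eq)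
  qed
qed (rule to_line_morphism from_line_morphism)+

end

theorem projective_space_fan_isomorphic:
  fixes \<Sigma> :: "(real^'n::finite) set set"
  assumes "fan \<Sigma>" "projective_space_fan \<Sigma>"
  shows "isomorphic (toric_variety \<Sigma> :: (('n, 'k::field) toric_point, 'k) atlas) (proj_space CARD('n))"
proof -
  obtain r w :: "'n \<Rightarrow> real^'n" where rw: "\<And>i. r i \<in> int_lattice" "\<And>i. w i \<in> int_lattice"
    "\<And>i j. w i \<bullet> r j = (if i = j then 1 else 0)"
    and \<Sigma>: "\<Sigma> = {convex_cone hull S | S. S \<subset> insert (- (\<Sum>i\<in>UNIV. r i)) (range r)}"
    using assms(2) unfolding projective_space_fan_def by blast
  obtain e :: "nat \<Rightarrow> 'n" where e: "bij_betw e {1..CARD('n)} UNIV"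
    using ex_bij_betw_nat_finite_1[of "UNIV :: 'n set"] by auto
  define V where "V i = (if i = 0 then - (\<Sum>i\<in>UNIV. r i) else r (e i))" for i :: nat
  define E where "E i = (if i = 0 then 0 else w (e i))" for i :: nat
  have split: "{..CARD('n)} = insert 0 {1..CARD('n)}" by auto
  have sum_e: "(\<Sum>i=1..CARD('n). f (e i)) = (\<Sum>i\<in>UNIV. f i)" for f :: "'n \<Rightarrow> 'b::comm_monoid_add"
    by (rule sum.reindex_bij_betw[OF e])
  have ran: "r ` e ` {1..CARD('n)} = range r" using e by (simp add: bij_betw_def)
  have VR: "V ` {..CARD('n)} = insert (- (\<Sum>i\<in>UNIV. r i)) (range r)"
  proof -
    have "V ` {1..CARD('n)} = r ` e ` {1..CARD('n)}" unfolding image_image by (intro image_cong) (auto simp: V_def)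
    then show ?thesis unfolding split image_insert ran by (simp add: V_def)
  qed
  interpret simplex_fan \<Sigma> V E
  proof
    show "fan \<Sigma>" by (rule assms(1))
    show "V i \<in> int_lattice" for i by (auto simp: V_def rw int_lattice_uminus int_lattice_sum)
    show "E i \<in> int_lattice" for i by (auto simp: E_def rw)
    show "E i \<bullet> V l = of_bool (i = l) - of_bool (l = 0)" if il: "i \<le> CARD('n)" "l \<le> CARD('n)" for i l
    proof (cases "i = 0 \<or> l = 0")
      case True
      then show ?thesis by (auto simp: E_def V_def inner_sum_right rw(3))
    next
      case False
      then have "e i = e l \<longleftrightarrow> i = l" using il e by (auto simp: bij_betw_def inj_on_eq_iff)
      then show ?thesis using False by (simp add: E_def V_def rw(3))
    qed
    show "u = (\<Sum>i\<le>CARD('n). (u \<bullet> V i) *\<^sub>R E i)" for u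
    proof -
      have "(\<Sum>i\<le>CARD('n). (u \<bullet> V i) *\<^sub>R E i) = (\<Sum>i=1..CARD('n). (u \<bullet> r (e i)) *\<^sub>R w (e i))"
        unfolding split by (simp add: E_def V_def)
      also have "\<dots> = (\<Sum>i\<in>UNIV. (u \<bullet> r i) *\<^sub>R w i)" by (rule sum_e)
      also have "\<dots> = u"
        using dual_basis_expansion(1)[of r w u] rw(3) by (simp add: inner_commute eq_commute)
      finally show ?thesis by simp
    qed
    show "(\<Sum>i\<le>CARD('n). u \<bullet> V i) = 0" for u
    proof -
      have "(\<Sum>i\<le>CARD('n). u \<bullet> V i) = u \<bullet> V 0 + (\<Sum>i=1..CARD('n). u \<bullet> r (e i))"
        unfolding split by (simp add: V_def)
      also have "(\<Sum>i=1..CARD('n). u \<bullet> r (e i)) = (\<Sum>i\<in>UNIV. u \<bullet> r i)" by (rule sum_e)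
      finally show ?thesis by (simp add: V_def inner_sum_right)
    qed
    have injV: "inj_on V {..CARD('n)}"
    proof (rule eq_card_imp_inj_on)
      have "- (\<Sum>i\<in>UNIV. r i) \<notin> range r"
      proof
        assume "- (\<Sum>i\<in>UNIV. r i) \<in> range r"
        then obtain k where "- (\<Sum>i\<in>UNIV. r i) = r k" by auto
        then have "w k \<bullet> (- (\<Sum>i\<in>UNIV. r i)) = 1" by (simp add: rw(3))
        then show False by (simp add: inner_sum_right rw(3))
      qed
      then show "card (V ` {..CARD('n)}) = card {..CARD('n)}"
        using dual_basis_expansion(3)[OF rw(3)] by (simp add: VR card_image)
    qed simp
    show "\<Sigma> = {convex_cone hull (V ` I) | I. I \<subset> {..CARD('n)}}"
    proof (intro subset_antisym subsetI)
      fix \<gamma> assume "\<gamma> \<in> \<Sigma>"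
      then obtain S where S: "S \<subset> V ` {..CARD('n)}" "\<gamma> = convex_cone hull S" unfolding \<Sigma> VR by blast
      then have "S = V ` ({..CARD('n)} \<inter> V -` S)" by blast
      moreover have "{..CARD('n)} \<inter> V -` S \<subset> {..CARD('n)}" using S(1) by blast
      ultimately show "\<gamma> \<in> {convex_cone hull (V ` I) | I. I \<subset> {..CARD('n)}}" using S(2) by (metis (mono_tags, lifting) mem_Collect_eq)
    next
      fix \<gamma> assume "\<gamma> \<in> {convex_cone hull (V ` I) | I. I \<subset> {..CARD('n)}}"
      then obtain I where I: "I \<subset> {..CARD('n)}" "\<gamma> = convex_cone hull (V ` I)" by blast
      have "V ` I \<subset> V ` {..CARD('n)}" using image_strict_mono[OF injV I(1)] .
      then show "\<gamma> \<in> \<Sigma>" unfolding \<Sigma> VR using I(2) by blast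
    qed
  qed
  show ?thesis by (rule isomorphic_projective_space)
qed

section \<open>Generation of the dual semigroups\<close>

lemma (in complete_fan) QCartier_rational_datum:
  assumes "T_QCartier \<Sigma> D" "\<sigma> \<in> maximal_cones \<Sigma>"
  shows "\<exists>u. u \<in> rat_vectors \<and> local_datum D \<sigma> u"
proof -
  obtain m :: nat where m: "m > 0" "T_Cartier \<Sigma> (\<lambda>\<rho>. real m * D \<rho>)"
    using assms(1) by (auto simp: T_QCartier_def)
  obtain w where w: "w \<in> int_lattice" "local_datum (\<lambda>\<rho>. real m * D \<rho>) \<sigma> w"
    using m(2) assms(2) by (auto simp: T_Cartier_def)
  have "(1 / real m) *\<^sub>R w \<in> rat_vectors"
    using w(1) by (intro rat_vectors_scale int_lattice_rat) auto
  moreover have "local_datum D \<sigma> ((1 / real m) *\<^sub>R w)"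
    using w(2) m(1) by (auto simp: local_datum_def)
  ultimately show ?thesis by blast
qed

theorem theorem2:
  fixes \<Sigma> :: "(real^'n::finite) set set" and D D' :: "'n T_divisor"
  assumes "fan \<Sigma>"
    and "projective (toric_variety \<Sigma> :: (('n, 'k::alg_closed_field) toric_point, 'k) atlas)"
    and "\<not> isomorphic (toric_variety \<Sigma> :: (('n, 'k) toric_point, 'k) atlas) (proj_space CARD('n))"
    and "T_QCartier \<Sigma> D" and "T_QCartier \<Sigma> D'"
    and "divisor_le \<Sigma> D' (\<lambda>_. 0)" and "divisor_le \<Sigma> canonical_divisor D'"
    and "\<And>C :: ('n, 'k) toric_point set.
           T_curve \<Sigma> C \<Longrightarrow> real CARD('n) + 1 \<le> intersection_number \<Sigma> D C"
  shows "\<forall>\<sigma>\<in>maximal_cones \<Sigma>.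
           generates_semigroup
             (shifted_polytope \<Sigma> (\<lambda>\<rho>. D \<rho> + D' \<rho>) \<sigma> \<inter> int_lattice)
             (dual_cone \<sigma> \<inter> int_lattice)"
proof -
  interpret complete_fan \<Sigma>
    using assms(1) projective_imp_complete[OF assms(1,2)] by unfold_locales
  obtain uD where uD: "\<And>\<sigma>. \<sigma> \<in> maximal_cones \<Sigma> \<Longrightarrow> uD \<sigma> \<in> rat_vectors \<and> local_datum D \<sigma> (uD \<sigma>)"
    using QCartier_rational_datum[OF assms(4)] by metis
  obtain uD' where uD': "\<And>\<sigma>. \<sigma> \<in> maximal_cones \<Sigma> \<Longrightarrow> uD' \<sigma> \<in> rat_vectors \<and> local_datum D' \<sigma> (uD' \<sigma>)"
    using QCartier_rational_datum[OF assms(5)] by metis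
  interpret adjoint_fan \<Sigma> D uD D' uD'
  proof
    show "\<exists>c\<ge>real CARD('n) + 1. uD \<tau> = uD \<sigma> + c *\<^sub>R g"
      if \<sigma>: "\<sigma> \<in> maximal_cones \<Sigma>" and \<tau>: "\<tau> \<in> maximal_cones \<Sigma>" "\<tau> \<noteq> \<sigma>"
        and g: "g \<in> facet_normals \<sigma>" and eq: "\<sigma> \<inter> \<tau> = \<sigma> \<inter> {x. g \<bullet> x = 0}" for \<sigma> \<tau> g
    proof -
      let ?\<omega> = "\<sigma> \<inter> {x. g \<bullet> x = 0}"
      have "?\<omega> \<in> \<Sigma>"
        using face_in_fan facet_normal_cone_face g \<sigma> maximalD(1) rational by blast
      then have "T_curve \<Sigma> (orbit_closure \<Sigma> ?\<omega> :: ('n, 'k) toric_point set)"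
        using g unfolding T_curve_def facet_normals_def by blast
      then have "real CARD('n) + 1 \<le> intersection_number \<Sigma> D (orbit_closure \<Sigma> ?\<omega> :: ('n, 'k) toric_point set)"
        by (rule assms(8))
      moreover obtain c where "uD \<tau> = uD \<sigma> + c *\<^sub>R g"
        "intersection_number \<Sigma> D (orbit_closure \<Sigma> ?\<omega> :: ('n, 'k) toric_point set) = c"
        using intersection_number_wall[OF \<sigma> \<tau> g eq assms(4), where 'k='k] uD \<sigma> \<tau>(1) by blast
      ultimately show ?thesis by (intro exI[of _ c]) simp
    qed
    show "\<not> projective_space_fan \<Sigma>"
      using assms(1,3) projective_space_fan_isomorphic by blast
  qed (use uD uD' assms(6,7) in \<open>auto simp: divisor_le_def canonical_divisor_def\<close>)
  show ?thesis using shifted_polytope_generates uD uD' by blast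
qed

end
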